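(* Let $k$ be a field of characteristic $2$ containing a primitive third root of unity $\zeta$ (i.e., $\mathbb{F}_4\subseteq k$). Let $A_4$ be the alternating group on $4$ letters and let $V$ be its Sylow $2$-subgroup, the Klein four group. Then $$\text{simple ghost number of } kA_4 = \text{ghost number of } kV = 2,$$ and $$2 \leq \text{ghost number of } kA_4 \leq 4.$$
   Context: For a finite group $H$ and a field $k$ whose characteristic divides $|H|$, $\mathsf{StMod}(kH)$ is the stable module category: objects are $kH$-modules, and $\underline{\mathrm{Hom}}(M,N)$ is $\mathrm{Hom}_{kH}(M,N)$ modulo maps factoring through a projective. It is triangulated; $\Omega M$ (the kernel of a surjection from a projective onto $M$) is the desuspension of $M$, and $\Omega^i$ is defined for all $i\in\mathbb{Z}$. $\mathsf{stmod}(kH)$ is the full subcategory of modules stably isomorphic to finitely generated ones. $\mathsf{Thick}\langle k\rangle$ is the smallest full triangulated subcategory of $\mathsf{StMod}(kH)$ closed under retracts and containing the trivial module $k$. A map $f$ is a ghost if $\underline{\mathrm{Hom}}(\Omega^i k, f)=0$ for all $i\in\mathbb{Z}$, and a simple ghost if $\underline{\mathrm{Hom}}(\Omega^i S, f)=0$ for all simple modules $S$ and all $i\in\mathbb{Z}$. The ghost number of $kH$ is the smallest $n$ such that every composite of $n$ ghosts in $\mathsf{Thick}\langle k\rangle$ is stably zero. The simple ghost number of $kH$ is the smallest $n$ such that every composite of $n$ simple ghosts in $\mathsf{stmod}(kH)$ is stably zero. *)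

theory Defs
  imports "HOL-Algebra.Module" "HOL-Algebra.AbelCoset" "HOL-Algebra.Sym_Groups"
    "HOL-Computational_Algebra.Primes" "HOL-Library.Extended_Nat"
begin

section \<open>Left modules over a ring\<close>

text \<open>The library locale \<^locale>\<open>module\<close> is restricted to commutative rings, so the same axioms are
  restated over an arbitrary ring; the record type of modules, \<^locale>\<open>submodule\<close> and
  \<^const>\<open>a_kernel\<close> are the library's. Throughout, a type \<open>'u\<close> plays the role of the universe
  in which the carriers of the modules live. Homomorphisms are functions on this type, only their
  values on the carrier of the source being relevant.\<close>

locale left_module = R?: ring R + M?: abelian_group M
  for R :: "('r, 'a) ring_scheme" (structure) and M :: "('r, 'u, 'b) module_scheme" (structure) +
  assumes smult_closed [simp, intro]:
      "\<lbrakk>a \<in> carrier R; x \<in> carrier M\<rbrakk> \<Longrightarrow> a \<odot>\<^bsub>M\<^esub> x \<in> carrier M"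
    and smult_l_distr:
      "\<lbrakk>a \<in> carrier R; b \<in> carrier R; x \<in> carrier M\<rbrakk> \<Longrightarrow>
      (a \<oplus> b) \<odot>\<^bsub>M\<^esub> x = a \<odot>\<^bsub>M\<^esub> x \<oplus>\<^bsub>M\<^esub> b \<odot>\<^bsub>M\<^esub> x"
    and smult_r_distr:
      "\<lbrakk>a \<in> carrier R; x \<in> carrier M; y \<in> carrier M\<rbrakk> \<Longrightarrow>
      a \<odot>\<^bsub>M\<^esub> (x \<oplus>\<^bsub>M\<^esub> y) = a \<odot>\<^bsub>M\<^esub> x \<oplus>\<^bsub>M\<^esub> a \<odot>\<^bsub>M\<^esub> y"
    and smult_assoc1:
      "\<lbrakk>a \<in> carrier R; b \<in> carrier R; x \<in> carrier M\<rbrakk> \<Longrightarrow>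
      (a \<otimes> b) \<odot>\<^bsub>M\<^esub> x = a \<odot>\<^bsub>M\<^esub> (b \<odot>\<^bsub>M\<^esub> x)"
    and smult_one [simp]:
      "x \<in> carrier M \<Longrightarrow> \<one> \<odot>\<^bsub>M\<^esub> x = x"

definition left_module_hom :: "'r ring \<Rightarrow> ('r, 'u) module \<Rightarrow> ('r, 'v) module \<Rightarrow> ('u \<Rightarrow> 'v) set" where
  "left_module_hom R M N = {f \<in> carrier M \<rightarrow> carrier N.
     (\<forall>x\<in>carrier M. \<forall>y\<in>carrier M. f (x \<oplus>\<^bsub>M\<^esub> y) = f x \<oplus>\<^bsub>N\<^esub> f y) \<and>
     (\<forall>a\<in>carrier R. \<forall>x\<in>carrier M. f (a \<odot>\<^bsub>M\<^esub> x) = a \<odot>\<^bsub>N\<^esub> f x)}"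

definition left_module_isomorphic :: "'r ring \<Rightarrow> ('r, 'u) module \<Rightarrow> ('r, 'v) module \<Rightarrow> bool" where
  "left_module_isomorphic R M N \<longleftrightarrow>
     (\<exists>f \<in> left_module_hom R M N. bij_betw f (carrier M) (carrier N))"

definition short_exact_sequence ::
  "'r ring \<Rightarrow> ('r, 'u) module \<Rightarrow> ('r, 'u) module \<Rightarrow> ('r, 'u) module \<Rightarrow> ('u \<Rightarrow> 'u) \<Rightarrow> ('u \<Rightarrow> 'u) \<Rightarrow> bool"
where
  "short_exact_sequence R A B C f g \<longleftrightarrow>
     left_module R A \<and> left_module R B \<and> left_module R C \<and>
     f \<in> left_module_hom R A B \<and> g \<in> left_module_hom R B C \<and>
     inj_on f (carrier A) \<and> f ` carrier A = a_kernel B C g \<and> g ` carrier B = carrier C"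

text \<open>The lifting property is tested against modules in the universe \<open>'u\<close>. If \<open>'u\<close> is infinite and
  at least as large as the ring, every module in \<open>'u\<close> has a free cover in \<open>'u\<close>, and this
  is projectivity in the absolute sense; in a small universe it may be weaker.\<close>

definition projective_module :: "'r ring \<Rightarrow> ('r, 'u) module \<Rightarrow> bool" where
  "projective_module R P \<longleftrightarrow> left_module R P \<and>
     (\<forall>(B :: ('r, 'u) module) (C :: ('r, 'u) module). \<forall>g \<in> left_module_hom R B C.
        \<forall>h \<in> left_module_hom R P C.
        left_module R B \<and> left_module R C \<and> g ` carrier B = carrier C \<longrightarrow>
        (\<exists>h' \<in> left_module_hom R P B. \<forall>x\<in>carrier P. g (h' x) = h x))"

definition simple_module :: "'r ring \<Rightarrow> ('r, 'u) module \<Rightarrow> bool" where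
  "simple_module R S \<longleftrightarrow> left_module R S \<and> carrier S \<noteq> {\<zero>\<^bsub>S\<^esub>} \<and>
     (\<forall>H. submodule H R S \<longrightarrow> H = {\<zero>\<^bsub>S\<^esub>} \<or> H = carrier S)"

definition finitely_generated_module :: "'r ring \<Rightarrow> ('r, 'u) module \<Rightarrow> bool" where
  "finitely_generated_module R M \<longleftrightarrow> left_module R M \<and>
     (\<exists>X. finite X \<and> X \<subseteq> carrier M \<and> (\<forall>H. submodule H R M \<and> X \<subseteq> H \<longrightarrow> H = carrier M))"


section \<open>The stable module category\<close>

definition stably_zero :: "'r ring \<Rightarrow> ('r, 'u) module \<Rightarrow> ('r, 'u) module \<Rightarrow> ('u \<Rightarrow> 'u) \<Rightarrow> bool" where
  "stably_zero R M N f \<longleftrightarrow> (\<exists>P :: ('r, 'u) module. projective_module R P \<and>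
     (\<exists>a \<in> left_module_hom R M P. \<exists>b \<in> left_module_hom R P N. \<forall>x\<in>carrier M. f x = b (a x)))"

text \<open>Equality of the classes of \<open>f\<close> and \<open>g\<close> in the stable Hom group from \<open>M\<close> to \<open>N\<close>:\<close>

definition stably_equal ::
  "'r ring \<Rightarrow> ('r, 'u) module \<Rightarrow> ('r, 'u) module \<Rightarrow> ('u \<Rightarrow> 'u) \<Rightarrow> ('u \<Rightarrow> 'u) \<Rightarrow> bool" where
  "stably_equal R M N f g \<longleftrightarrow> stably_zero R M N (\<lambda>x. f x \<ominus>\<^bsub>N\<^esub> g x)"

definition stable_isomorphism ::
  "'r ring \<Rightarrow> ('r, 'u) module \<Rightarrow> ('r, 'u) module \<Rightarrow> ('u \<Rightarrow> 'u) \<Rightarrow> bool" where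
  "stable_isomorphism R M N f \<longleftrightarrow> f \<in> left_module_hom R M N \<and>
     (\<exists>g \<in> left_module_hom R N M. stably_equal R M M (g \<circ> f) id \<and> stably_equal R N N (f \<circ> g) id)"

definition stable_retract :: "'r ring \<Rightarrow> ('r, 'u) module \<Rightarrow> ('r, 'u) module \<Rightarrow> bool" where
  "stable_retract R M N \<longleftrightarrow> left_module R M \<and> left_module R N \<and>
     (\<exists>i \<in> left_module_hom R M N. \<exists>r \<in> left_module_hom R N M. stably_equal R M M (r \<circ> i) id)"

definition stmod :: "'r ring \<Rightarrow> ('r, 'u) module set" where
  "stmod R = {M. left_module R M \<and>
     (\<exists>N f. finitely_generated_module R N \<and> stable_isomorphism R M N f)}"

text \<open>\<open>is_syzygy R M K\<close> says that \<open>K\<close> is a choice of \<open>\<Omega> M\<close>. Such a choice depends on a projective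
  cover and is unique only up to stable isomorphism, so \<open>\<Omega>\<close> and its powers are relations. A choice
  of \<open>\<Omega>\<close> to a negative power \<open>-n\<close> of \<open>M\<close> is a module of which \<open>M\<close> is an \<open>n\<close>-th syzygy.\<close>

definition is_syzygy :: "'r ring \<Rightarrow> ('r, 'u) module \<Rightarrow> ('r, 'u) module \<Rightarrow> bool" where
  "is_syzygy R M K \<longleftrightarrow> (\<exists>P i p. projective_module R P \<and> short_exact_sequence R K P M i p)"

definition is_Omega :: "'r ring \<Rightarrow> int \<Rightarrow> ('r, 'u) module \<Rightarrow> ('r, 'u) module \<Rightarrow> bool" where
  "is_Omega R i M N \<longleftrightarrow>
     (if 0 \<le> i then (is_syzygy R ^^ nat i) M N else (is_syzygy R ^^ nat (- i)) N M)"

text \<open>The exact triangles of the stable category are the triangles stably isomorphic to those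
  induced by short exact sequences of modules. Only the first two maps of a triangle
  \<open>X \<rightarrow> Y \<rightarrow> Z\<close> (followed by the connecting map from \<open>Z\<close> to the suspension of \<open>X\<close>) are recorded:
  the connecting map can be transported along the isomorphism and plays no role in the
  closure properties below.\<close>

definition exact_triangle ::
  "'r ring \<Rightarrow> ('r, 'u) module \<Rightarrow> ('r, 'u) module \<Rightarrow> ('r, 'u) module \<Rightarrow> ('u \<Rightarrow> 'u) \<Rightarrow> ('u \<Rightarrow> 'u) \<Rightarrow> bool"
where
  "exact_triangle R X Y Z u v \<longleftrightarrow>
     left_module R X \<and> left_module R Y \<and> left_module R Z \<and>
     u \<in> left_module_hom R X Y \<and> v \<in> left_module_hom R Y Z \<and>
     (\<exists>A B C f g a b c. short_exact_sequence R A B C f g \<and>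
        stable_isomorphism R A X a \<and> stable_isomorphism R B Y b \<and> stable_isomorphism R C Z c \<and>
        stably_equal R A Y (u \<circ> a) (b \<circ> f) \<and> stably_equal R B Z (v \<circ> b) (c \<circ> g))"

text \<open>A full subcategory is given by its set of objects. It is a triangulated subcategory if it is
  closed under \<open>\<Omega>\<close>, its inverse, and cones; closure under stable isomorphism is a special case of
  closure under retracts.\<close>

definition thick_subcategory :: "'r ring \<Rightarrow> ('r, 'u) module set \<Rightarrow> bool" where
  "thick_subcategory R \<C> \<longleftrightarrow>
     (\<forall>M\<in>\<C>. left_module R M) \<and>
     (\<forall>M K. M \<in> \<C> \<and> is_syzygy R M K \<longrightarrow> K \<in> \<C>) \<and>
     (\<forall>M K. K \<in> \<C> \<and> is_syzygy R M K \<longrightarrow> M \<in> \<C>) \<and>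
     (\<forall>X Y Z u v. exact_triangle R X Y Z u v \<and> X \<in> \<C> \<and> Y \<in> \<C> \<longrightarrow> Z \<in> \<C>) \<and>
     (\<forall>M N. N \<in> \<C> \<and> stable_retract R M N \<longrightarrow> M \<in> \<C>)"

definition Thick :: "'r ring \<Rightarrow> ('r, 'u) module set \<Rightarrow> ('r, 'u) module set" where
  "Thick R \<S> = \<Inter>{\<C>. thick_subcategory R \<C> \<and> \<S> \<subseteq> \<C>}"


section \<open>Ghosts\<close>

text \<open>\<open>f : M \<rightarrow> N\<close> induces the zero map on stable homomorphisms from all \<open>\<Omega>\<close>-powers of objects
  in \<open>\<S>\<close>.\<close>

definition is_ghost_wrt ::
  "'r ring \<Rightarrow> ('r, 'u) module set \<Rightarrow> ('r, 'u) module \<Rightarrow> ('r, 'u) module \<Rightarrow> ('u \<Rightarrow> 'u) \<Rightarrow> bool" where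
  "is_ghost_wrt R \<S> M N f \<longleftrightarrow> f \<in> left_module_hom R M N \<and>
     (\<forall>S\<in>\<S>. \<forall>i X. is_Omega R i S X \<longrightarrow>
        (\<forall>g \<in> left_module_hom R X M. stably_zero R X N (f \<circ> g)))"

primrec composite :: "(nat \<Rightarrow> 'u \<Rightarrow> 'u) \<Rightarrow> nat \<Rightarrow> 'u \<Rightarrow> 'u" where
  "composite f 0 = id"
| "composite f (Suc n) = f n \<circ> composite f n"

text \<open>The smallest \<open>n\<close> such that every composite \<open>M 0 \<rightarrow> \<dots> \<rightarrow> M n\<close> of \<open>n\<close> ghosts between objects of
  \<open>\<C>\<close> is stably zero, and \<open>\<infinity>\<close> if there is no such \<open>n\<close>.\<close>

definition ghost_number_wrt :: "'r ring \<Rightarrow> ('r, 'u) module set \<Rightarrow> ('r, 'u) module set \<Rightarrow> enat" where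
  "ghost_number_wrt R \<S> \<C> = Inf {enat n | n. \<forall>M f.
     (\<forall>i\<le>n. M i \<in> \<C>) \<and> (\<forall>i<n. is_ghost_wrt R \<S> (M i) (M (Suc i)) (f i)) \<longrightarrow>
     stably_zero R (M 0) (M n) (composite f n)}"


section \<open>Group algebras\<close>

definition group_algebra :: "'g monoid \<Rightarrow> ('g \<Rightarrow> 'k::field) ring" where
  "group_algebra G = \<lparr>
     carrier = {a. \<forall>g. g \<notin> carrier G \<longrightarrow> a g = 0},
     monoid.mult = (\<lambda>a b g. \<Sum>(h, l) \<in> {(h, l). h \<in> carrier G \<and> l \<in> carrier G \<and> h \<otimes>\<^bsub>G\<^esub> l = g}.
       a h * b l),
     one = (\<lambda>g. if g = \<one>\<^bsub>G\<^esub> then 1 else 0),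
     zero = (\<lambda>g. 0),
     add = (\<lambda>a b g. a g + b g)\<rparr>"

text \<open>The fields \<open>mult\<close> and \<open>one\<close> of a module record are irrelevant.\<close>

definition trivial_module :: "'g monoid \<Rightarrow> ('g \<Rightarrow> 'k::field, 'k) module" where
  "trivial_module G = \<lparr>carrier = UNIV, monoid.mult = (*), one = 1, zero = 0, add = (+),
     smult = (\<lambda>a x. (\<Sum>g\<in>carrier G. a g) * x)\<rparr>"

text \<open>The isomorphic copies of the trivial module in the universe \<open>'u\<close>:\<close>

definition trivial_modules :: "'g monoid \<Rightarrow> ('g \<Rightarrow> 'k::field, 'u) module set" where
  "trivial_modules G = {T. left_module (group_algebra G) T \<and>
     left_module_isomorphic (group_algebra G) T (trivial_module G)}"

definition ghost_number :: "'k::field itself \<Rightarrow> 'u itself \<Rightarrow> 'g monoid \<Rightarrow> enat" where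
  "ghost_number _ _ G = (let R = (group_algebra G :: ('g \<Rightarrow> 'k) ring);
       \<S> = (trivial_modules G :: ('g \<Rightarrow> 'k, 'u) module set)
     in ghost_number_wrt R \<S> (Thick R \<S>))"

definition simple_ghost_number :: "'k::field itself \<Rightarrow> 'u itself \<Rightarrow> 'g monoid \<Rightarrow> enat" where
  "simple_ghost_number _ _ G = (let R = (group_algebra G :: ('g \<Rightarrow> 'k) ring);
       \<S> = {S :: ('g \<Rightarrow> 'k, 'u) module. simple_module R S}
     in ghost_number_wrt R \<S> (stmod R))"

definition sylow_subgroup :: "nat \<Rightarrow> 'g set \<Rightarrow> 'g monoid \<Rightarrow> bool" where
  "sylow_subgroup p P G \<longleftrightarrow> prime p \<and> subgroup P G \<and> card P = p ^ multiplicity p (order G)"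

end

theory Submission
  imports Defs "HOL-Algebra.Multiplicative_Group"
begin

text \<open>By Higman's criterion a homomorphism is stably zero iff it is the trace \<open>\<Sum>g. g h g\<^sup>-\<^sup>1\<close> of a
  \<open>k\<close>-linear map \<open>h\<close>, so that stable vanishing becomes linear algebra, independent of the universe.

  Upper bounds: a map of \<open>kA\<^sub>4\<close>-modules which is a simple ghost, or of \<open>kV\<close>-modules which is a ghost, sends
  \<open>V\<close>-invariants to norms from \<open>V\<close>. The composite of two maps with this property is a trace from \<open>V\<close>, because
  each of them allows one to clear one radical layer by subtracting a trace, and the radical of \<open>kV\<close> has
  cube zero; as the index of \<open>V\<close> is odd, it is then a trace from the whole group. Over \<open>A\<^sub>4\<close> the two nontrivial
  simple modules are the summands of \<open>rad P / soc P\<close>, where \<open>P\<close> is the projective cover of \<open>k\<close>; this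
  quotient is the cone of a map \<open>k \<rightarrow> \<Omega>k\<close>, and therefore a composite of two ghosts is a simple ghost.

  Lower bounds: let \<open>L\<close> be the quotient of \<open>P\<close> of dimension two with top \<open>k\<close> and a nontrivial simple socle.
  It is periodic up to a twist, and its top maps to the socle of \<open>\<Omega>L\<close>. This map \<open>L \<rightarrow> \<Omega>L\<close> kills the
  socle of \<open>L\<close>, hence every map from a simple module; by dimension shifting it stably kills all maps from
  \<open>\<Omega>\<close>-powers of simple modules. It is not a trace, and \<open>L\<close> lies in the thick subcategory
  generated by \<open>k\<close>.\<close>

section \<open>The group algebra\<close>

text \<open>Modules may be infinite-dimensional, even those in \<open>stmod\<close>, so no bases or
  decompositions into indecomposables are available. Sections and lifts are chosen by Zorn's lemma;
  they are only linear, and equivariance is restored by taking traces. The upper bounds read the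
  ghost conditions only in degrees 0 and \<plusminus>1: a map out of a line picks an invariant, and
  a trace sends invariants to norms.

  A second obstacle is the universe. The module through which a trace factors consists of functions
  on the group, so it has to be copied back into \<open>'u\<close>, which is possible when
  \<open>'u\<close> is infinite.

  The explicit modules come from the permutation module on the field with four elements, written in
  power moments. These coordinates diagonalise the stabiliser of 0, display the radical layers, and
  turn traces into power sums: over the four elements b, the sum of b^k is 0 for k = 0, 1, 2 and 1
  for k = 3. This yields both the projectivity of P and the vanishing of all traces between twists
  of L. The twist by \<chi>^j stays a parameter because passing from L to \<Omega>L raises j by 2;
  for the group of translations \<chi> is 1 and the same formulas apply.\<close>

locale finite_group = group G for G :: "'g monoid" (structure) +
  fixes K :: "'k::field itself"
  assumes finite_carrier [simp]: "finite (carrier G)"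
begin

abbreviation R where "R \<equiv> (group_algebra G :: (_ \<Rightarrow> 'k) ring)"

definition delta :: "'g \<Rightarrow> 'k \<Rightarrow> 'g \<Rightarrow> 'k" where
  "delta g c = (\<lambda>x. if x = g then c else 0)"

lemma R_simps:
  "a \<in> carrier R \<longleftrightarrow> (\<forall>g. g \<notin> carrier G \<longrightarrow> a g = 0)"
  "\<zero>\<^bsub>R\<^esub> = (\<lambda>g. 0)"
  "\<one>\<^bsub>R\<^esub> = delta \<one> 1"
  "a \<oplus>\<^bsub>R\<^esub> b = (\<lambda>g. a g + b g)"
  by (simp_all add: group_algebra_def delta_def)

lemma delta_closed [simp]: "g \<in> carrier G \<Longrightarrow> delta g c \<in> carrier R"
  by (simp add: R_simps delta_def)

lemma R_mult_outside: "g \<notin> carrier G \<Longrightarrow> (a \<otimes>\<^bsub>R\<^esub> b) g = 0"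
  by (auto simp: group_algebra_def intro!: sum.neutral)

lemma R_mult:
  assumes "g \<in> carrier G"
  shows "(a \<otimes>\<^bsub>R\<^esub> b) g = (\<Sum>h\<in>carrier G. a h * b (inv h \<otimes> g))"
proof -
  have "{(h, l). h \<in> carrier G \<and> l \<in> carrier G \<and> h \<otimes> l = g} = (\<lambda>h. (h, inv h \<otimes> g)) ` carrier G"
    using assms by (auto simp: image_iff inv_solve_left' m_assoc[symmetric])
  moreover have "inj_on (\<lambda>h. (h, inv h \<otimes> g)) (carrier G)"
    by (auto simp: inj_on_def)
  ultimately show ?thesis
    by (simp add: group_algebra_def sum.reindex)
qed

lemma sum_left_translate:
  assumes "x \<in> carrier G"
  shows "(\<Sum>h\<in>carrier G. f (x \<otimes> h)) = (\<Sum>h\<in>carrier G. f h)"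
  by (rule sum.reindex_bij_witness[where i = "\<lambda>h. inv x \<otimes> h" and j = "\<lambda>h. x \<otimes> h"])
     (use assms in \<open>auto simp: m_assoc[symmetric]\<close>)

lemma delta_mult:
  assumes "g \<in> carrier G" "h \<in> carrier G"
  shows "delta g c \<otimes>\<^bsub>R\<^esub> delta h d = delta (g \<otimes> h) (c * d)"
proof
  fix x
  show "(delta g c \<otimes>\<^bsub>R\<^esub> delta h d) x = delta (g \<otimes> h) (c * d) x"
  proof (cases "x \<in> carrier G")
    case True
    have "(delta g c \<otimes>\<^bsub>R\<^esub> delta h d) x
      = (\<Sum>y\<in>carrier G. if y = g then c * delta h d (inv g \<otimes> x) else 0)"
      unfolding R_mult[OF True] by (intro sum.cong) (auto simp: delta_def)
    also have "\<dots> = c * delta h d (inv g \<otimes> x)"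
      using assms by simp
    also have "\<dots> = delta (g \<otimes> h) (c * d) x"
      using assms True by (auto simp: delta_def inv_solve_left')
    finally show ?thesis .
  next
    case False
    then show ?thesis using assms by (auto simp: R_mult_outside delta_def)
  qed
qed

lemma R_ring: "ring R"
proof (rule ringI)
  show "abelian_group R"
  proof (rule abelian_groupI)
    fix x assume "x \<in> carrier R"
    then have "(\<lambda>g. - x g) \<in> carrier R" "(\<lambda>g. - x g) \<oplus>\<^bsub>R\<^esub> x = \<zero>\<^bsub>R\<^esub>"
      by (auto simp: R_simps)
    then show "\<exists>y\<in>carrier R. y \<oplus>\<^bsub>R\<^esub> x = \<zero>\<^bsub>R\<^esub>" by blast
  qed (auto simp: R_simps algebra_simps)
  show "monoid R"
  proof
    fix a b c assume abc: "a \<in> carrier R" "b \<in> carrier R" "c \<in> carrier R"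
    show "a \<otimes>\<^bsub>R\<^esub> b \<otimes>\<^bsub>R\<^esub> c = a \<otimes>\<^bsub>R\<^esub> (b \<otimes>\<^bsub>R\<^esub> c)"
    proof
      fix g
      show "(a \<otimes>\<^bsub>R\<^esub> b \<otimes>\<^bsub>R\<^esub> c) g = (a \<otimes>\<^bsub>R\<^esub> (b \<otimes>\<^bsub>R\<^esub> c)) g"
      proof (cases "g \<in> carrier G")
        case True
        have "(a \<otimes>\<^bsub>R\<^esub> b \<otimes>\<^bsub>R\<^esub> c) g
          = (\<Sum>h\<in>carrier G. \<Sum>p\<in>carrier G. a p * b (inv p \<otimes> h) * c (inv h \<otimes> g))"
          by (simp add: R_mult True sum_distrib_right)
        also have "\<dots> = (\<Sum>p\<in>carrier G. \<Sum>h\<in>carrier G. a p * b (inv p \<otimes> h) * c (inv h \<otimes> g))"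
          by (rule sum.swap)
        also have "\<dots> = (\<Sum>p\<in>carrier G. \<Sum>q\<in>carrier G. a p * b q * c (inv q \<otimes> (inv p \<otimes> g)))"
        proof (rule sum.cong[OF refl])
          fix p assume p: "p \<in> carrier G"
          show "(\<Sum>h\<in>carrier G. a p * b (inv p \<otimes> h) * c (inv h \<otimes> g))
            = (\<Sum>q\<in>carrier G. a p * b q * c (inv q \<otimes> (inv p \<otimes> g)))"
            unfolding sum_left_translate[OF p, of "\<lambda>h. a p * b (inv p \<otimes> h) * c (inv h \<otimes> g)", symmetric]
            by (rule sum.cong) (use p True in \<open>auto simp: m_assoc[symmetric] inv_mult_group\<close>)
        qed
        also have "\<dots> = (a \<otimes>\<^bsub>R\<^esub> (b \<otimes>\<^bsub>R\<^esub> c)) g"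
          by (simp add: R_mult True sum_distrib_left mult.assoc)
        finally show ?thesis .
      qed (simp add: R_mult_outside)
    qed
  next
    fix a assume a: "a \<in> carrier R"
    show "\<one>\<^bsub>R\<^esub> \<otimes>\<^bsub>R\<^esub> a = a"
    proof
      fix g
      show "(\<one>\<^bsub>R\<^esub> \<otimes>\<^bsub>R\<^esub> a) g = a g"
      proof (cases "g \<in> carrier G")
        case True
        have "(\<one>\<^bsub>R\<^esub> \<otimes>\<^bsub>R\<^esub> a) g = (\<Sum>h\<in>carrier G. if h = \<one> then a (inv h \<otimes> g) else 0)"
          unfolding R_mult[OF True] by (intro sum.cong) (auto simp: R_simps delta_def)
        then show ?thesis using True by simp
      qed (use a in \<open>simp add: R_mult_outside R_simps\<close>)
    qed
    show "a \<otimes>\<^bsub>R\<^esub> \<one>\<^bsub>R\<^esub> = a"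
    proof
      fix g
      show "(a \<otimes>\<^bsub>R\<^esub> \<one>\<^bsub>R\<^esub>) g = a g"
      proof (cases "g \<in> carrier G")
        case True
        have "(a \<otimes>\<^bsub>R\<^esub> \<one>\<^bsub>R\<^esub>) g = (\<Sum>h\<in>carrier G. if h = g then a h else 0)"
          unfolding R_mult[OF True]
          by (intro sum.cong) (use True in \<open>auto simp: R_simps delta_def inv_solve_left'\<close>)
        then show ?thesis using True by simp
      qed (use a in \<open>simp add: R_mult_outside R_simps\<close>)
    qed
  qed (simp_all add: R_simps R_mult_outside delta_def)
next
  fix x y z
  show "(x \<oplus>\<^bsub>R\<^esub> y) \<otimes>\<^bsub>R\<^esub> z = x \<otimes>\<^bsub>R\<^esub> z \<oplus>\<^bsub>R\<^esub> y \<otimes>\<^bsub>R\<^esub> z"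
  proof
    fix g
    show "((x \<oplus>\<^bsub>R\<^esub> y) \<otimes>\<^bsub>R\<^esub> z) g = (x \<otimes>\<^bsub>R\<^esub> z \<oplus>\<^bsub>R\<^esub> y \<otimes>\<^bsub>R\<^esub> z) g"
      by (cases "g \<in> carrier G")
        (simp_all add: R_mult R_mult_outside R_simps(4) distrib_right sum.distrib)
  qed
  show "z \<otimes>\<^bsub>R\<^esub> (x \<oplus>\<^bsub>R\<^esub> y) = z \<otimes>\<^bsub>R\<^esub> x \<oplus>\<^bsub>R\<^esub> z \<otimes>\<^bsub>R\<^esub> y"
  proof
    fix g
    show "(z \<otimes>\<^bsub>R\<^esub> (x \<oplus>\<^bsub>R\<^esub> y)) g = (z \<otimes>\<^bsub>R\<^esub> x \<oplus>\<^bsub>R\<^esub> z \<otimes>\<^bsub>R\<^esub> y) g"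
      by (cases "g \<in> carrier G")
        (simp_all add: R_mult R_mult_outside R_simps(4) distrib_left sum.distrib)
  qed
qed

end

section \<open>Modules over the group algebra as linear representations\<close>

lemma (in abelian_monoid) finsum_UN_disjoint:
  assumes "finite I" "\<And>i. i \<in> I \<Longrightarrow> finite (A i)" "pairwise (\<lambda>i j. disjnt (A i) (A j)) I"
    and "\<And>i x. i \<in> I \<Longrightarrow> x \<in> A i \<Longrightarrow> f x \<in> carrier G"
  shows "finsum G f (\<Union>(A ` I)) = finsum G (\<lambda>i. finsum G f (A i)) I"
  using add.finprod_UN_disjoint[OF assms] .

lemma (in abelian_monoid) finsum_swap:
  assumes "finite A" "finite B" "\<And>x y. x \<in> A \<Longrightarrow> y \<in> B \<Longrightarrow> f x y \<in> carrier G"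
  shows "finsum G (\<lambda>x. finsum G (f x) B) A = finsum G (\<lambda>y. finsum G (\<lambda>x. f x y) A) B"
  using assms(1,3)
proof (induction A rule: finite_induct)
  case empty
  then show ?case by simp
next
  case (insert x A)
  have "finsum G (\<lambda>y. finsum G (\<lambda>x. f x y) (insert x A)) B
     = finsum G (\<lambda>y. f x y \<oplus> finsum G (\<lambda>x. f x y) A) B"
    using insert by (intro finsum_cong') (auto intro!: finsum_closed)
  also have "\<dots> = finsum G (f x) B \<oplus> finsum G (\<lambda>y. finsum G (\<lambda>x. f x y) A) B"
    using insert by (intro finsum_addf) (auto intro!: finsum_closed)
  finally show ?case
    using insert by (simp add: finsum_closed Pi_def)
qed

lemma finsum_hom:
  assumes "abelian_group M" "abelian_group N" "f \<in> carrier M \<rightarrow> carrier N"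
    and add: "\<And>x y. x \<in> carrier M \<Longrightarrow> y \<in> carrier M \<Longrightarrow> f (x \<oplus>\<^bsub>M\<^esub> y) = f x \<oplus>\<^bsub>N\<^esub> f y"
    and F: "\<And>i. i \<in> A \<Longrightarrow> F i \<in> carrier M"
  shows "f (finsum M F A) = finsum N (\<lambda>i. f (F i)) A"
proof -
  interpret M: abelian_group M by fact
  interpret N: abelian_group N by fact
  have f0: "f \<zero>\<^bsub>M\<^esub> = \<zero>\<^bsub>N\<^esub>"
    using add[of "\<zero>\<^bsub>M\<^esub>" "\<zero>\<^bsub>M\<^esub>"] assms(3) by (simp add: Pi_def N.add.r_cancel_one')
  show ?thesis
  proof (cases "finite A")
    case True
    then show ?thesis using F
    proof (induction A rule: finite_induct)
      case empty
      then show ?case by (simp add: f0)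
    next
      case (insert x A)
      then show ?case using assms(3) by (simp add: Pi_def add M.finsum_closed)
    qed
  qed (simp add: f0)
qed

lemma hom_add:
  "f \<in> left_module_hom R M N \<Longrightarrow> x \<in> carrier M \<Longrightarrow> y \<in> carrier M \<Longrightarrow> f (x \<oplus>\<^bsub>M\<^esub> y) = f x \<oplus>\<^bsub>N\<^esub> f y"
  by (simp add: left_module_hom_def)

lemma hom_smult:
  "f \<in> left_module_hom R M N \<Longrightarrow> a \<in> carrier R \<Longrightarrow> x \<in> carrier M \<Longrightarrow> f (a \<odot>\<^bsub>M\<^esub> x) = a \<odot>\<^bsub>N\<^esub> f x"
  by (simp add: left_module_hom_def)

lemma hom_closed: "f \<in> left_module_hom R M N \<Longrightarrow> x \<in> carrier M \<Longrightarrow> f x \<in> carrier N"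
  by (auto simp: left_module_hom_def)

lemma hom_comp:
  "f \<in> left_module_hom R M N \<Longrightarrow> g \<in> left_module_hom R N L \<Longrightarrow> g \<circ> f \<in> left_module_hom R M L"
  by (auto simp: left_module_hom_def Pi_def)

lemma hom_id: "id \<in> left_module_hom R M M"
  by (auto simp: left_module_hom_def)

lemma left_moduleI:
  assumes "ring R" "abelian_group M"
    and "\<And>a x. a \<in> carrier R \<Longrightarrow> x \<in> carrier M \<Longrightarrow> a \<odot>\<^bsub>M\<^esub> x \<in> carrier M"
    and "\<And>a b x. a \<in> carrier R \<Longrightarrow> b \<in> carrier R \<Longrightarrow> x \<in> carrier M \<Longrightarrow>
      (a \<oplus>\<^bsub>R\<^esub> b) \<odot>\<^bsub>M\<^esub> x = a \<odot>\<^bsub>M\<^esub> x \<oplus>\<^bsub>M\<^esub> b \<odot>\<^bsub>M\<^esub> x"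
    and "\<And>a x y. a \<in> carrier R \<Longrightarrow> x \<in> carrier M \<Longrightarrow> y \<in> carrier M \<Longrightarrow>
      a \<odot>\<^bsub>M\<^esub> (x \<oplus>\<^bsub>M\<^esub> y) = a \<odot>\<^bsub>M\<^esub> x \<oplus>\<^bsub>M\<^esub> a \<odot>\<^bsub>M\<^esub> y"
    and "\<And>a b x. a \<in> carrier R \<Longrightarrow> b \<in> carrier R \<Longrightarrow> x \<in> carrier M \<Longrightarrow>
      (a \<otimes>\<^bsub>R\<^esub> b) \<odot>\<^bsub>M\<^esub> x = a \<odot>\<^bsub>M\<^esub> (b \<odot>\<^bsub>M\<^esub> x)"
    and "\<And>x. x \<in> carrier M \<Longrightarrow> \<one>\<^bsub>R\<^esub> \<odot>\<^bsub>M\<^esub> x = x"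
  shows "left_module R M"
  using assms by (auto intro!: left_module.intro left_module_axioms.intro)

context finite_group
begin

text \<open>A module over the group algebra is handled through its scalars and its group action, so
  that later arguments avoid convolution products; \<open>smult_eq_finsum\<close> recovers the full
  multiplication.\<close>

definition sc :: "('g \<Rightarrow> 'k, 'u) module \<Rightarrow> 'k \<Rightarrow> 'u \<Rightarrow> 'u" where
  "sc M c x = delta \<one> c \<odot>\<^bsub>M\<^esub> x"

definition ac :: "('g \<Rightarrow> 'k, 'u) module \<Rightarrow> 'g \<Rightarrow> 'u \<Rightarrow> 'u" where
  "ac M g x = delta g 1 \<odot>\<^bsub>M\<^esub> x"

abbreviation md where "md \<equiv> left_module R"
abbreviation Hom where "Hom \<equiv> left_module_hom R"

lemma md_abelian_group: "md M \<Longrightarrow> abelian_group M"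
  by (simp add: left_module_def)

context
  fixes M :: "('g \<Rightarrow> 'k, 'u) module"
  assumes M: "md M"
begin

interpretation left_module R M by (fact M)

lemma add_closed [simp]: "x \<in> carrier M \<Longrightarrow> y \<in> carrier M \<Longrightarrow> x \<oplus>\<^bsub>M\<^esub> y \<in> carrier M"
  by (rule M.add.m_closed)

lemma zero_closed [simp]: "\<zero>\<^bsub>M\<^esub> \<in> carrier M"
  by simp

lemma minus_closed [simp]: "x \<in> carrier M \<Longrightarrow> y \<in> carrier M \<Longrightarrow> x \<ominus>\<^bsub>M\<^esub> y \<in> carrier M"
  by simp

lemma minus_eq_zero_iff: "x \<in> carrier M \<Longrightarrow> y \<in> carrier M \<Longrightarrow> x \<ominus>\<^bsub>M\<^esub> y = \<zero>\<^bsub>M\<^esub> \<longleftrightarrow> x = y"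
  by (metis M.a_inv_closed M.add.inv_inv M.minus_equality M.minus_eq M.r_neg)

lemma sc_closed [simp]: "x \<in> carrier M \<Longrightarrow> sc M c x \<in> carrier M"
  and ac_closed [simp]: "g \<in> carrier G \<Longrightarrow> x \<in> carrier M \<Longrightarrow> ac M g x \<in> carrier M"
  by (simp_all add: sc_def ac_def)

lemma sc_add_left: "x \<in> carrier M \<Longrightarrow> sc M (c + d) x = sc M c x \<oplus>\<^bsub>M\<^esub> sc M d x"
proof -
  have "delta \<one> (c + d) = delta \<one> c \<oplus>\<^bsub>R\<^esub> delta \<one> d"
    by (auto simp: R_simps delta_def)
  then show "x \<in> carrier M \<Longrightarrow> ?thesis"
    by (simp add: sc_def smult_l_distr)
qed

lemma sc_add: "x \<in> carrier M \<Longrightarrow> y \<in> carrier M \<Longrightarrow> sc M c (x \<oplus>\<^bsub>M\<^esub> y) = sc M c x \<oplus>\<^bsub>M\<^esub> sc M c y"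
  and ac_add: "g \<in> carrier G \<Longrightarrow> x \<in> carrier M \<Longrightarrow> y \<in> carrier M \<Longrightarrow>
    ac M g (x \<oplus>\<^bsub>M\<^esub> y) = ac M g x \<oplus>\<^bsub>M\<^esub> ac M g y"
  by (simp_all add: sc_def ac_def smult_r_distr)

lemma sc_sc [simp]: "x \<in> carrier M \<Longrightarrow> sc M c (sc M d x) = sc M (c * d) x"
  and ac_ac: "g \<in> carrier G \<Longrightarrow> h \<in> carrier G \<Longrightarrow> x \<in> carrier M \<Longrightarrow>
    ac M g (ac M h x) = ac M (g \<otimes> h) x"
  and ac_sc: "g \<in> carrier G \<Longrightarrow> x \<in> carrier M \<Longrightarrow> ac M g (sc M c x) = sc M c (ac M g x)"
  and smult_delta: "g \<in> carrier G \<Longrightarrow> x \<in> carrier M \<Longrightarrow> delta g c \<odot>\<^bsub>M\<^esub> x = sc M c (ac M g x)"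
  by (simp_all add: sc_def ac_def smult_assoc1[symmetric] delta_mult)

lemma sc_one [simp]: "x \<in> carrier M \<Longrightarrow> sc M 1 x = x"
  and ac_one [simp]: "x \<in> carrier M \<Longrightarrow> ac M \<one> x = x"
  by (simp_all add: sc_def ac_def R_simps(3)[symmetric])

lemma sc_zero_right [simp]: "sc M c \<zero>\<^bsub>M\<^esub> = \<zero>\<^bsub>M\<^esub>"
  using sc_add[of "\<zero>\<^bsub>M\<^esub>" "\<zero>\<^bsub>M\<^esub>" c] by (simp add: M.add.r_cancel_one')

lemma ac_zero_right [simp]: "g \<in> carrier G \<Longrightarrow> ac M g \<zero>\<^bsub>M\<^esub> = \<zero>\<^bsub>M\<^esub>"
  using ac_add[of g "\<zero>\<^bsub>M\<^esub>" "\<zero>\<^bsub>M\<^esub>"] by (simp add: M.add.r_cancel_one')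

lemma sc_zero_left [simp]: "x \<in> carrier M \<Longrightarrow> sc M 0 x = \<zero>\<^bsub>M\<^esub>"
  using sc_add_left[of x 0 0] by (simp add: M.add.r_cancel_one')

lemma uminus_eq_sc: "x \<in> carrier M \<Longrightarrow> \<ominus>\<^bsub>M\<^esub> x = sc M (-1) x"
  using sc_add_left[of x "-1" 1] by (intro M.minus_equality) simp_all

lemma ac_inv_ac [simp]:
  "g \<in> carrier G \<Longrightarrow> x \<in> carrier M \<Longrightarrow> ac M (inv g) (ac M g x) = x"
  "g \<in> carrier G \<Longrightarrow> x \<in> carrier M \<Longrightarrow> ac M g (ac M (inv g) x) = x"
  by (simp_all add: ac_ac)

text \<open>An element of the group algebra is the sum of its components
  \<open>delta g (a g)\<close>, and the action is additive in the algebra element.\<close>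

lemma smult_eq_finsum:
  assumes "a \<in> carrier R" "x \<in> carrier M"
  shows "a \<odot>\<^bsub>M\<^esub> x = (\<Oplus>\<^bsub>M\<^esub>g\<in>carrier G. sc M (a g) (ac M g x))"
proof -
  \<comment> \<open>Induction on a finite set \<open>A\<close> outside of which the coefficients are
    cut off to 0.\<close>
  have "(\<lambda>g. if g \<in> A then a g else 0) \<odot>\<^bsub>M\<^esub> x = (\<Oplus>\<^bsub>M\<^esub>g\<in>A. sc M (a g) (ac M g x))"
    if "finite A" "A \<subseteq> carrier G" for A
    using that
  proof (induction A rule: finite_induct)
    case empty
    then show ?case
      using assms sc_zero_left[of x] by (simp add: sc_def delta_def)
  next
    case (insert h A)
    have eq: "(\<lambda>g. if g \<in> insert h A then a g else 0) =
        delta h (a h) \<oplus>\<^bsub>R\<^esub> (\<lambda>g. if g \<in> A then a g else 0)"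
      using insert by (auto simp: R_simps delta_def)
    have "(\<lambda>g. if g \<in> A then a g else 0) \<in> carrier R"
      using insert by (auto simp: R_simps)
    then show ?case
      unfolding eq using insert assms
      by (simp add: smult_l_distr smult_delta Pi_def subset_iff)
  qed
  moreover have "(\<lambda>g. if g \<in> carrier G then a g else 0) = a"
    using assms by (auto simp: R_simps)
  ultimately show ?thesis
    by (metis finite_carrier subset_refl)
qed

end

text \<open>By \<open>smult_eq_finsum\<close> the action of any algebra element is a finite sum of
  scalars times group elements, and an additive map commutes with finite sums.\<close>

lemma hom_iff:
  assumes "md M" "md N"
  shows "f \<in> Hom M N \<longleftrightarrow> f \<in> carrier M \<rightarrow> carrier N \<and>
    (\<forall>x\<in>carrier M. \<forall>y\<in>carrier M. f (x \<oplus>\<^bsub>M\<^esub> y) = f x \<oplus>\<^bsub>N\<^esub> f y) \<and>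
    (\<forall>c. \<forall>x\<in>carrier M. f (sc M c x) = sc N c (f x)) \<and>
    (\<forall>g\<in>carrier G. \<forall>x\<in>carrier M. f (ac M g x) = ac N g (f x))" (is "?l \<longleftrightarrow> ?r")
proof
  assume ?l
  then show ?r
    by (auto simp: left_module_hom_def sc_def ac_def)
next
  assume f: ?r
  then have fc: "f x \<in> carrier N" if "x \<in> carrier M" for x using that by auto
  interpret N: abelian_group N using assms by (simp add: md_abelian_group)
  have "f (a \<odot>\<^bsub>M\<^esub> x) = a \<odot>\<^bsub>N\<^esub> f x" if "a \<in> carrier R" "x \<in> carrier M" for a x
  proof -
    have "f (a \<odot>\<^bsub>M\<^esub> x) = (\<Oplus>\<^bsub>N\<^esub>g\<in>carrier G. f (sc M (a g) (ac M g x)))"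
      unfolding smult_eq_finsum[OF assms(1) that]
      by (rule finsum_hom) (use f that assms in \<open>auto simp: md_abelian_group\<close>)
    also have "\<dots> = (\<Oplus>\<^bsub>N\<^esub>g\<in>carrier G. sc N (a g) (ac N g (f x)))"
      using f fc that assms by (intro N.finsum_cong') auto
    also have "\<dots> = a \<odot>\<^bsub>N\<^esub> f x"
      using smult_eq_finsum[OF assms(2) that(1) fc[OF that(2)]] by simp
    finally show ?thesis .
  qed
  then show ?l using f by (simp add: left_module_hom_def)
qed

lemma hom_sc: "f \<in> Hom M N \<Longrightarrow> x \<in> carrier M \<Longrightarrow> f (sc M c x) = sc N c (f x)"
  and hom_ac: "f \<in> Hom M N \<Longrightarrow> g \<in> carrier G \<Longrightarrow> x \<in> carrier M \<Longrightarrow> f (ac M g x) = ac N g (f x)"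
  by (auto simp: left_module_hom_def sc_def ac_def)

lemma hom_zero:
  assumes "md M" "md N" "f \<in> Hom M N"
  shows "f \<zero>\<^bsub>M\<^esub> = \<zero>\<^bsub>N\<^esub>"
  using hom_sc[OF assms(3), of "\<zero>\<^bsub>M\<^esub>" 0] assms by (simp add: hom_closed)

lemma hom_diff:
  assumes "md M" "md N" "f \<in> Hom M N" "x \<in> carrier M" "y \<in> carrier M"
  shows "f (x \<ominus>\<^bsub>M\<^esub> y) = f x \<ominus>\<^bsub>N\<^esub> f y"
  using assms by (simp add: a_minus_def uminus_eq_sc hom_add hom_sc hom_closed)

lemma hom_minus:
  assumes "md M" "md N" "f \<in> Hom M N" "g \<in> Hom M N"
  shows "(\<lambda>x. f x \<ominus>\<^bsub>N\<^esub> g x) \<in> Hom M N"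
proof -
  interpret N: abelian_group N using assms by (simp add: md_abelian_group)
  show ?thesis
    unfolding hom_iff[OF assms(1,2)]
  proof (intro conjI ballI allI)
    show "(\<lambda>x. f x \<ominus>\<^bsub>N\<^esub> g x) \<in> carrier M \<rightarrow> carrier N"
      using assms by (auto simp: hom_closed)
  next
    fix x y assume "x \<in> carrier M" "y \<in> carrier M"
    then show "f (x \<oplus>\<^bsub>M\<^esub> y) \<ominus>\<^bsub>N\<^esub> g (x \<oplus>\<^bsub>M\<^esub> y) = (f x \<ominus>\<^bsub>N\<^esub> g x) \<oplus>\<^bsub>N\<^esub> (f y \<ominus>\<^bsub>N\<^esub> g y)"
      using assms by (simp add: hom_closed hom_add a_minus_def N.minus_add N.a_ac)
  next
    fix c x assume "x \<in> carrier M"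
    then show "f (sc M c x) \<ominus>\<^bsub>N\<^esub> g (sc M c x) = sc N c (f x \<ominus>\<^bsub>N\<^esub> g x)"
      using assms by (simp add: hom_closed hom_sc a_minus_def uminus_eq_sc sc_add)
  next
    fix h x assume "h \<in> carrier G" "x \<in> carrier M"
    then show "f (ac M h x) \<ominus>\<^bsub>N\<^esub> g (ac M h x) = ac N h (f x \<ominus>\<^bsub>N\<^esub> g x)"
      using assms by (simp add: hom_closed hom_ac a_minus_def uminus_eq_sc ac_add ac_sc)
  qed
qed

text \<open>Only the additive group of the record \<open>B\<close> is used.\<close>

definition rep_module :: "('v, 'm) ring_scheme \<Rightarrow> ('k \<Rightarrow> 'v \<Rightarrow> 'v) \<Rightarrow> ('g \<Rightarrow> 'v \<Rightarrow> 'v) \<Rightarrow>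
    ('g \<Rightarrow> 'k, 'v) module" where
  "rep_module B s r = \<lparr>carrier = carrier B, monoid.mult = (\<lambda>x y. x), one = \<zero>\<^bsub>B\<^esub>, zero = \<zero>\<^bsub>B\<^esub>, add = add B,
     smult = (\<lambda>a x. \<Oplus>\<^bsub>B\<^esub>g\<in>carrier G. s (a g) (r g x))\<rparr>"

context
  fixes B :: "('v, 'm) ring_scheme" and s :: "'k \<Rightarrow> 'v \<Rightarrow> 'v" and r :: "'g \<Rightarrow> 'v \<Rightarrow> 'v"
  assumes B: "abelian_group B"
    and s_closed: "\<And>c x. x \<in> carrier B \<Longrightarrow> s c x \<in> carrier B"
    and s_add_left: "\<And>c d x. x \<in> carrier B \<Longrightarrow> s (c + d) x = s c x \<oplus>\<^bsub>B\<^esub> s d x"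
    and s_add: "\<And>c x y. x \<in> carrier B \<Longrightarrow> y \<in> carrier B \<Longrightarrow> s c (x \<oplus>\<^bsub>B\<^esub> y) = s c x \<oplus>\<^bsub>B\<^esub> s c y"
    and s_s: "\<And>c d x. x \<in> carrier B \<Longrightarrow> s c (s d x) = s (c * d) x"
    and s_one: "\<And>x. x \<in> carrier B \<Longrightarrow> s 1 x = x"
    and r_closed: "\<And>g x. g \<in> carrier G \<Longrightarrow> x \<in> carrier B \<Longrightarrow> r g x \<in> carrier B"
    and r_add: "\<And>g x y. g \<in> carrier G \<Longrightarrow> x \<in> carrier B \<Longrightarrow> y \<in> carrier B \<Longrightarrow>
      r g (x \<oplus>\<^bsub>B\<^esub> y) = r g x \<oplus>\<^bsub>B\<^esub> r g y"
    and r_s: "\<And>g c x. g \<in> carrier G \<Longrightarrow> x \<in> carrier B \<Longrightarrow> r g (s c x) = s c (r g x)"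
    and r_r: "\<And>g h x. g \<in> carrier G \<Longrightarrow> h \<in> carrier G \<Longrightarrow> x \<in> carrier B \<Longrightarrow> r g (r h x) = r (g \<otimes> h) x"
    and r_one: "\<And>x. x \<in> carrier B \<Longrightarrow> r \<one> x = x"
begin

interpretation B: abelian_group B by (fact B)

lemma s_zero: "x \<in> carrier B \<Longrightarrow> s 0 x = \<zero>\<^bsub>B\<^esub>"
  using s_add_left[of x 0 0] s_closed[of x 0] by (simp add: B.add.r_cancel_one')

lemma rep_smult_delta:
  assumes "h \<in> carrier G" "x \<in> carrier B"
  shows "(\<Oplus>\<^bsub>B\<^esub>g\<in>carrier G. s (delta h c g) (r g x)) = s c (r h x)"
proof -
  have "(\<Oplus>\<^bsub>B\<^esub>g\<in>carrier G. s (delta h c g) (r g x)) =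
      (\<Oplus>\<^bsub>B\<^esub>g\<in>carrier G. if h = g then s c (r g x) else \<zero>\<^bsub>B\<^esub>)"
    using assms by (intro B.finsum_cong') (auto simp: delta_def s_zero r_closed s_closed)
  also have "\<dots> = s c (r h x)"
    by (rule B.finsum_singleton[OF assms(1)]) (use assms in \<open>auto simp: r_closed s_closed\<close>)
  finally show ?thesis .
qed

lemma s_sum:
  assumes "finite A" "x \<in> carrier B"
  shows "s (sum c A) x = (\<Oplus>\<^bsub>B\<^esub>i\<in>A. s (c i) x)"
  using assms by (induction A rule: finite_induct) (auto simp: s_zero s_add_left s_closed Pi_def)

lemma rep_module_md: "md (rep_module B s r)"
proof (rule left_moduleI[OF R_ring])
  have rec: "carrier (rep_module B s r) = carrier B" "\<zero>\<^bsub>rep_module B s r\<^esub> = \<zero>\<^bsub>B\<^esub>"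
      "add (rep_module B s r) = add B"
      "smult (rep_module B s r) = (\<lambda>a x. \<Oplus>\<^bsub>B\<^esub>g\<in>carrier G. s (a g) (r g x))"
    by (simp_all add: rep_module_def)
  show "abelian_group (rep_module B s r)"
    by (rule abelian_groupI) (use abelian_groupE[OF B] in \<open>simp_all only: rec\<close>)
  note [simp] = rec s_closed r_closed
  fix a x assume a: "a \<in> carrier R" and x: "x \<in> carrier (rep_module B s r)"
  show "a \<odot>\<^bsub>rep_module B s r\<^esub> x \<in> carrier (rep_module B s r)"
    using x by (auto intro!: B.finsum_closed)
  show "a \<odot>\<^bsub>rep_module B s r\<^esub> (x \<oplus>\<^bsub>rep_module B s r\<^esub> y) =
      a \<odot>\<^bsub>rep_module B s r\<^esub> x \<oplus>\<^bsub>rep_module B s r\<^esub> a \<odot>\<^bsub>rep_module B s r\<^esub> y"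
    if "y \<in> carrier (rep_module B s r)" for y
  proof -
    have "(\<Oplus>\<^bsub>B\<^esub>g\<in>carrier G. s (a g) (r g (x \<oplus>\<^bsub>B\<^esub> y))) =
        (\<Oplus>\<^bsub>B\<^esub>g\<in>carrier G. s (a g) (r g x) \<oplus>\<^bsub>B\<^esub> s (a g) (r g y))"
      using x that by (intro B.finsum_cong') (auto simp: r_add s_add)
    then show ?thesis using x that by (simp add: Pi_def B.finsum_addf)
  qed
  fix b assume b: "b \<in> carrier R"
  show "(a \<oplus>\<^bsub>R\<^esub> b) \<odot>\<^bsub>rep_module B s r\<^esub> x =
      a \<odot>\<^bsub>rep_module B s r\<^esub> x \<oplus>\<^bsub>rep_module B s r\<^esub> b \<odot>\<^bsub>rep_module B s r\<^esub> x"
  proof -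
    have "(\<Oplus>\<^bsub>B\<^esub>g\<in>carrier G. s (a g + b g) (r g x)) =
        (\<Oplus>\<^bsub>B\<^esub>g\<in>carrier G. s (a g) (r g x) \<oplus>\<^bsub>B\<^esub> s (b g) (r g x))"
      using x by (intro B.finsum_cong') (auto simp: s_add_left)
    then show ?thesis using x by (simp add: Pi_def B.finsum_addf R_simps)
  qed
  have s_hom: "s c (\<Oplus>\<^bsub>B\<^esub>g\<in>carrier G. F g) = (\<Oplus>\<^bsub>B\<^esub>g\<in>carrier G. s c (F g))"
    and r_hom: "h \<in> carrier G \<Longrightarrow> r h (\<Oplus>\<^bsub>B\<^esub>g\<in>carrier G. F g) = (\<Oplus>\<^bsub>B\<^esub>g\<in>carrier G. r h (F g))"
    if "\<And>g. g \<in> carrier G \<Longrightarrow> F g \<in> carrier B" for c h F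
    using that by (auto intro!: finsum_hom[OF B B] simp: s_add r_add)
  show "(a \<otimes>\<^bsub>R\<^esub> b) \<odot>\<^bsub>rep_module B s r\<^esub> x =
      a \<odot>\<^bsub>rep_module B s r\<^esub> (b \<odot>\<^bsub>rep_module B s r\<^esub> x)"
  proof -
    have "(\<Oplus>\<^bsub>B\<^esub>g\<in>carrier G. s ((a \<otimes>\<^bsub>R\<^esub> b) g) (r g x)) =
        (\<Oplus>\<^bsub>B\<^esub>g\<in>carrier G. \<Oplus>\<^bsub>B\<^esub>h\<in>carrier G. s (a h * b (inv h \<otimes> g)) (r g x))"
      using x by (intro B.finsum_cong') (auto simp: R_mult s_sum intro!: B.finsum_closed)
    also have "\<dots> = (\<Oplus>\<^bsub>B\<^esub>h\<in>carrier G. \<Oplus>\<^bsub>B\<^esub>g\<in>carrier G. s (a h * b (inv h \<otimes> g)) (r g x))"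
      using x by (intro B.finsum_swap) auto
    \<comment> \<open>Replacing \<open>g\<close> by \<open>h \<otimes> g\<close> turns the
      convolution into an independent double sum, from which the inner action can be pulled
      out.\<close>
    also have "\<dots> = (\<Oplus>\<^bsub>B\<^esub>h\<in>carrier G. \<Oplus>\<^bsub>B\<^esub>g\<in>carrier G. s (a h * b g) (r (h \<otimes> g) x))"
    proof (rule B.finsum_cong'[OF refl])
      fix h assume h: "h \<in> carrier G"
      have "(\<lambda>g. h \<otimes> g) ` carrier G = carrier G"
        using h by (rule surj_const_mult)
      moreover have "inj_on (\<lambda>g. h \<otimes> g) (carrier G)"
        using h by (simp add: inj_on_def)
      ultimately have "(\<Oplus>\<^bsub>B\<^esub>g\<in>carrier G. s (a h * b (inv h \<otimes> g)) (r g x)) =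
          (\<Oplus>\<^bsub>B\<^esub>g\<in>carrier G. s (a h * b (inv h \<otimes> (h \<otimes> g))) (r (h \<otimes> g) x))"
        using B.finsum_reindex[of "\<lambda>g. s (a h * b (inv h \<otimes> g)) (r g x)" "\<lambda>g. h \<otimes> g" "carrier G"] x
        by auto
      also have "\<dots> = (\<Oplus>\<^bsub>B\<^esub>g\<in>carrier G. s (a h * b g) (r (h \<otimes> g) x))"
        using h x by (intro B.finsum_cong') (auto simp: m_assoc[symmetric])
      finally show "(\<Oplus>\<^bsub>B\<^esub>g\<in>carrier G. s (a h * b (inv h \<otimes> g)) (r g x)) =
          (\<Oplus>\<^bsub>B\<^esub>g\<in>carrier G. s (a h * b g) (r (h \<otimes> g) x))" .
    qed (use x in \<open>auto intro!: B.finsum_closed\<close>)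
    also have "\<dots> = (\<Oplus>\<^bsub>B\<^esub>h\<in>carrier G. s (a h) (r h (\<Oplus>\<^bsub>B\<^esub>g\<in>carrier G. s (b g) (r g x))))"
    proof (rule B.finsum_cong'[OF refl])
      fix h assume h: "h \<in> carrier G"
      have "s (a h) (r h (\<Oplus>\<^bsub>B\<^esub>g\<in>carrier G. s (b g) (r g x))) =
          (\<Oplus>\<^bsub>B\<^esub>g\<in>carrier G. s (a h) (r h (s (b g) (r g x))))"
        using h x by (simp add: r_hom s_hom)
      also have "\<dots> = (\<Oplus>\<^bsub>B\<^esub>g\<in>carrier G. s (a h * b g) (r (h \<otimes> g) x))"
        using h x by (intro B.finsum_cong') (auto simp: r_s s_s r_r)
      finally show "(\<Oplus>\<^bsub>B\<^esub>g\<in>carrier G. s (a h * b g) (r (h \<otimes> g) x)) =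
          s (a h) (r h (\<Oplus>\<^bsub>B\<^esub>g\<in>carrier G. s (b g) (r g x)))" by simp
    qed (use x in \<open>auto intro!: B.finsum_closed\<close>)
    finally show ?thesis by simp
  qed
next
  fix x assume x: "x \<in> carrier (rep_module B s r)"
  then show "\<one>\<^bsub>R\<^esub> \<odot>\<^bsub>rep_module B s r\<^esub> x = x"
    by (simp add: rep_module_def R_simps(3) rep_smult_delta r_one s_one)
qed

lemma rep_module_sc: "x \<in> carrier B \<Longrightarrow> sc (rep_module B s r) c x = s c x"
  and rep_module_ac: "g \<in> carrier G \<Longrightarrow> x \<in> carrier B \<Longrightarrow> ac (rep_module B s r) g x = r g x"
  using rep_smult_delta[of \<one> x c] rep_smult_delta[of g x 1]
  by (simp_all add: sc_def ac_def rep_module_def r_one s_one r_closed)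

end

end

section \<open>Linear maps\<close>

context finite_group
begin

definition Lin :: "('g \<Rightarrow> 'k, 'u) module \<Rightarrow> ('g \<Rightarrow> 'k, 'v) module \<Rightarrow> ('u \<Rightarrow> 'v) set" where
  "Lin M N = {f \<in> carrier M \<rightarrow> carrier N.
     (\<forall>x\<in>carrier M. \<forall>y\<in>carrier M. f (x \<oplus>\<^bsub>M\<^esub> y) = f x \<oplus>\<^bsub>N\<^esub> f y) \<and>
     (\<forall>c. \<forall>x\<in>carrier M. f (sc M c x) = sc N c (f x))}"

lemma LinI:
  assumes "\<And>x. x \<in> carrier M \<Longrightarrow> f x \<in> carrier N"
    and "\<And>x y. x \<in> carrier M \<Longrightarrow> y \<in> carrier M \<Longrightarrow> f (x \<oplus>\<^bsub>M\<^esub> y) = f x \<oplus>\<^bsub>N\<^esub> f y"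
    and "\<And>c x. x \<in> carrier M \<Longrightarrow> f (sc M c x) = sc N c (f x)"
  shows "f \<in> Lin M N"
  using assms by (auto simp: Lin_def)

lemma Lin_closed: "f \<in> Lin M N \<Longrightarrow> x \<in> carrier M \<Longrightarrow> f x \<in> carrier N"
  and Lin_add: "f \<in> Lin M N \<Longrightarrow> x \<in> carrier M \<Longrightarrow> y \<in> carrier M \<Longrightarrow> f (x \<oplus>\<^bsub>M\<^esub> y) = f x \<oplus>\<^bsub>N\<^esub> f y"
  and Lin_sc: "f \<in> Lin M N \<Longrightarrow> x \<in> carrier M \<Longrightarrow> f (sc M c x) = sc N c (f x)"
  by (auto simp: Lin_def)

lemma Lin_zero:
  assumes "md M" "md N" "f \<in> Lin M N"
  shows "f \<zero>\<^bsub>M\<^esub> = \<zero>\<^bsub>N\<^esub>"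
  using Lin_sc[OF assms(3), of "\<zero>\<^bsub>M\<^esub>" 0] assms by (simp add: Lin_closed)

lemma Lin_comp: "f \<in> Lin M N \<Longrightarrow> g \<in> Lin N L \<Longrightarrow> g \<circ> f \<in> Lin M L"
  by (auto simp: Lin_def Pi_def)

lemma Lin_plus:
  assumes "md M" "md N" "f \<in> Lin M N" "g \<in> Lin M N"
  shows "(\<lambda>x. f x \<oplus>\<^bsub>N\<^esub> g x) \<in> Lin M N"
proof -
  interpret N: abelian_group N using assms by (simp add: md_abelian_group)
  show ?thesis
    using assms by (intro LinI) (auto simp: Lin_closed Lin_add Lin_sc sc_add N.a_ac)
qed

lemma hom_Lin: "md M \<Longrightarrow> md N \<Longrightarrow> f \<in> Hom M N \<Longrightarrow> f \<in> Lin M N"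
  by (auto simp: hom_iff Lin_def)

lemma hom_LinI:
  assumes "md M" "md N" "f \<in> Lin M N"
    and "\<And>g x. g \<in> carrier G \<Longrightarrow> x \<in> carrier M \<Longrightarrow> f (ac M g x) = ac N g (f x)"
  shows "f \<in> Hom M N"
  using assms by (auto simp: hom_iff Lin_def)

lemma ac_Lin: "md M \<Longrightarrow> g \<in> carrier G \<Longrightarrow> ac M g \<in> Lin M M"
  by (rule LinI) (auto simp: ac_add ac_sc)

section \<open>Linear algebra in arbitrary dimension: choices by Zorn's lemma\<close>

definition subspace :: "('g \<Rightarrow> 'k, 'u) module \<Rightarrow> 'u set \<Rightarrow> bool" where
  "subspace M U \<longleftrightarrow> U \<subseteq> carrier M \<and> \<zero>\<^bsub>M\<^esub> \<in> U \<and> (\<forall>x\<in>U. \<forall>y\<in>U. x \<oplus>\<^bsub>M\<^esub> y \<in> U) \<and> (\<forall>c. \<forall>x\<in>U. sc M c x \<in> U)"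

text \<open>A subspace of the product, read as a partial and possibly multivalued linear map. It is
  the graph of a partial map when only zero is related to zero. Both problems ("find
  \<open>h\<close> with these properties") and partial solutions take this form.\<close>

definition linear_relation :: "('g \<Rightarrow> 'k, 'u) module \<Rightarrow> ('g \<Rightarrow> 'k, 'v) module \<Rightarrow> ('u \<times> 'v) set \<Rightarrow> bool" where
  "linear_relation M N \<Gamma> \<longleftrightarrow> \<Gamma> \<subseteq> carrier M \<times> carrier N \<and> (\<zero>\<^bsub>M\<^esub>, \<zero>\<^bsub>N\<^esub>) \<in> \<Gamma> \<and>
     (\<forall>x y x' y'. (x, y) \<in> \<Gamma> \<longrightarrow> (x', y') \<in> \<Gamma> \<longrightarrow> (x \<oplus>\<^bsub>M\<^esub> x', y \<oplus>\<^bsub>N\<^esub> y') \<in> \<Gamma>) \<and>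
     (\<forall>c x y. (x, y) \<in> \<Gamma> \<longrightarrow> (sc M c x, sc N c y) \<in> \<Gamma>)"

lemma linear_relation_single_valued:
  assumes "md M" "md N" "linear_relation M N \<Gamma>"
    and sv: "\<And>y. (\<zero>\<^bsub>M\<^esub>, y) \<in> \<Gamma> \<Longrightarrow> y = \<zero>\<^bsub>N\<^esub>"
    and xy: "(x, y) \<in> \<Gamma>" "(x, y') \<in> \<Gamma>"
  shows "y = y'"
proof -
  interpret M: abelian_group M using assms by (simp add: md_abelian_group)
  have c: "x \<in> carrier M" "y \<in> carrier N" "y' \<in> carrier N"
    using assms by (auto simp: linear_relation_def)
  have "(x \<oplus>\<^bsub>M\<^esub> sc M (-1) x, y \<oplus>\<^bsub>N\<^esub> sc N (-1) y') \<in> \<Gamma>"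
    using assms unfolding linear_relation_def by blast
  then have "(\<zero>\<^bsub>M\<^esub>, y \<ominus>\<^bsub>N\<^esub> y') \<in> \<Gamma>"
    using c assms(1,2) by (simp add: a_minus_def uminus_eq_sc[symmetric] M.r_neg)
  from sv[OF this] show ?thesis
    using c assms(2) by (simp add: minus_eq_zero_iff)
qed

text \<open>Adding the line through \<open>(a, b)\<close> creates no second value at zero: a
  relation x + c a = 0 with c \<noteq> 0 would put \<open>a\<close> into the domain of
  \<Gamma>.\<close>

lemma linear_relation_extend:
  assumes M: "md M" and N: "md N" and \<Gamma>: "linear_relation M N \<Gamma>"
    and sv: "\<And>y. (\<zero>\<^bsub>M\<^esub>, y) \<in> \<Gamma> \<Longrightarrow> y = \<zero>\<^bsub>N\<^esub>"
    and ab: "a \<in> carrier M" "b \<in> carrier N" "a \<notin> Domain \<Gamma>"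
  defines "\<Gamma>' \<equiv> {(x \<oplus>\<^bsub>M\<^esub> sc M c a, y \<oplus>\<^bsub>N\<^esub> sc N c b) | x y c. (x, y) \<in> \<Gamma>}"
  shows "linear_relation M N \<Gamma>'" "\<Gamma> \<subseteq> \<Gamma>'" "(a, b) \<in> \<Gamma>'" "(\<zero>\<^bsub>M\<^esub>, z) \<in> \<Gamma>' \<Longrightarrow> z = \<zero>\<^bsub>N\<^esub>"
proof -
  interpret M: abelian_group M using M by (simp add: md_abelian_group)
  interpret N: abelian_group N using N by (simp add: md_abelian_group)
  have c: "x \<in> carrier M" "y \<in> carrier N" if "(x, y) \<in> \<Gamma>" for x y
    using \<Gamma> that by (auto simp: linear_relation_def)
  have z: "(\<zero>\<^bsub>M\<^esub>, \<zero>\<^bsub>N\<^esub>) \<in> \<Gamma>" using \<Gamma> by (simp add: linear_relation_def)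
  have I: "(x \<oplus>\<^bsub>M\<^esub> sc M c a, y \<oplus>\<^bsub>N\<^esub> sc N c b) \<in> \<Gamma>'" if "(x, y) \<in> \<Gamma>" for x y c
    using that by (auto simp: \<Gamma>'_def)
  have "(x, y) \<in> \<Gamma>'" if "(x, y) \<in> \<Gamma>" for x y
    using I[OF that, of 0] c[OF that] ab M N by simp
  then show sub: "\<Gamma> \<subseteq> \<Gamma>'" by auto
  show "(a, b) \<in> \<Gamma>'"
    using I[OF z, of 1] ab M N by simp
  show "linear_relation M N \<Gamma>'"
    unfolding linear_relation_def
  proof (intro conjI allI impI)
    show "\<Gamma>' \<subseteq> carrier M \<times> carrier N"
      using c ab M N by (auto simp: \<Gamma>'_def)
    show "(\<zero>\<^bsub>M\<^esub>, \<zero>\<^bsub>N\<^esub>) \<in> \<Gamma>'" using z sub by blast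
  next
    fix p q p' q' assume "(p, q) \<in> \<Gamma>'" "(p', q') \<in> \<Gamma>'"
    then obtain x y c x' y' c' where *: "(x, y) \<in> \<Gamma>" "(x', y') \<in> \<Gamma>"
      "p = x \<oplus>\<^bsub>M\<^esub> sc M c a" "q = y \<oplus>\<^bsub>N\<^esub> sc N c b" "p' = x' \<oplus>\<^bsub>M\<^esub> sc M c' a" "q' = y' \<oplus>\<^bsub>N\<^esub> sc N c' b"
      by (auto simp: \<Gamma>'_def)
    have "(x \<oplus>\<^bsub>M\<^esub> x', y \<oplus>\<^bsub>N\<^esub> y') \<in> \<Gamma>" using * \<Gamma> by (simp add: linear_relation_def)
    from I[OF this, of "c + c'"] show "(p \<oplus>\<^bsub>M\<^esub> p', q \<oplus>\<^bsub>N\<^esub> q') \<in> \<Gamma>'"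
      using * c M N ab by (simp add: sc_add_left M.a_ac N.a_ac)
  next
    fix d p q assume "(p, q) \<in> \<Gamma>'"
    then obtain x y c where *: "(x, y) \<in> \<Gamma>" "p = x \<oplus>\<^bsub>M\<^esub> sc M c a" "q = y \<oplus>\<^bsub>N\<^esub> sc N c b"
      by (auto simp: \<Gamma>'_def)
    have "(sc M d x, sc N d y) \<in> \<Gamma>" using * \<Gamma> by (simp add: linear_relation_def)
    from I[OF this, of "d * c"] show "(sc M d p, sc N d q) \<in> \<Gamma>'"
      using * c M N ab by (simp add: sc_add)
  qed
  assume "(\<zero>\<^bsub>M\<^esub>, z) \<in> \<Gamma>'"
  then obtain x y c where *: "(x, y) \<in> \<Gamma>" "\<zero>\<^bsub>M\<^esub> = x \<oplus>\<^bsub>M\<^esub> sc M c a" "z = y \<oplus>\<^bsub>N\<^esub> sc N c b"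
    by (auto simp: \<Gamma>'_def)
  show "z = \<zero>\<^bsub>N\<^esub>"
  proof (cases "c = 0")
    case True
    then show ?thesis using * sv[of y] c[of x y] M N ab by simp
  next
    case False
    have "sc M c a = \<ominus>\<^bsub>M\<^esub> x"
      using *(2) c[OF *(1)] ab M by (metis M.a_comm M.minus_equality sc_closed)
    then have "sc M (inverse c) (sc M c a) = sc M (inverse c) (sc M (-1) x)"
      using c[OF *(1)] M by (simp add: uminus_eq_sc)
    then have "a = sc M (- inverse c) x"
      using c[OF *(1)] M ab False by simp
    then have "(a, sc N (- inverse c) y) \<in> \<Gamma>"
      using *(1) \<Gamma> by (simp add: linear_relation_def)
    then show ?thesis using ab by blast
  qed
qed

text \<open>Here \<open>S\<close> is the multivalued constraint and \<open>\<Gamma>0\<close> the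
  prescribed part. A maximal graph between them already has the full domain of \<open>S\<close>, for
  otherwise a pair of \<open>S\<close> could be added by
  \<open>linear_relation_extend\<close>.\<close>

lemma linear_relation_maximal:
  assumes M: "md M" and N: "md N" and \<Gamma>0: "linear_relation M N \<Gamma>0"
    and sv: "\<And>y. (\<zero>\<^bsub>M\<^esub>, y) \<in> \<Gamma>0 \<Longrightarrow> y = \<zero>\<^bsub>N\<^esub>"
    and S: "linear_relation M N S" and sub: "\<Gamma>0 \<subseteq> S"
  obtains \<Gamma> where "linear_relation M N \<Gamma>" "\<And>y. (\<zero>\<^bsub>M\<^esub>, y) \<in> \<Gamma> \<Longrightarrow> y = \<zero>\<^bsub>N\<^esub>"
    "\<Gamma>0 \<subseteq> \<Gamma>" "\<Gamma> \<subseteq> S" "Domain \<Gamma> = Domain S"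
proof -
  define Q where "Q = {\<Gamma>. linear_relation M N \<Gamma> \<and> (\<forall>y. (\<zero>\<^bsub>M\<^esub>, y) \<in> \<Gamma> \<longrightarrow> y = \<zero>\<^bsub>N\<^esub>) \<and> \<Gamma>0 \<subseteq> \<Gamma> \<and> \<Gamma> \<subseteq> S}"
  have "\<Gamma>0 \<in> Q" using assms by (auto simp: Q_def)
  moreover have "\<Union>C \<in> Q" if "C \<noteq> {}" "subset.chain Q C" for C
  proof -
    have CQ: "C \<subseteq> Q" and tot: "\<And>A B. A \<in> C \<Longrightarrow> B \<in> C \<Longrightarrow> A \<subseteq> B \<or> B \<subseteq> A"
      using that(2) by (auto simp: subset_chain_def)
    have "linear_relation M N (\<Union>C)"
      unfolding linear_relation_def
    proof (intro conjI allI impI)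
      show "\<Union>C \<subseteq> carrier M \<times> carrier N"
        using CQ by (auto simp: Q_def linear_relation_def subset_iff)
      from that(1) obtain A where "A \<in> C" by blast
      then show "(\<zero>\<^bsub>M\<^esub>, \<zero>\<^bsub>N\<^esub>) \<in> \<Union>C"
        using CQ by (auto simp: Q_def linear_relation_def)
    next
      fix x y x' y' assume "(x, y) \<in> \<Union>C" "(x', y') \<in> \<Union>C"
      then obtain A B where "A \<in> C" "B \<in> C" "(x, y) \<in> A" "(x', y') \<in> B" by blast
      then obtain A where "A \<in> C" "(x, y) \<in> A" "(x', y') \<in> A" using tot by blast
      moreover from this have "linear_relation M N A"
        using CQ by (auto simp: Q_def)
      ultimately show "(x \<oplus>\<^bsub>M\<^esub> x', y \<oplus>\<^bsub>N\<^esub> y') \<in> \<Union>C"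
        unfolding linear_relation_def by blast
    next
      fix c x y assume "(x, y) \<in> \<Union>C"
      then obtain A where "A \<in> C" "(x, y) \<in> A" by blast
      moreover from this have "linear_relation M N A"
        using CQ by (auto simp: Q_def)
      ultimately show "(sc M c x, sc N c y) \<in> \<Union>C"
        unfolding linear_relation_def by blast
    qed
    then show ?thesis using CQ that(1) by (auto simp: Q_def)
  qed
  ultimately obtain \<Gamma> where \<Gamma>: "\<Gamma> \<in> Q" and max: "\<And>X. X \<in> Q \<Longrightarrow> \<Gamma> \<subseteq> X \<Longrightarrow> X = \<Gamma>"
    using subset_Zorn_nonempty[of Q] by blast
  then have lin: "linear_relation M N \<Gamma>" and sv\<Gamma>: "\<And>y. (\<zero>\<^bsub>M\<^esub>, y) \<in> \<Gamma> \<Longrightarrow> y = \<zero>\<^bsub>N\<^esub>"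
    and le: "\<Gamma>0 \<subseteq> \<Gamma>" "\<Gamma> \<subseteq> S" by (auto simp: Q_def)
  have "Domain S \<subseteq> Domain \<Gamma>"
  proof (rule ccontr)
    assume "\<not> Domain S \<subseteq> Domain \<Gamma>"
    then obtain a b where ab: "(a, b) \<in> S" "a \<notin> Domain \<Gamma>" by blast
    then have ab': "a \<in> carrier M" "b \<in> carrier N" using S by (auto simp: linear_relation_def)
    note ext = linear_relation_extend[OF M N lin sv\<Gamma> ab' ab(2)]
    let ?\<Gamma>' = "{(x \<oplus>\<^bsub>M\<^esub> sc M c a, y \<oplus>\<^bsub>N\<^esub> sc N c b) | x y c. (x, y) \<in> \<Gamma>}"
    have "(x \<oplus>\<^bsub>M\<^esub> sc M c a, y \<oplus>\<^bsub>N\<^esub> sc N c b) \<in> S" if "(x, y) \<in> \<Gamma>" for x y c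
      using S ab(1) le(2) that unfolding linear_relation_def by blast
    then have "?\<Gamma>' \<subseteq> S" by auto
    then have "?\<Gamma>' \<in> Q"
      using ext le by (auto simp: Q_def)
    from max[OF this ext(2)] ext(3) ab(2) show False by blast
  qed
  with that[OF lin sv\<Gamma> le] le(2) show ?thesis by blast
qed

text \<open>Zorn's lemma is used twice: once inside \<open>S\<close>, to meet the constraint on its
  domain, and once inside the full product, to extend the resulting graph to all of
  \<open>M\<close>.\<close>

lemma linear_selection:
  assumes M: "md M" and N: "md N" and \<Gamma>0: "linear_relation M N \<Gamma>0"
    and sv: "\<And>y. (\<zero>\<^bsub>M\<^esub>, y) \<in> \<Gamma>0 \<Longrightarrow> y = \<zero>\<^bsub>N\<^esub>"
    and S: "linear_relation M N S" and sub: "\<Gamma>0 \<subseteq> S"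
  obtains h where "h \<in> Lin M N" "\<And>x. x \<in> Domain S \<Longrightarrow> (x, h x) \<in> S"
    "\<And>x y. (x, y) \<in> \<Gamma>0 \<Longrightarrow> h x = y"
proof -
  obtain \<Gamma>1 where 1: "linear_relation M N \<Gamma>1" "\<And>y. (\<zero>\<^bsub>M\<^esub>, y) \<in> \<Gamma>1 \<Longrightarrow> y = \<zero>\<^bsub>N\<^esub>"
    "\<Gamma>0 \<subseteq> \<Gamma>1" "\<Gamma>1 \<subseteq> S" "Domain \<Gamma>1 = Domain S"
    by (rule linear_relation_maximal[OF M N \<Gamma>0 sv S sub]) blast+
  have full: "linear_relation M N (carrier M \<times> carrier N)"
    using M N by (auto simp: linear_relation_def)
  have sub1: "\<Gamma>1 \<subseteq> carrier M \<times> carrier N" using 1(1) by (simp add: linear_relation_def)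
  obtain \<Gamma> where 2: "linear_relation M N \<Gamma>" "\<And>y. (\<zero>\<^bsub>M\<^esub>, y) \<in> \<Gamma> \<Longrightarrow> y = \<zero>\<^bsub>N\<^esub>"
    "\<Gamma>1 \<subseteq> \<Gamma>" "Domain \<Gamma> = Domain (carrier M \<times> carrier N)"
    by (rule linear_relation_maximal[OF M N 1(1,2) full sub1]) blast+
  have "carrier N \<noteq> {}" using zero_closed[OF N] by blast
  then have dom: "Domain \<Gamma> = carrier M" using 2 by auto
  define h where "h x = (THE y. (x, y) \<in> \<Gamma>)" for x
  have hI: "h x = y" if "(x, y) \<in> \<Gamma>" for x y
    unfolding h_def using that linear_relation_single_valued[OF M N 2(1,2)] by blast
  have h: "(x, h x) \<in> \<Gamma>" if "x \<in> carrier M" for x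
    using that hI dom by (metis DomainE)
  show thesis
  proof (rule that)
    show "h \<in> Lin M N"
    proof (rule LinI)
      show "h x \<in> carrier N" if "x \<in> carrier M" for x
        using h[OF that] 2(1) by (auto simp: linear_relation_def)
      show "h (x \<oplus>\<^bsub>M\<^esub> y) = h x \<oplus>\<^bsub>N\<^esub> h y" if "x \<in> carrier M" "y \<in> carrier M" for x y
        using h[OF that(1)] h[OF that(2)] 2(1) by (intro hI) (auto simp: linear_relation_def)
      show "h (sc M c x) = sc N c (h x)" if "x \<in> carrier M" for c x
        using h[OF that(1)] 2(1) by (intro hI) (auto simp: linear_relation_def)
    qed
    show "(x, h x) \<in> S" if "x \<in> Domain S" for x
    proof -
      from that 1(5) obtain y where "(x, y) \<in> \<Gamma>1" by blast
      then show ?thesis using hI 2(3) 1(4) by blast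
    qed
    show "h x = y" if "(x, y) \<in> \<Gamma>0" for x y
      using that hI 1(3) 2(3) by blast
  qed
qed

text \<open>The constraint is the relation of all pairs (x, y) with x in \<open>U\<close> and T y =
  F x. The value 0 on \<open>Z\<close> is prescribed because the traces formed later require maps
  that kill a radical layer.\<close>

lemma linear_lift:
  assumes M: "md M" and N: "md N" and L: "md L" and F: "F \<in> Lin M L" and T: "T \<in> Lin N L"
    and U: "subspace M U" and Z: "subspace M Z" "Z \<subseteq> U"
    and FU: "\<And>x. x \<in> U \<Longrightarrow> F x \<in> T ` carrier N" and FZ: "\<And>x. x \<in> Z \<Longrightarrow> F x = \<zero>\<^bsub>L\<^esub>"
  obtains h where "h \<in> Lin M N" "\<And>x. x \<in> U \<Longrightarrow> T (h x) = F x" "\<And>x. x \<in> Z \<Longrightarrow> h x = \<zero>\<^bsub>N\<^esub>"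
proof -
  interpret N: abelian_group N using N by (simp add: md_abelian_group)
  let ?S = "{(x, y). x \<in> U \<and> y \<in> carrier N \<and> T y = F x}"
  have Uc: "U \<subseteq> carrier M" using U by (simp add: subspace_def)
  have S: "linear_relation M N ?S"
    using U Uc M N L F T
    by (auto simp: linear_relation_def subspace_def Lin_add Lin_sc Lin_zero subset_iff)
  have \<Gamma>0: "linear_relation M N (Z \<times> {\<zero>\<^bsub>N\<^esub>})"
    using Z M N by (auto simp: linear_relation_def subspace_def)
  have sub: "Z \<times> {\<zero>\<^bsub>N\<^esub>} \<subseteq> ?S"
    using Z(2) FZ N L T by (auto simp: Lin_zero)
  have sv: "y = \<zero>\<^bsub>N\<^esub>" if "(\<zero>\<^bsub>M\<^esub>, y) \<in> Z \<times> {\<zero>\<^bsub>N\<^esub>}" for y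
    using that by blast
  obtain h where h: "h \<in> Lin M N" "\<And>x. x \<in> Domain ?S \<Longrightarrow> (x, h x) \<in> ?S"
    "\<And>x y. (x, y) \<in> Z \<times> {\<zero>\<^bsub>N\<^esub>} \<Longrightarrow> h x = y"
    by (rule linear_selection[OF M N \<Gamma>0 sv S sub]) blast+
  show thesis
  proof (rule that[OF h(1)])
    show "T (h x) = F x" if "x \<in> U" for x
    proof -
      from FU[OF that] obtain y where "y \<in> carrier N" "T y = F x" by (metis imageE)
      then have "x \<in> Domain ?S" using that by blast
      from h(2)[OF this] show ?thesis by simp
    qed
    show "h x = \<zero>\<^bsub>N\<^esub>" if "x \<in> Z" for x using h(3) that by blast
  qed
qed

lemma linear_lift_surj:
  assumes M: "md M" and N: "md N" and L: "md L" and F: "F \<in> Lin M L" and T: "T \<in> Lin N L"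
    and surj: "T ` carrier N = carrier L"
  obtains h where "h \<in> Lin M N" "\<And>x. x \<in> carrier M \<Longrightarrow> T (h x) = F x"
proof -
  interpret M: abelian_group M using M by (simp add: md_abelian_group)
  have "subspace M (carrier M)" "subspace M {\<zero>\<^bsub>M\<^esub>}"
    using M by (auto simp: subspace_def)
  then show thesis
    by (rule linear_lift[OF M N L F T])
      (use that surj F M L in \<open>auto simp: Lin_closed Lin_zero\<close>)
qed

text \<open>Injectivity of \<open>i\<close> makes the set of pairs (i x, F x) a graph, which can be
  extended to the whole space.\<close>

lemma linear_extend:
  assumes M: "md M" and P: "md P" and N: "md N" and i: "i \<in> Lin M P" and F: "F \<in> Lin M N"
    and inj: "inj_on i (carrier M)"
  obtains h where "h \<in> Lin P N" "\<And>x. x \<in> carrier M \<Longrightarrow> h (i x) = F x"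
proof -
  interpret N: abelian_group N using N by (simp add: md_abelian_group)
  let ?\<Gamma> = "{(i x, F x) | x. x \<in> carrier M}"
  have \<Gamma>: "linear_relation P N ?\<Gamma>"
    unfolding linear_relation_def
  proof (intro conjI allI impI)
    show "?\<Gamma> \<subseteq> carrier P \<times> carrier N" using i F by (auto simp: Lin_closed)
    show "(\<zero>\<^bsub>P\<^esub>, \<zero>\<^bsub>N\<^esub>) \<in> ?\<Gamma>"
      using Lin_zero[OF M P i] Lin_zero[OF M N F] zero_closed[OF M] by (metis (mono_tags, lifting) mem_Collect_eq)
  next
    fix x y x' y' assume "(x, y) \<in> ?\<Gamma>" "(x', y') \<in> ?\<Gamma>"
    then obtain u u' where "u \<in> carrier M" "u' \<in> carrier M" "x = i u" "y = F u" "x' = i u'" "y' = F u'" by blast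
    then show "(x \<oplus>\<^bsub>P\<^esub> x', y \<oplus>\<^bsub>N\<^esub> y') \<in> ?\<Gamma>"
      using Lin_add[OF i, of u u'] Lin_add[OF F, of u u'] add_closed[OF M, of u u']
      by (metis (mono_tags, lifting) mem_Collect_eq)
  next
    fix c x y assume "(x, y) \<in> ?\<Gamma>"
    then obtain u where "u \<in> carrier M" "x = i u" "y = F u" by blast
    then show "(sc P c x, sc N c y) \<in> ?\<Gamma>"
      using Lin_sc[OF i, of u c] Lin_sc[OF F, of u c] sc_closed[OF M, of u c]
      by (metis (mono_tags, lifting) mem_Collect_eq)
  qed
  have sv: "y = \<zero>\<^bsub>N\<^esub>" if "(\<zero>\<^bsub>P\<^esub>, y) \<in> ?\<Gamma>" for y
  proof -
    from that obtain u where u: "u \<in> carrier M" "\<zero>\<^bsub>P\<^esub> = i u" "y = F u" by blast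
    then have "u = \<zero>\<^bsub>M\<^esub>"
      using Lin_zero[OF M P i] inj zero_closed[OF M] by (metis inj_onD)
    then show ?thesis using u Lin_zero[OF M N F] by simp
  qed
  have full: "linear_relation P N (carrier P \<times> carrier N)"
    using P N by (auto simp: linear_relation_def)
  have "?\<Gamma> \<subseteq> carrier P \<times> carrier N" using i F by (auto simp: Lin_closed)
  obtain h where "h \<in> Lin P N" "\<And>x y. (x, y) \<in> ?\<Gamma> \<Longrightarrow> h x = y"
    by (rule linear_selection[OF P N \<Gamma> sv full \<open>?\<Gamma> \<subseteq> carrier P \<times> carrier N\<close>]) blast+
  then show thesis by (intro that) auto
qed


lemma Lin_finsum:
  assumes M: "md M" and N: "md N" and F: "\<And>i. i \<in> S \<Longrightarrow> F i \<in> Lin M N"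
  shows "(\<lambda>x. \<Oplus>\<^bsub>N\<^esub>i\<in>S. F i x) \<in> Lin M N"
proof -
  interpret N: abelian_group N using N by (rule md_abelian_group)
  have c: "F i x \<in> carrier N" if "i \<in> S" "x \<in> carrier M" for i x
    using Lin_closed[OF F] that by blast
  show ?thesis
  proof (rule LinI)
    show "(\<Oplus>\<^bsub>N\<^esub>i\<in>S. F i x) \<in> carrier N" if "x \<in> carrier M" for x
      using c that by (intro N.finsum_closed) auto
    show "(\<Oplus>\<^bsub>N\<^esub>i\<in>S. F i (x \<oplus>\<^bsub>M\<^esub> y)) = (\<Oplus>\<^bsub>N\<^esub>i\<in>S. F i x) \<oplus>\<^bsub>N\<^esub> (\<Oplus>\<^bsub>N\<^esub>i\<in>S. F i y)"
      if "x \<in> carrier M" "y \<in> carrier M" for x y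
    proof -
      have "(\<Oplus>\<^bsub>N\<^esub>i\<in>S. F i (x \<oplus>\<^bsub>M\<^esub> y)) = (\<Oplus>\<^bsub>N\<^esub>i\<in>S. F i x \<oplus>\<^bsub>N\<^esub> F i y)"
        using c that N by (intro N.finsum_cong') (auto simp: Lin_add[OF F])
      then show ?thesis using c that by (simp add: N.finsum_addf Pi_def)
    qed
    show "(\<Oplus>\<^bsub>N\<^esub>i\<in>S. F i (sc M d x)) = sc N d (\<Oplus>\<^bsub>N\<^esub>i\<in>S. F i x)" if "x \<in> carrier M" for d x
    proof -
      have "sc N d (\<Oplus>\<^bsub>N\<^esub>i\<in>S. F i x) = (\<Oplus>\<^bsub>N\<^esub>i\<in>S. sc N d (F i x))"
        by (rule finsum_hom) (use N that c in \<open>auto simp: md_abelian_group sc_add\<close>)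
      also have "\<dots> = (\<Oplus>\<^bsub>N\<^esub>i\<in>S. F i (sc M d x))"
        using c that N by (intro N.finsum_cong') (auto simp: Lin_sc[OF F])
      finally show ?thesis by simp
    qed
  qed
qed


section \<open>Traces and Higman's criterion\<close>

text \<open>The sum of the conjugates g h g^-1 over a set \<open>S\<close>, used for the whole group
  and for the subgroup of translations. Equivariance under \<open>u\<close> requires only that left
  translation by \<open>u\<close> preserves \<open>S\<close>.\<close>

definition rel_tr :: "'g set \<Rightarrow> ('g \<Rightarrow> 'k, 'u) module \<Rightarrow> ('g \<Rightarrow> 'k, 'v) module \<Rightarrow> ('u \<Rightarrow> 'v) \<Rightarrow> 'u \<Rightarrow> 'v" where
  "rel_tr S M N h x = (\<Oplus>\<^bsub>N\<^esub>g\<in>S. ac N g (h (ac M (inv g) x)))"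

abbreviation tr where "tr \<equiv> rel_tr (carrier G)"

lemma finsum_translate:
  assumes N: "abelian_group N" and S: "S \<subseteq> carrier G" and x: "x \<in> carrier G" "(\<lambda>g. x \<otimes> g) ` S = S"
    and F: "\<And>g. g \<in> S \<Longrightarrow> F g \<in> carrier N"
  shows "(\<Oplus>\<^bsub>N\<^esub>g\<in>S. F (x \<otimes> g)) = (\<Oplus>\<^bsub>N\<^esub>g\<in>S. F g)"
proof -
  interpret N: abelian_group N by (fact N)
  have "inj_on (\<lambda>g. x \<otimes> g) S"
    using x(1) subsetD[OF S] by (auto simp: inj_on_def)
  then show ?thesis
    using N.finsum_reindex[of F "\<lambda>g. x \<otimes> g" S] F x by auto
qed

context
  fixes S :: "'g set"
  assumes S: "S \<subseteq> carrier G"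
begin

lemma S_closed [simp]: "g \<in> S \<Longrightarrow> g \<in> carrier G"
  using S by blast

lemma rel_tr_Lin:
  assumes M: "md M" and N: "md N" and h: "h \<in> Lin M N"
  shows "rel_tr S M N h \<in> Lin M N"
  unfolding rel_tr_def [abs_def]
proof (rule Lin_finsum[OF M N])
  fix g assume g: "g \<in> S"
  show "(\<lambda>x. ac N g (h (ac M (inv g) x))) \<in> Lin M N"
    using Lin_comp[OF Lin_comp[OF ac_Lin[OF M] h] ac_Lin[OF N], of "inv g" g] g by (simp add: comp_def)
qed

text \<open>An equivariant \<open>f\<close> passes through each conjugate. Together with the version
  on the right this makes the traces an ideal in the category of modules.\<close>

lemma rel_tr_comp_hom_left:
  assumes M: "md M" and N: "md N" and L: "md L" and h: "h \<in> Lin M N" and f: "f \<in> Hom N L" and x: "x \<in> carrier M"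
  shows "f (rel_tr S M N h x) = rel_tr S M L (f \<circ> h) x"
proof -
  interpret L: abelian_group L using L by (simp add: md_abelian_group)
  have "f (rel_tr S M N h x) = (\<Oplus>\<^bsub>L\<^esub>g\<in>S. f (ac N g (h (ac M (inv g) x))))"
    unfolding rel_tr_def
    by (rule finsum_hom) (use assms in \<open>auto simp: md_abelian_group hom_closed hom_add Lin_closed\<close>)
  also have "\<dots> = rel_tr S M L (f \<circ> h) x"
    unfolding rel_tr_def using assms
    by (intro L.finsum_cong') (auto simp: Lin_closed hom_closed hom_ac)
  finally show ?thesis .
qed

lemma rel_tr_comp_hom_right:
  assumes M: "md M" and N: "md N" and L: "md L" and h: "h \<in> Lin M N" and f: "f \<in> Hom L M" and x: "x \<in> carrier L"
  shows "rel_tr S M N h (f x) = rel_tr S L N (h \<circ> f) x"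
proof -
  interpret N: abelian_group N using N by (simp add: md_abelian_group)
  show ?thesis
    unfolding rel_tr_def using assms
    by (intro N.finsum_cong') (auto simp: Lin_closed hom_closed hom_ac)
qed

lemma rel_tr_plus:
  assumes "md M" "md N" "h \<in> Lin M N" "h' \<in> Lin M N" "x \<in> carrier M"
  shows "rel_tr S M N (\<lambda>y. h y \<oplus>\<^bsub>N\<^esub> h' y) x = rel_tr S M N h x \<oplus>\<^bsub>N\<^esub> rel_tr S M N h' x"
proof -
  interpret N: abelian_group N using assms by (simp add: md_abelian_group)
  have "rel_tr S M N (\<lambda>y. h y \<oplus>\<^bsub>N\<^esub> h' y) x =
    (\<Oplus>\<^bsub>N\<^esub>g\<in>S. ac N g (h (ac M (inv g) x)) \<oplus>\<^bsub>N\<^esub> ac N g (h' (ac M (inv g) x)))"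
    unfolding rel_tr_def using assms
    by (intro N.finsum_cong') (auto simp: Lin_closed ac_add)
  then show ?thesis
    using assms by (simp add: rel_tr_def Lin_closed Pi_def N.finsum_addf)
qed

lemma ac_rel_tr:
  assumes M: "md M" and N: "md N" and h: "h \<in> Lin M N" and x: "x \<in> carrier M"
    and u: "u \<in> carrier G" "(\<lambda>g. u \<otimes> g) ` S = S"
  shows "rel_tr S M N h (ac M u x) = ac N u (rel_tr S M N h x)"
proof -
  interpret N: abelian_group N using N by (rule md_abelian_group)
  have "ac N u (rel_tr S M N h x) = (\<Oplus>\<^bsub>N\<^esub>g\<in>S. ac N u (ac N g (h (ac M (inv g) x))))"
    unfolding rel_tr_def
    by (rule finsum_hom) (use M N h u x in \<open>auto simp: md_abelian_group ac_add Lin_closed\<close>)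
  also have "\<dots> = (\<Oplus>\<^bsub>N\<^esub>g\<in>S. ac N (u \<otimes> g) (h (ac M (inv (u \<otimes> g)) (ac M u x))))"
    using M N h u(1) x by (intro N.finsum_cong') (auto simp: ac_ac Lin_closed inv_mult_group m_assoc)
  also have "\<dots> = rel_tr S M N h (ac M u x)"
    unfolding rel_tr_def using M N h x u
    by (intro finsum_translate[where F = "\<lambda>g. ac N g (h (ac M (inv g) (ac M u x)))"] S)
      (auto simp: md_abelian_group Lin_closed)
  finally show ?thesis by simp
qed

end

lemmas tr_comp_hom_left = rel_tr_comp_hom_left [OF subset_refl]
lemmas tr_comp_hom_right = rel_tr_comp_hom_right [OF subset_refl]

lemma tr_cong:
  assumes "md M" "md N" "h \<in> Lin M N" "x \<in> carrier M" "\<And>y. y \<in> carrier M \<Longrightarrow> h y = h' y"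
  shows "tr M N h x = tr M N h' x"
proof -
  interpret N: abelian_group N using assms by (simp add: md_abelian_group)
  show ?thesis
    unfolding rel_tr_def using assms
    by (intro N.finsum_cong') (auto simp: Lin_closed simp flip: assms(5))
qed

lemma tr_hom:
  assumes M: "md M" and N: "md N" and h: "h \<in> Lin M N"
  shows "tr M N h \<in> Hom M N"
  by (rule hom_LinI[OF M N rel_tr_Lin[OF subset_refl M N h]])
    (auto intro!: ac_rel_tr[OF subset_refl M N h] surj_const_mult)

lemma tr_closed: "md M \<Longrightarrow> md N \<Longrightarrow> h \<in> Lin M N \<Longrightarrow> x \<in> carrier M \<Longrightarrow> tr M N h x \<in> carrier N"
  by (rule hom_closed[OF tr_hom])

end

section \<open>Copying modules of functions into the universe\<close>

lemma PiE_const_mem: "f \<in> A \<rightarrow>\<^sub>E B \<Longrightarrow> x \<in> A \<Longrightarrow> f x \<in> B"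
  by (rule PiE_mem)

text \<open>An infinite type is equinumerous with its square, so one coordinate at a time can be
  absorbed into the code.\<close>

lemma ex_inj_on_PiE:
  assumes inf: "infinite (UNIV :: 'u set)" and "finite A"
  shows "\<exists>J :: ('a \<Rightarrow> 'u) \<Rightarrow> 'u. inj_on J (A \<rightarrow>\<^sub>E UNIV)"
proof -
  obtain p :: "'u \<times> 'u \<Rightarrow> 'u" where p: "inj p"
    using card_of_Times_same_infinite[OF inf] unfolding card_of_ordIso[symmetric]
    by (auto simp: bij_betw_def)
  show ?thesis
    using \<open>finite A\<close>
  proof (induction A rule: finite_induct)
    case (insert a A)
    from insert.IH obtain J :: "('a \<Rightarrow> 'u) \<Rightarrow> 'u" where J: "inj_on J (A \<rightarrow>\<^sub>E UNIV)" ..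
    have "inj_on (\<lambda>\<phi>. p (\<phi> a, J (\<phi>(a := undefined)))) (insert a A \<rightarrow>\<^sub>E UNIV)"
    proof (rule inj_onI)
      fix \<phi> \<psi> :: "'a \<Rightarrow> 'u"
      assume \<phi>\<psi>: "\<phi> \<in> insert a A \<rightarrow>\<^sub>E UNIV" "\<psi> \<in> insert a A \<rightarrow>\<^sub>E UNIV"
        and "p (\<phi> a, J (\<phi>(a := undefined))) = p (\<psi> a, J (\<psi>(a := undefined)))"
      from injD[OF p this(3)] have eq: "\<phi> a = \<psi> a" "J (\<phi>(a := undefined)) = J (\<psi>(a := undefined))"
        by simp_all
      have "\<phi>(a := undefined) \<in> A \<rightarrow>\<^sub>E UNIV" "\<psi>(a := undefined) \<in> A \<rightarrow>\<^sub>E UNIV"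
        using \<phi>\<psi> by (auto simp: PiE_def extensional_def)
      then have "\<phi>(a := undefined) = \<psi>(a := undefined)"
        using inj_onD[OF J, OF eq(2)] by blast
      then show "\<phi> = \<psi>"
        using eq(1) by (metis fun_upd_triv fun_upd_upd)
    qed
    then show ?case by blast
  qed simp
qed

definition transport :: "('u \<Rightarrow> 'v) \<Rightarrow> ('v \<Rightarrow> 'u) \<Rightarrow> ('r, 'u) module \<Rightarrow> ('r, 'v) module" where
  "transport J J' M = \<lparr>carrier = J ` carrier M, monoid.mult = (\<lambda>x y. x), one = J \<zero>\<^bsub>M\<^esub>, zero = J \<zero>\<^bsub>M\<^esub>,
     add = (\<lambda>x y. J (J' x \<oplus>\<^bsub>M\<^esub> J' y)), smult = (\<lambda>a x. J (a \<odot>\<^bsub>M\<^esub> J' x))\<rparr>"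

lemma transport_simps:
  "carrier (transport J J' M) = J ` carrier M"
  "\<zero>\<^bsub>transport J J' M\<^esub> = J \<zero>\<^bsub>M\<^esub>"
  "x \<oplus>\<^bsub>transport J J' M\<^esub> y = J (J' x \<oplus>\<^bsub>M\<^esub> J' y)"
  "a \<odot>\<^bsub>transport J J' M\<^esub> x = J (a \<odot>\<^bsub>M\<^esub> J' x)"
  by (simp_all add: transport_def)

lemma left_module_transport:
  assumes M: "left_module R M" and inv: "\<And>x. x \<in> carrier M \<Longrightarrow> J' (J x) = x"
  shows "left_module R (transport J J' M)"
proof -
  interpret left_module R M by (fact M)
  show ?thesis
  proof (rule left_moduleI)
    show "ring R" by (fact R.ring_axioms)
    show "abelian_group (transport J J' M)"
    proof (rule abelian_groupI)
      fix x assume "x \<in> carrier (transport J J' M)"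
      then obtain u where u: "u \<in> carrier M" "x = J u" by (auto simp: transport_simps)
      then show "\<exists>y\<in>carrier (transport J J' M). y \<oplus>\<^bsub>transport J J' M\<^esub> x = \<zero>\<^bsub>transport J J' M\<^esub>"
        by (intro bexI[of _ "J (\<ominus>\<^bsub>M\<^esub> u)"]) (auto simp: transport_simps inv M.l_neg)
    qed (auto simp: transport_simps inv M.a_ac)
  qed (auto simp: transport_simps inv smult_l_distr smult_r_distr smult_assoc1)
qed

lemma transport_hom:
  assumes "left_module R M" and inv: "\<And>x. x \<in> carrier M \<Longrightarrow> J' (J x) = x"
  shows "J \<in> left_module_hom R M (transport J J' M)" "J' \<in> left_module_hom R (transport J J' M) M"
proof -
  interpret left_module R M by fact
  show "J \<in> left_module_hom R M (transport J J' M)" "J' \<in> left_module_hom R (transport J J' M) M"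
    by (auto simp: left_module_hom_def transport_simps inv)
qed

context finite_group
begin

text \<open>By the ideal property, p (tr h) i is the trace of p h i. Hence being the trace of a
  linear map passes from the identity of \<open>P\<close> to the identity of any retract, in
  particular to that of any isomorphic copy.\<close>

lemma tr_id_retract:
  assumes P: "md P" and Q: "md Q" and h: "h \<in> Lin P P" "\<And>x. x \<in> carrier P \<Longrightarrow> tr P P h x = x"
    and i: "i \<in> Hom Q P" and p: "p \<in> Hom P Q" and pi: "\<And>x. x \<in> carrier Q \<Longrightarrow> p (i x) = x"
  shows "p \<circ> h \<circ> i \<in> Lin Q Q" "x \<in> carrier Q \<Longrightarrow> tr Q Q (p \<circ> h \<circ> i) x = x"
proof -
  have L: "h \<circ> i \<in> Lin Q P" using h i P Q by (intro Lin_comp[OF hom_Lin]) auto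
  show "p \<circ> h \<circ> i \<in> Lin Q Q"
    unfolding comp_assoc using L p P Q by (intro Lin_comp[OF L] hom_Lin)
  assume x: "x \<in> carrier Q"
  have "x = p (tr P P h (i x))" using x h i pi by (simp add: hom_closed)
  also have "\<dots> = p (tr Q P (h \<circ> i) x)" using P Q h i x by (simp add: tr_comp_hom_right)
  also have "\<dots> = tr Q Q (p \<circ> h \<circ> i) x" using P Q L p x by (simp add: tr_comp_hom_left comp_assoc)
  finally show "tr Q Q (p \<circ> h \<circ> i) x = x" by simp
qed

text \<open>A linear lift of \<open>h\<close> through the surjection exists without any
  projectivity; its trace is equivariant and lies over the trace of \<open>h\<close>. The dual
  argument gives \<open>tr_extend\<close>.\<close>

lemma tr_lift:
  assumes X: "md X" and Q: "md Q" and N: "md N" and h: "h \<in> Lin X N"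
    and p: "p \<in> Hom Q N" "p ` carrier Q = carrier N"
  obtains h' where "h' \<in> Lin X Q" "tr X Q h' \<in> Hom X Q"
    "\<And>x. x \<in> carrier X \<Longrightarrow> p (tr X Q h' x) = tr X N h x"
proof -
  obtain h' where h': "h' \<in> Lin X Q" "\<And>x. x \<in> carrier X \<Longrightarrow> p (h' x) = h x"
    by (rule linear_lift_surj[OF X Q N h hom_Lin[OF Q N p(1)] p(2)]) blast
  have "p (tr X Q h' x) = tr X N h x" if "x \<in> carrier X" for x
    using that h' p X Q N
    by (simp add: tr_comp_hom_left) (intro tr_cong, auto intro: Lin_comp hom_Lin)
  then show thesis using h' X Q by (intro that) (auto intro: tr_hom)
qed

lemma tr_extend:
  assumes X: "md X" and P: "md P" and N: "md N" and h: "h \<in> Lin X N"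
    and i: "i \<in> Hom X P" "inj_on i (carrier X)"
  obtains h' where "h' \<in> Lin P N" "tr P N h' \<in> Hom P N"
    "\<And>x. x \<in> carrier X \<Longrightarrow> tr P N h' (i x) = tr X N h x"
proof -
  obtain h' where h': "h' \<in> Lin P N" "\<And>x. x \<in> carrier X \<Longrightarrow> h' (i x) = h x"
    by (rule linear_extend[OF X P N hom_Lin[OF X P i(1)] h i(2)]) blast
  have "tr P N h' (i x) = tr X N h x" if "x \<in> carrier X" for x
    using that h' i X P N
    by (simp add: tr_comp_hom_right) (intro tr_cong, auto intro: Lin_comp hom_Lin)
  then show thesis using h' P N by (intro that) (auto intro: tr_hom)
qed

text \<open>If the identity is the trace of \<open>h\<close>, then every \<open>f\<close> out of
  \<open>P\<close> is the trace of \<open>f \<circ> h\<close>, and traces lift by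
  \<open>tr_lift\<close>.\<close>

lemma projective_if_tr_id:
  assumes P: "md P" and h: "h \<in> Lin P P" "\<And>x. x \<in> carrier P \<Longrightarrow> tr P P h x = x"
  shows "projective_module R P"
  unfolding projective_module_def
proof (intro conjI allI ballI impI)
  fix B C :: "('g \<Rightarrow> 'k, 'v) module" and g f
  assume g: "g \<in> Hom B C" and f: "f \<in> Hom P C" and "md B \<and> md C \<and> g ` carrier B = carrier C"
  then have B: "md B" and C: "md C" and surj: "g ` carrier B = carrier C" by auto
  have fh: "f \<circ> h \<in> Lin P C" using f P C by (intro Lin_comp[OF h(1)] hom_Lin)
  obtain h' where h': "tr P B h' \<in> Hom P B" "\<And>x. x \<in> carrier P \<Longrightarrow> g (tr P B h' x) = tr P C (f \<circ> h) x"
    by (rule tr_lift[OF P B C fh g surj]) blast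
  have "tr P C (f \<circ> h) x = f x" if "x \<in> carrier P" for x
    using tr_comp_hom_left[OF P P C h(1) f that] h(2)[OF that] by simp
  with h' show "\<exists>f'\<in>Hom P B. \<forall>x\<in>carrier P. g (f' x) = f x" by force
qed (fact P)

text \<open>The module induced (equivalently, coinduced) from the underlying vector space of \<open>M\<close>,
  realised on functions \<open>G \<rightarrow> M\<close>.\<close>

definition ind :: "('g \<Rightarrow> 'k, 'u) module \<Rightarrow> ('g \<Rightarrow> 'k, 'g \<Rightarrow> 'u) module" where
  "ind M = rep_module \<lparr>carrier = carrier G \<rightarrow>\<^sub>E carrier M, monoid.mult = (\<lambda>\<phi> \<psi>. \<phi>), one = (\<lambda>g\<in>carrier G. \<zero>\<^bsub>M\<^esub>),
       zero = (\<lambda>g\<in>carrier G. \<zero>\<^bsub>M\<^esub>), add = (\<lambda>\<phi> \<psi>. \<lambda>g\<in>carrier G. \<phi> g \<oplus>\<^bsub>M\<^esub> \<psi> g)\<rparr>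
     (\<lambda>c \<phi>. \<lambda>g\<in>carrier G. sc M c (\<phi> g)) (\<lambda>x \<phi>. \<lambda>g\<in>carrier G. \<phi> (inv x \<otimes> g))"

lemma ind_simps:
  "carrier (ind M) = carrier G \<rightarrow>\<^sub>E carrier M"
  "\<zero>\<^bsub>ind M\<^esub> = (\<lambda>g\<in>carrier G. \<zero>\<^bsub>M\<^esub>)"
  "\<phi> \<oplus>\<^bsub>ind M\<^esub> \<psi> = (\<lambda>g\<in>carrier G. \<phi> g \<oplus>\<^bsub>M\<^esub> \<psi> g)"
  by (simp_all add: ind_def rep_module_def)

lemma
  assumes M: "md M"
  shows ind_md: "md (ind M)"
    and ind_sc: "\<phi> \<in> carrier G \<rightarrow>\<^sub>E carrier M \<Longrightarrow> sc (ind M) c \<phi> = (\<lambda>g\<in>carrier G. sc M c (\<phi> g))"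
    and ind_ac: "\<phi> \<in> carrier G \<rightarrow>\<^sub>E carrier M \<Longrightarrow> x \<in> carrier G \<Longrightarrow>
      ac (ind M) x \<phi> = (\<lambda>g\<in>carrier G. \<phi> (inv x \<otimes> g))"
proof -
  interpret M: abelian_group M using M by (rule md_abelian_group)
  let ?B = "\<lparr>carrier = carrier G \<rightarrow>\<^sub>E carrier M, monoid.mult = (\<lambda>\<phi> \<psi>. \<phi>), one = (\<lambda>g\<in>carrier G. \<zero>\<^bsub>M\<^esub>),
       zero = (\<lambda>g\<in>carrier G. \<zero>\<^bsub>M\<^esub>), add = (\<lambda>\<phi> \<psi>. \<lambda>g\<in>carrier G. \<phi> g \<oplus>\<^bsub>M\<^esub> \<psi> g)\<rparr>"
  let ?s = "\<lambda>c \<phi>. \<lambda>g\<in>carrier G. sc M c (\<phi> g)" and ?r = "\<lambda>x \<phi>. \<lambda>g\<in>carrier G. \<phi> (inv x \<otimes> g)"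
  have c: "\<phi> g \<in> carrier M" if "\<phi> \<in> carrier G \<rightarrow>\<^sub>E carrier M" "g \<in> carrier G" for \<phi> g
    using that by (rule PiE_const_mem)
  have eta: "(\<lambda>g\<in>carrier G. F g) = \<phi>" if "\<phi> \<in> carrier G \<rightarrow>\<^sub>E carrier M" "\<And>g. g \<in> carrier G \<Longrightarrow> F g = \<phi> g" for \<phi> F
    using that by (auto simp: PiE_def extensional_def restrict_def)
  have B: "abelian_group ?B"
  proof (rule abelian_groupI)
    fix \<phi> assume \<phi>: "\<phi> \<in> carrier ?B"
    show "\<exists>\<psi>\<in>carrier ?B. \<psi> \<oplus>\<^bsub>?B\<^esub> \<phi> = \<zero>\<^bsub>?B\<^esub>"
      using \<phi> by (intro bexI[of _ "\<lambda>g\<in>carrier G. \<ominus>\<^bsub>M\<^esub> \<phi> g"]) (auto simp: c M.l_neg intro!: restrict_ext)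
    show "\<zero>\<^bsub>?B\<^esub> \<oplus>\<^bsub>?B\<^esub> \<phi> = \<phi>"
      using \<phi> by (auto simp: c intro!: eta)
  qed (auto simp: c M.a_ac intro!: restrict_ext)
  have 1: "\<And>c x. x \<in> carrier ?B \<Longrightarrow> ?s c x \<in> carrier ?B"
    "\<And>c d x. x \<in> carrier ?B \<Longrightarrow> ?s (c + d) x = ?s c x \<oplus>\<^bsub>?B\<^esub> ?s d x"
    "\<And>c x y. x \<in> carrier ?B \<Longrightarrow> y \<in> carrier ?B \<Longrightarrow> ?s c (x \<oplus>\<^bsub>?B\<^esub> y) = ?s c x \<oplus>\<^bsub>?B\<^esub> ?s c y"
    "\<And>c d x. x \<in> carrier ?B \<Longrightarrow> ?s c (?s d x) = ?s (c * d) x"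
    "\<And>x. x \<in> carrier ?B \<Longrightarrow> ?s 1 x = x"
    using M by (auto simp: c sc_add_left sc_add intro!: restrict_ext eta)
  have 2: "\<And>g x. g \<in> carrier G \<Longrightarrow> x \<in> carrier ?B \<Longrightarrow> ?r g x \<in> carrier ?B"
    "\<And>g x y. g \<in> carrier G \<Longrightarrow> x \<in> carrier ?B \<Longrightarrow> y \<in> carrier ?B \<Longrightarrow> ?r g (x \<oplus>\<^bsub>?B\<^esub> y) = ?r g x \<oplus>\<^bsub>?B\<^esub> ?r g y"
    "\<And>g c x. g \<in> carrier G \<Longrightarrow> x \<in> carrier ?B \<Longrightarrow> ?r g (?s c x) = ?s c (?r g x)"
    "\<And>g h x. g \<in> carrier G \<Longrightarrow> h \<in> carrier G \<Longrightarrow> x \<in> carrier ?B \<Longrightarrow> ?r g (?r h x) = ?r (g \<otimes> h) x"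
    "\<And>x. x \<in> carrier ?B \<Longrightarrow> ?r \<one> x = x"
    by (auto simp: c inv_mult_group m_assoc intro!: restrict_ext eta)
  show "md (ind M)"
    unfolding ind_def by (rule rep_module_md[OF B 1 2])
  show "sc (ind M) c \<phi> = ?s c \<phi>" if "\<phi> \<in> carrier G \<rightarrow>\<^sub>E carrier M"
    unfolding ind_def using that by (intro rep_module_sc[OF B 1 2]) simp_all
  show "ac (ind M) x \<phi> = ?r x \<phi>" if "\<phi> \<in> carrier G \<rightarrow>\<^sub>E carrier M" "x \<in> carrier G"
    unfolding ind_def using that by (intro rep_module_ac[OF B 1 2]) simp_all
qed

lemma ind_finsum_apply:
  assumes M: "md M" and F: "\<And>i. i \<in> A \<Longrightarrow> F i \<in> carrier (ind M)" and g: "g \<in> carrier G"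
  shows "(\<Oplus>\<^bsub>ind M\<^esub>i\<in>A. F i) g = (\<Oplus>\<^bsub>M\<^esub>i\<in>A. F i g)"
  by (rule finsum_hom[where f = "\<lambda>\<phi>. \<phi> g"])
    (use assms in \<open>auto simp: md_abelian_group ind_md ind_simps\<close>)

lemma ind_mem: "\<phi> \<in> carrier (ind M) \<Longrightarrow> g \<in> carrier G \<Longrightarrow> \<phi> g \<in> carrier M"
  unfolding ind_simps by (rule PiE_const_mem)

definition ind_proj :: "('g \<Rightarrow> 'k, 'u) module \<Rightarrow> ('g \<Rightarrow> 'u) \<Rightarrow> 'g \<Rightarrow> 'u" where
  "ind_proj M \<phi> = (\<lambda>g\<in>carrier G. if g = \<one> then \<phi> g else \<zero>\<^bsub>M\<^esub>)"

text \<open>\<open>ind_proj\<close> is the projection onto the coordinate at the identity. Its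
  conjugates are the projections onto all the coordinates, one for each group element, and these add
  up to the identity.\<close>

lemma ind_tr_id:
  assumes M: "md M"
  shows "ind_proj M \<in> Lin (ind M) (ind M)"
    and "\<phi> \<in> carrier (ind M) \<Longrightarrow> tr (ind M) (ind M) (ind_proj M) \<phi> = \<phi>"
proof -
  interpret M: abelian_group M using M by (rule md_abelian_group)
  show proj: "ind_proj M \<in> Lin (ind M) (ind M)"
  proof (rule LinI)
    fix c \<phi> assume \<phi>: "\<phi> \<in> carrier (ind M)"
    have "ind_proj M \<phi> \<in> carrier G \<rightarrow>\<^sub>E carrier M"
      using \<phi> M by (auto simp: ind_simps ind_proj_def ind_mem[unfolded ind_simps])
    then show "ind_proj M (sc (ind M) c \<phi>) = sc (ind M) c (ind_proj M \<phi>)"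
      using \<phi> M by (auto simp: ind_simps ind_sc ind_proj_def fun_eq_iff)
  qed (use M in \<open>auto simp: ind_simps ind_proj_def ind_mem[unfolded ind_simps] fun_eq_iff\<close>)
  assume \<phi>: "\<phi> \<in> carrier (ind M)"
  show "tr (ind M) (ind M) (ind_proj M) \<phi> = \<phi>"
  proof
    fix x
    show "tr (ind M) (ind M) (ind_proj M) \<phi> x = \<phi> x"
    proof (cases "x \<in> carrier G")
      case True
      have "tr (ind M) (ind M) (ind_proj M) \<phi> x = (\<Oplus>\<^bsub>M\<^esub>g\<in>carrier G. ac (ind M) g (ind_proj M (ac (ind M) (inv g) \<phi>)) x)"
        unfolding rel_tr_def using M True \<phi>
        by (intro ind_finsum_apply) (auto intro!: ac_closed Lin_closed[OF proj] simp: ind_md)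
      also have "\<dots> = (\<Oplus>\<^bsub>M\<^esub>g\<in>carrier G. if x = g then \<phi> g else \<zero>\<^bsub>M\<^esub>)"
      proof (rule M.finsum_cong'[OF refl])
        fix g assume g: "g \<in> carrier G"
        have c1: "ac (ind M) (inv g) \<phi> \<in> carrier (ind M)" using M \<phi> g by (simp add: ind_md)
        then have "ind_proj M (ac (ind M) (inv g) \<phi>) \<in> carrier (ind M)" by (rule Lin_closed[OF proj])
        then have "ac (ind M) g (ind_proj M (ac (ind M) (inv g) \<phi>)) x = ind_proj M (ac (ind M) (inv g) \<phi>) (inv g \<otimes> x)"
          using M g True by (simp add: ind_ac ind_simps)
        also have "\<dots> = (if inv g \<otimes> x = \<one> then \<phi> (g \<otimes> (inv g \<otimes> x)) else \<zero>\<^bsub>M\<^esub>)"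
          using M g True \<phi> by (simp add: ind_proj_def ind_ac ind_simps)
        also have "\<dots> = (if x = g then \<phi> g else \<zero>\<^bsub>M\<^esub>)"
          using g True by (auto simp: inv_solve_left')
        finally show "ac (ind M) g (ind_proj M (ac (ind M) (inv g) \<phi>)) x = (if x = g then \<phi> g else \<zero>\<^bsub>M\<^esub>)" .
      qed (use \<phi> in \<open>auto simp: ind_simps\<close>)
      also have "\<dots> = \<phi> x"
        using \<phi> True by (intro M.finsum_singleton) (auto simp: ind_simps)
      finally show ?thesis .
    next
      case False
      have "tr (ind M) (ind M) (ind_proj M) \<phi> \<in> carrier (ind M)"
        using M \<phi> proj by (simp add: tr_closed ind_md)
      then show ?thesis using False \<phi> unfolding ind_simps by (metis PiE_arb)
    qed
  qed
qed

lemma ind_unit_hom: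
  assumes "md M"
  shows "(\<lambda>x. \<lambda>g\<in>carrier G. ac M (inv g) x) \<in> Hom M (ind M)"
  by (rule hom_LinI[OF _ _ LinI])
    (use assms in \<open>auto simp: ind_md ind_simps ind_sc ind_ac ac_add ac_sc ac_ac inv_mult_group fun_eq_iff\<close>)

text \<open>Composed with the map of \<open>ind_unit_hom\<close>, this is the trace of
  \<open>h\<close>. It is therefore the second half of the factorisation of a trace through an
  induced module.\<close>

lemma ind_counit_hom:
  assumes M: "md M" and N: "md N" and h: "h \<in> Lin M N"
  shows "(\<lambda>\<phi>. \<Oplus>\<^bsub>N\<^esub>g\<in>carrier G. ac N g (h (\<phi> g))) \<in> Hom (ind M) N" (is "?b \<in> _")
proof (rule hom_LinI[OF ind_md[OF M] N Lin_finsum[OF ind_md[OF M] N]])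
  interpret N: abelian_group N using N by (rule md_abelian_group)
  show "(\<lambda>\<phi>. ac N g (h (\<phi> g))) \<in> Lin (ind M) N" if g: "g \<in> carrier G" for g
  proof -
    have "(\<lambda>\<phi>. \<phi> g) \<in> Lin (ind M) M"
      using M g by (intro LinI) (auto simp: ind_simps ind_sc)
    from Lin_comp[OF Lin_comp[OF this h] ac_Lin[OF N g]] show ?thesis by (simp add: comp_def)
  qed
  have c: "ac N g (h (\<phi> g)) \<in> carrier N" if "g \<in> carrier G" "\<phi> \<in> carrier (ind M)" for g \<phi>
    using that N h by (simp add: ind_mem Lin_closed)
  show "?b (ac (ind M) x \<phi>) = ac N x (?b \<phi>)" if x: "x \<in> carrier G" and \<phi>: "\<phi> \<in> carrier (ind M)" for x \<phi>
  proof -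
    have "ac N x (?b \<phi>) = (\<Oplus>\<^bsub>N\<^esub>g\<in>carrier G. ac N x (ac N g (h (\<phi> g))))"
      by (rule finsum_hom) (use N x \<phi> c in \<open>auto simp: md_abelian_group ac_add\<close>)
    also have "\<dots> = (\<Oplus>\<^bsub>N\<^esub>g\<in>carrier G. ac N (x \<otimes> g) (h (ac (ind M) x \<phi> (x \<otimes> g))))"
      using x \<phi> M N h
      by (intro N.finsum_cong') (auto simp: ind_simps ind_ac ind_mem[unfolded ind_simps] ac_ac Lin_closed m_assoc[symmetric])
    also have "\<dots> = ?b (ac (ind M) x \<phi>)"
      using x c[OF _ ac_closed[OF ind_md[OF M] x \<phi>]] N
      by (intro finsum_translate[where F = "\<lambda>g. ac N g (h (ac (ind M) x \<phi> g))"])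
        (auto simp: md_abelian_group surj_const_mult)
    finally show ?thesis by simp
  qed
qed

end

section \<open>Higman's criterion in an infinite universe\<close>

locale finite_group_universe = finite_group G K for G :: "'g monoid" (structure) and K :: "'k::field itself" +
  fixes U :: "'u itself"
  assumes infinite_universe: "infinite (UNIV :: 'u set)"
begin

text \<open>The definition of \<open>stably_zero\<close> admits only projectives whose carrier lies
  in \<open>'u\<close>, whereas \<open>ind M\<close> consists of functions into \<open>'u\<close>; a
  copy of it is needed.\<close>

lemma ex_ind_copy:
  fixes M :: "('g \<Rightarrow> 'k, 'u) module"
  assumes M: "md M"
  obtains I :: "('g \<Rightarrow> 'k, 'u) module" and J J' \<epsilon> where "md I" "J \<in> Hom (ind M) I" "J' \<in> Hom I (ind M)"
    "\<And>\<phi>. \<phi> \<in> carrier (ind M) \<Longrightarrow> J' (J \<phi>) = \<phi>" "\<epsilon> \<in> Lin I I" "\<And>x. x \<in> carrier I \<Longrightarrow> tr I I \<epsilon> x = x"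
proof -
  obtain J :: "('g \<Rightarrow> 'u) \<Rightarrow> 'u" where "inj_on J (carrier G \<rightarrow>\<^sub>E UNIV)"
    using ex_inj_on_PiE[OF infinite_universe finite_carrier] by blast
  then have J: "inj_on J (carrier (ind M))"
    by (rule inj_on_subset) (auto simp: ind_simps)
  define J' where "J' = inv_into (carrier (ind M)) J"
  have inv: "J' (J \<phi>) = \<phi>" if "\<phi> \<in> carrier (ind M)" for \<phi>
    using that J by (simp add: J'_def)
  have I: "md (transport J J' (ind M))"
    using ind_md[OF M] inv by (rule left_module_transport)
  have homs: "J \<in> Hom (ind M) (transport J J' (ind M))" "J' \<in> Hom (transport J J' (ind M)) (ind M)"
    using transport_hom[OF ind_md[OF M], of J' J] inv by auto
  have JJ': "J (J' x) = x" if "x \<in> carrier (transport J J' (ind M))" for x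
    using that inv by (auto simp: transport_simps)
  show thesis
  proof (rule that[OF I homs inv])
    note retract = tr_id_retract[OF ind_md[OF M] I ind_tr_id(1)[OF M] _ homs(2,1)]
    show "J \<circ> ind_proj M \<circ> J' \<in> Lin (transport J J' (ind M)) (transport J J' (ind M))"
      by (rule retract(1)) (use ind_tr_id(2)[OF M] JJ' in auto)
    show "tr (transport J J' (ind M)) (transport J J' (ind M)) (J \<circ> ind_proj M \<circ> J') x = x"
      if "x \<in> carrier (transport J J' (ind M))" for x
      by (rule retract(2)) (use ind_tr_id(2)[OF M] JJ' that in auto)
  qed
qed

text \<open>The counit belonging to the identity maps an induced module onto \<open>P\<close>.
  Projectivity splits it, and \<open>tr_id_retract\<close> carries the averaging map of the induced
  module over to \<open>P\<close>.\<close>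

lemma projective_iff_tr_id:
  fixes P :: "('g \<Rightarrow> 'k, 'u) module"
  assumes P: "md P"
  shows "projective_module R P \<longleftrightarrow> (\<exists>h\<in>Lin P P. \<forall>x\<in>carrier P. tr P P h x = x)"
proof
  assume proj: "projective_module R P"
  interpret P: abelian_group P using P by (rule md_abelian_group)
  obtain I :: "('g \<Rightarrow> 'k, 'u) module" and J J' \<epsilon> where I: "md I" "J \<in> Hom (ind P) I" "J' \<in> Hom I (ind P)"
    "\<And>\<phi>. \<phi> \<in> carrier (ind P) \<Longrightarrow> J' (J \<phi>) = \<phi>" "\<epsilon> \<in> Lin I I" "\<And>x. x \<in> carrier I \<Longrightarrow> tr I I \<epsilon> x = x"
    by (rule ex_ind_copy[OF P]) blast
  have id: "id \<in> Lin P P" by (rule LinI) auto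
  define b where "b = (\<lambda>\<phi>. \<Oplus>\<^bsub>P\<^esub>g\<in>carrier G. ac P g (id (\<phi> g)))"
  have b: "b \<in> Hom (ind P) P" unfolding b_def by (rule ind_counit_hom[OF P P id])
  have bJ: "b \<circ> J' \<in> Hom I P" by (rule hom_comp[OF I(3) b])
  have "x \<in> (b \<circ> J') ` carrier I" if x: "x \<in> carrier P" for x
  proof -
    \<comment> \<open>A preimage of \<open>x\<close> under the counit: the function with value
      \<open>x\<close> at the identity and 0 elsewhere.\<close>
    let ?\<phi> = "\<lambda>g\<in>carrier G. if \<one> = g then x else \<zero>\<^bsub>P\<^esub>"
    have \<phi>: "?\<phi> \<in> carrier (ind P)" using x by (auto simp: ind_simps)
    have "b ?\<phi> = (\<Oplus>\<^bsub>P\<^esub>g\<in>carrier G. if \<one> = g then ac P g x else \<zero>\<^bsub>P\<^esub>)"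
      unfolding b_def using P x by (intro P.finsum_cong') auto
    also have "\<dots> = ac P \<one> x"
      using P x by (intro P.finsum_singleton) auto
    finally have "(b \<circ> J') (J ?\<phi>) = x" using P x I(4)[OF \<phi>] by simp
    then show ?thesis using hom_closed[OF I(2) \<phi>] by (metis image_eqI)
  qed
  then have "(b \<circ> J') ` carrier I = carrier P" using hom_closed[OF bJ] by blast
  then obtain s where s: "s \<in> Hom P I" "\<And>x. x \<in> carrier P \<Longrightarrow> (b \<circ> J') (s x) = id x"
    using proj bJ hom_id[of R P] I(1) P unfolding projective_module_def by blast
  note retract = tr_id_retract[OF I(1) P I(5) _ s(1) bJ]
  show "\<exists>h\<in>Lin P P. \<forall>x\<in>carrier P. tr P P h x = x"
  proof (rule bexI, rule ballI)
    show "(b \<circ> J') \<circ> \<epsilon> \<circ> s \<in> Lin P P"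
      by (rule retract(1)) (use I(6) s(2) in auto)
    show "tr P P ((b \<circ> J') \<circ> \<epsilon> \<circ> s) x = x" if "x \<in> carrier P" for x
      by (rule retract(2)) (use I(6) s(2) that in auto)
  qed
next
  assume "\<exists>h\<in>Lin P P. \<forall>x\<in>carrier P. tr P P h x = x"
  then show "projective_module R P" using P projective_if_tr_id by blast
qed

lemma projective_md: "projective_module R P \<Longrightarrow> md P"
  by (simp add: projective_module_def)

text \<open>A map through a projective is a trace because the identity of the projective is one and
  traces form an ideal. Conversely, a trace factors through the unit and counit of the induced
  module.\<close>

lemma stably_zero_iff_tr:
  fixes M N :: "('g \<Rightarrow> 'k, 'u) module"
  assumes M: "md M" and N: "md N"
  shows "stably_zero R M N f \<longleftrightarrow> (\<exists>h\<in>Lin M N. \<forall>x\<in>carrier M. f x = tr M N h x)"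
proof
  assume "stably_zero R M N f"
  then obtain P :: "('g \<Rightarrow> 'k, 'u) module" and a b where P: "projective_module R P"
    and ab: "a \<in> Hom M P" "b \<in> Hom P N" and f: "\<And>x. x \<in> carrier M \<Longrightarrow> f x = b (a x)"
    unfolding stably_zero_def by blast
  obtain h where h: "h \<in> Lin P P" "\<And>x. x \<in> carrier P \<Longrightarrow> tr P P h x = x"
    using P projective_iff_tr_id[OF projective_md[OF P]] by blast
  note P = projective_md[OF P]
  have ha: "h \<circ> a \<in> Lin M P" using M P ab h by (intro Lin_comp[OF hom_Lin]) auto
  have "f x = tr M N (b \<circ> (h \<circ> a)) x" if "x \<in> carrier M" for x
  proof -
    have "f x = b (tr P P h (a x))" using that h ab f by (simp add: hom_closed)
    also have "\<dots> = b (tr M P (h \<circ> a) x)" using that M P h ab by (simp add: tr_comp_hom_right)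
    also have "\<dots> = tr M N (b \<circ> (h \<circ> a)) x" using that M P N ha ab by (intro tr_comp_hom_left)
    finally show ?thesis .
  qed
  moreover have "b \<circ> (h \<circ> a) \<in> Lin M N" using ha ab P N by (intro Lin_comp[OF ha] hom_Lin)
  ultimately show "\<exists>h\<in>Lin M N. \<forall>x\<in>carrier M. f x = tr M N h x" by blast
next
  assume "\<exists>h\<in>Lin M N. \<forall>x\<in>carrier M. f x = tr M N h x"
  then obtain h where h: "h \<in> Lin M N" "\<And>x. x \<in> carrier M \<Longrightarrow> f x = tr M N h x" by blast
  obtain I :: "('g \<Rightarrow> 'k, 'u) module" and J J' \<epsilon> where I: "md I" "J \<in> Hom (ind M) I" "J' \<in> Hom I (ind M)"
    "\<And>\<phi>. \<phi> \<in> carrier (ind M) \<Longrightarrow> J' (J \<phi>) = \<phi>" "\<epsilon> \<in> Lin I I" "\<And>x. x \<in> carrier I \<Longrightarrow> tr I I \<epsilon> x = x"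
    by (rule ex_ind_copy[OF M]) blast
  interpret N: abelian_group N using N by (rule md_abelian_group)
  define a where "a = (\<lambda>x. \<lambda>g\<in>carrier G. ac M (inv g) x)"
  define b where "b = (\<lambda>\<phi>. \<Oplus>\<^bsub>N\<^esub>g\<in>carrier G. ac N g (h (\<phi> g)))"
  have a: "a \<in> Hom M (ind M)" unfolding a_def by (rule ind_unit_hom[OF M])
  have b: "b \<in> Hom (ind M) N" unfolding b_def by (rule ind_counit_hom[OF M N h(1)])
  have "f x = (b \<circ> J') ((J \<circ> a) x)" if x: "x \<in> carrier M" for x
  proof -
    have "b (a x) = tr M N h x"
      unfolding a_def b_def rel_tr_def using M N x h by (intro N.finsum_cong') (auto simp: Lin_closed)
    then show ?thesis using h(2)[OF x] I(4) hom_closed[OF a x] by simp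
  qed
  moreover have "projective_module R I" using projective_if_tr_id[OF I(1,5,6)] .
  moreover have "J \<circ> a \<in> Hom M I" "b \<circ> J' \<in> Hom I N"
    using hom_comp[OF a I(2)] hom_comp[OF I(3) b] by auto
  ultimately show "stably_zero R M N f" unfolding stably_zero_def by blast
qed

end

section \<open>Dimension shifting\<close>

lemma short_exact_sequenceD:
  assumes "short_exact_sequence R A B C f g"
  shows "left_module R A" "left_module R B" "left_module R C" "f \<in> left_module_hom R A B"
    "g \<in> left_module_hom R B C" "inj_on f (carrier A)" "g ` carrier B = carrier C"
    "x \<in> carrier B \<Longrightarrow> g x = \<zero>\<^bsub>C\<^esub> \<longleftrightarrow> x \<in> f ` carrier A"
  using assms by (auto simp: short_exact_sequence_def a_kernel_def')

context finite_group
begin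

section \<open>Factorisation, extension and lifting of maps\<close>

lemma hom_factor_surj:
  assumes P: "md P" and X: "md X" and Q: "md Q" and p: "p \<in> Hom P X" "p ` carrier P = carrier X"
    and F: "F \<in> Hom P Q" and ker: "\<And>x. x \<in> carrier P \<Longrightarrow> p x = \<zero>\<^bsub>X\<^esub> \<Longrightarrow> F x = \<zero>\<^bsub>Q\<^esub>"
  obtains \<theta> where "\<theta> \<in> Hom X Q" "\<And>x. x \<in> carrier P \<Longrightarrow> \<theta> (p x) = F x"
proof -
  define \<theta> where "\<theta> = F \<circ> inv_into (carrier P) p"
  have eq: "F x = F y" if "x \<in> carrier P" "y \<in> carrier P" "p x = p y" for x y
  proof -
    have "p (x \<ominus>\<^bsub>P\<^esub> y) = \<zero>\<^bsub>X\<^esub>"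
      using that P X p by (simp add: hom_diff hom_closed minus_eq_zero_iff)
    then have "F (x \<ominus>\<^bsub>P\<^esub> y) = \<zero>\<^bsub>Q\<^esub>" using that P ker by simp
    then show ?thesis using that P Q F by (simp add: hom_diff hom_closed minus_eq_zero_iff)
  qed
  have \<theta>: "\<theta> (p x) = F x" if "x \<in> carrier P" for x
    unfolding \<theta>_def comp_def
    using that by (intro eq) (auto intro: inv_into_into f_inv_into_f)
  have "\<theta> \<in> Hom X Q"
    unfolding left_module_hom_def
  proof (intro CollectI conjI ballI Pi_I)
    fix x assume "x \<in> carrier X"
    then obtain u where u: "u \<in> carrier P" "x = p u" using p(2) by blast
    then show "\<theta> x \<in> carrier Q" using \<theta> F by (simp add: hom_closed)
    show "\<theta> (x \<oplus>\<^bsub>X\<^esub> y) = \<theta> x \<oplus>\<^bsub>Q\<^esub> \<theta> y" if y: "y \<in> carrier X" for y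
    proof -
      from y p(2) obtain v where v: "v \<in> carrier P" "y = p v" by blast
      have "x \<oplus>\<^bsub>X\<^esub> y = p (u \<oplus>\<^bsub>P\<^esub> v)" using u v p by (simp add: hom_add)
      then show ?thesis using u v \<theta> P F by (simp add: hom_add)
    qed
  next
    fix a x assume a: "a \<in> carrier R" and "x \<in> carrier X"
    then obtain u where u: "u \<in> carrier P" "x = p u" using p(2) by blast
    interpret P: left_module R P by (fact P)
    have "a \<odot>\<^bsub>X\<^esub> x = p (a \<odot>\<^bsub>P\<^esub> u)" using a u p by (simp add: hom_smult)
    then show "\<theta> (a \<odot>\<^bsub>X\<^esub> x) = a \<odot>\<^bsub>Q\<^esub> \<theta> x" using a u \<theta> F by (simp add: hom_smult)
  qed
  then show thesis using that \<theta> by blast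
qed

lemma hom_factor_inj:
  assumes X: "md X" and M: "md M" and Q: "md Q" and i: "i \<in> Hom M Q" "inj_on i (carrier M)"
    and F: "F \<in> Hom X Q" and im: "\<And>x. x \<in> carrier X \<Longrightarrow> F x \<in> i ` carrier M"
  obtains \<xi> where "\<xi> \<in> Hom X M" "\<And>x. x \<in> carrier X \<Longrightarrow> i (\<xi> x) = F x"
proof -
  interpret X: left_module R X by (fact X)
  interpret M: left_module R M by (fact M)
  define \<xi> where "\<xi> = inv_into (carrier M) i \<circ> F"
  have \<xi>: "i (\<xi> x) = F x" "\<xi> x \<in> carrier M" if "x \<in> carrier X" for x
    using im[OF that] by (auto simp: \<xi>_def f_inv_into_f inv_into_into)
  have inj: "u = v" if "u \<in> carrier M" "v \<in> carrier M" "i u = i v" for u v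
    using inj_onD[OF i(2)] that by blast
  have "\<xi> \<in> Hom X M"
    unfolding left_module_hom_def
  proof (intro CollectI conjI ballI Pi_I)
    show "\<xi> (x \<oplus>\<^bsub>X\<^esub> y) = \<xi> x \<oplus>\<^bsub>M\<^esub> \<xi> y" if "x \<in> carrier X" "y \<in> carrier X" for x y
      using that i F X M by (intro inj) (auto simp: \<xi> hom_add)
    show "\<xi> (a \<odot>\<^bsub>X\<^esub> x) = a \<odot>\<^bsub>M\<^esub> \<xi> x" if "a \<in> carrier R" "x \<in> carrier X" for a x
      using that i F by (intro inj) (auto simp: \<xi> hom_smult)
  qed (use \<xi> in auto)
  then show thesis using that \<xi> by blast
qed

end

context finite_group_universe
begin

text \<open>This takes the place of the injectivity of projective modules: a stably zero map is a
  trace, and its linear part extends along any injection. \<open>stably_zero_lift\<close> is the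
  dual statement.\<close>

lemma stably_zero_extend:
  fixes X P N :: "('g \<Rightarrow> 'k, 'u) module"
  assumes X: "md X" and P: "md P" and N: "md N" and F: "stably_zero R X N F"
    and i: "i \<in> Hom X P" "inj_on i (carrier X)"
  obtains F' where "F' \<in> Hom P N" "\<And>x. x \<in> carrier X \<Longrightarrow> F' (i x) = F x"
proof -
  obtain h where h: "h \<in> Lin X N" "\<And>x. x \<in> carrier X \<Longrightarrow> F x = tr X N h x"
    using F stably_zero_iff_tr[OF X N] by blast
  obtain h' where h': "tr P N h' \<in> Hom P N" "\<And>x. x \<in> carrier X \<Longrightarrow> tr P N h' (i x) = tr X N h x"
    by (rule tr_extend[OF X P N h(1) i]) blast
  show thesis by (rule that[OF h'(1)]) (use h(2) h'(2) in simp)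
qed

lemma stably_zero_lift:
  fixes X Q N :: "('g \<Rightarrow> 'k, 'u) module"
  assumes X: "md X" and Q: "md Q" and N: "md N" and F: "stably_zero R X N F"
    and p: "p \<in> Hom Q N" "p ` carrier Q = carrier N"
  obtains F' where "F' \<in> Hom X Q" "\<And>x. x \<in> carrier X \<Longrightarrow> p (F' x) = F x"
proof -
  obtain h where h: "h \<in> Lin X N" "\<And>x. x \<in> carrier X \<Longrightarrow> F x = tr X N h x"
    using F stably_zero_iff_tr[OF X N] by blast
  obtain h' where h': "tr X Q h' \<in> Hom X Q" "\<And>x. x \<in> carrier X \<Longrightarrow> p (tr X Q h' x) = tr X N h x"
    by (rule tr_lift[OF X Q N h(1) p]) blast
  show thesis by (rule that[OF h'(1)]) (use h(2) h'(2) in simp)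
qed

lemma stably_zero_via_projective:
  fixes M P N :: "('g \<Rightarrow> 'k, 'u) module"
  assumes "projective_module R P" "a \<in> Hom M P" "b \<in> Hom P N" "\<And>x. x \<in> carrier M \<Longrightarrow> f x = b (a x)"
  shows "stably_zero R M N f"
  using assms unfolding stably_zero_def by blast

lemma stably_zero_comp:
  fixes M N L M' :: "('g \<Rightarrow> 'k, 'u) module"
  assumes f: "stably_zero R M N f" and g: "g \<in> Hom N L" and h: "h \<in> Hom M' M"
    and eq: "\<And>x. x \<in> carrier M' \<Longrightarrow> F x = g (f (h x))"
  shows "stably_zero R M' L F"
proof -
  obtain P :: "('g \<Rightarrow> 'k, 'u) module" and a b where P: "projective_module R P"
    and ab: "a \<in> Hom M P" "b \<in> Hom P N" and f: "\<And>x. x \<in> carrier M \<Longrightarrow> f x = b (a x)"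
    using f unfolding stably_zero_def by blast
  show ?thesis
    by (rule stably_zero_via_projective[OF P hom_comp[OF h ab(1)] hom_comp[OF ab(2) g]])
      (use eq f h in \<open>simp add: hom_closed\<close>)
qed

text \<open>In the next two lemmas the primed modules and maps are a choice of \<open>\<Omega>\<close> of the unprimed ones.\<close>

context
  fixes X' P X M' Q M N' Q2 N :: "('g \<Rightarrow> 'k, 'u) module"
    and iX pX iM pM iN pN \<phi> \<phi>Q \<phi>' :: "'u \<Rightarrow> 'u"
  assumes X: "short_exact_sequence R X' P X iX pX" "projective_module R P"
    and M: "short_exact_sequence R M' Q M iM pM" "projective_module R Q"
    and N: "short_exact_sequence R N' Q2 N iN pN" "projective_module R Q2"
    and \<phi>: "\<phi> \<in> Hom M N" "\<phi>Q \<in> Hom Q Q2" "\<phi>' \<in> Hom M' N'"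
    and comm_i: "\<And>x. x \<in> carrier M' \<Longrightarrow> \<phi>Q (iM x) = iN (\<phi>' x)"
    and comm_p: "\<And>x. x \<in> carrier Q \<Longrightarrow> pN (\<phi>Q x) = \<phi> (pM x)"
begin

private lemma md_all: "md X'" "md P" "md X" "md M'" "md Q" "md M" "md N'" "md Q2" "md N"
  using X M N by (auto simp: short_exact_sequence_def)

private lemma homs: "iX \<in> Hom X' P" "pX \<in> Hom P X" "iM \<in> Hom M' Q" "pM \<in> Hom Q M" "iN \<in> Hom N' Q2" "pN \<in> Hom Q2 N"
  using X M N by (auto simp: short_exact_sequence_def)

private lemma inj: "inj_on iX (carrier X')" "inj_on iM (carrier M')" "inj_on iN (carrier N')"
  using X M N by (auto simp: short_exact_sequence_def)

private lemma surj: "pX ` carrier P = carrier X" "pM ` carrier Q = carrier M" "pN ` carrier Q2 = carrier N"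
  using X M N by (auto simp: short_exact_sequence_def)

private lemma ker: "x \<in> carrier P \<Longrightarrow> pX x = \<zero>\<^bsub>X\<^esub> \<longleftrightarrow> x \<in> iX ` carrier X'"
  "y \<in> carrier Q \<Longrightarrow> pM y = \<zero>\<^bsub>M\<^esub> \<longleftrightarrow> y \<in> iM ` carrier M'"
  "z \<in> carrier Q2 \<Longrightarrow> pN z = \<zero>\<^bsub>N\<^esub> \<longleftrightarrow> z \<in> iN ` carrier N'"
  using short_exact_sequenceD(8)[OF X(1)] short_exact_sequenceD(8)[OF M(1)] short_exact_sequenceD(8)[OF N(1)]
  by auto

private lemma comp_zero: "x \<in> carrier X' \<Longrightarrow> pX (iX x) = \<zero>\<^bsub>X\<^esub>"
  "y \<in> carrier M' \<Longrightarrow> pM (iM y) = \<zero>\<^bsub>M\<^esub>" "z \<in> carrier N' \<Longrightarrow> pN (iN z) = \<zero>\<^bsub>N\<^esub>"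
  using ker hom_closed[OF homs(1)] hom_closed[OF homs(3)] hom_closed[OF homs(5)] by blast+

text \<open>The map \<open>f\<close> extends to the projectives and induces \<open>f0\<close> on the
  quotients. A lift \<open>\<theta>\<close> of the stably zero map \<open>\<phi> \<circ> f0\<close>
  to \<open>Q2\<close> corrects \<open>\<phi>Q \<circ> fP\<close> to a map with values in the
  kernel, and the resulting \<open>\<xi>\<close> extends \<open>\<phi>' \<circ> f\<close> to
  \<open>P\<close>.\<close>

lemma shift_down:
  assumes zero: "\<And>f. f \<in> Hom X M \<Longrightarrow> stably_zero R X N (\<phi> \<circ> f)" and f: "f \<in> Hom X' M'"
  shows "stably_zero R X' N' (\<phi>' \<circ> f)"
proof -
  note [simp] = md_all
  have "stably_zero R X' Q (iM \<circ> f)"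
    by (rule stably_zero_via_projective[OF M(2) hom_comp[OF f homs(3)] hom_id]) simp
  then obtain fP where fP: "fP \<in> Hom P Q" "\<And>x. x \<in> carrier X' \<Longrightarrow> fP (iX x) = (iM \<circ> f) x"
    by (rule stably_zero_extend[OF md_all(1,2,5) _ homs(1) inj(1)]) (assumption | rule that)+
  have pfP: "pM \<circ> fP \<in> Hom P M" by (rule hom_comp[OF fP(1) homs(4)])
  have "(pM \<circ> fP) x = \<zero>\<^bsub>M\<^esub>" if "x \<in> carrier P" "pX x = \<zero>\<^bsub>X\<^esub>" for x
    using that fP(2) by (auto simp: ker comp_zero hom_closed[OF f])
  then obtain f0 where f0: "f0 \<in> Hom X M" "\<And>x. x \<in> carrier P \<Longrightarrow> f0 (pX x) = (pM \<circ> fP) x"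
    by (rule hom_factor_surj[OF md_all(2,3,6) homs(2) surj(1) pfP]) (assumption | rule that)+
  obtain \<theta> where \<theta>: "\<theta> \<in> Hom X Q2" "\<And>x. x \<in> carrier X \<Longrightarrow> pN (\<theta> x) = (\<phi> \<circ> f0) x"
    by (rule stably_zero_lift[OF md_all(3,8,9) zero[OF f0(1)] homs(6) surj(3)]) (assumption | rule that)+
  define F where "F = (\<lambda>x. (\<phi>Q \<circ> fP) x \<ominus>\<^bsub>Q2\<^esub> (\<theta> \<circ> pX) x)"
  have F: "F \<in> Hom P Q2"
    unfolding F_def by (rule hom_minus[OF _ _ hom_comp[OF fP(1) \<phi>(2)] hom_comp[OF homs(2) \<theta>(1)]]) simp_all
  have "F x \<in> iN ` carrier N'" if x: "x \<in> carrier P" for x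
  proof -
    have c: "fP x \<in> carrier Q" "\<phi>Q (fP x) \<in> carrier Q2" "\<theta> (pX x) \<in> carrier Q2" "pX x \<in> carrier X"
      using x hom_closed[OF fP(1)] hom_closed[OF \<phi>(2)] hom_closed[OF \<theta>(1)] hom_closed[OF homs(2)] by auto
    have "pN (F x) = pN (\<phi>Q (fP x)) \<ominus>\<^bsub>N\<^esub> pN (\<theta> (pX x))"
      unfolding F_def using c by (simp add: hom_diff[OF _ _ homs(6)])
    also have "\<dots> = \<phi> (pM (fP x)) \<ominus>\<^bsub>N\<^esub> \<phi> (pM (fP x))"
      using c x \<theta>(2) f0(2) by (simp add: comm_p)
    also have "\<dots> = \<zero>\<^bsub>N\<^esub>"
      using c hom_closed[OF \<phi>(1) hom_closed[OF homs(4)]] by (simp add: minus_eq_zero_iff)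
    finally show ?thesis using ker(3) hom_closed[OF F x] by blast
  qed
  then obtain \<xi> where \<xi>: "\<xi> \<in> Hom P N'" "\<And>x. x \<in> carrier P \<Longrightarrow> iN (\<xi> x) = F x"
    by (rule hom_factor_inj[OF md_all(2,7,8) homs(5) inj(3) F]) (assumption | rule that)+
  have "(\<phi>' \<circ> f) x = \<xi> (iX x)" if x: "x \<in> carrier X'" for x
  proof -
    have c: "iX x \<in> carrier P" "f x \<in> carrier M'" using x homs f by (auto simp: hom_closed)
    have c': "\<phi>' (f x) \<in> carrier N'" "iN (\<phi>' (f x)) \<in> carrier Q2"
      using c hom_closed[OF \<phi>(3)] hom_closed[OF homs(5)] by auto
    have "iN (\<xi> (iX x)) = \<phi>Q (iM (f x)) \<ominus>\<^bsub>Q2\<^esub> \<theta> \<zero>\<^bsub>X\<^esub>"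
      using c x \<xi>(2) fP(2) by (simp add: F_def comp_zero)
    also have "\<dots> = iN (\<phi>' (f x)) \<ominus>\<^bsub>Q2\<^esub> \<zero>\<^bsub>Q2\<^esub>"
      using c by (simp add: comm_i hom_zero[OF _ _ \<theta>(1)])
    also have "\<dots> = iN (\<phi>' (f x))"
      using c' by (simp add: a_minus_def uminus_eq_sc)
        (metis abelian_monoid.r_zero abelian_group.axioms(1) md_abelian_group md_all(8))
    finally show ?thesis
      using inj_onD[OF inj(3)] c' hom_closed[OF \<xi>(1) c(1)] by force
  qed
  then show ?thesis by (rule stably_zero_via_projective[OF X(2) homs(1) \<xi>(1)])
qed

text \<open>The dual diagram chase: \<open>f\<close> lifts to the projectives and restricts to
  \<open>f'\<close> on the kernels. Subtracting an extension \<open>\<xi>\<close> of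
  \<open>\<phi>' \<circ> f'\<close> makes \<open>\<phi>Q \<circ> fP\<close> vanish on the kernel, so
  it descends to a map \<open>\<theta>\<close> that factors \<open>\<phi> \<circ> f\<close> through
  \<open>Q2\<close>.\<close>

lemma shift_up:
  assumes zero: "\<And>f. f \<in> Hom X' M' \<Longrightarrow> stably_zero R X' N' (\<phi>' \<circ> f)" and f: "f \<in> Hom X M"
  shows "stably_zero R X N (\<phi> \<circ> f)"
proof -
  note [simp] = md_all
  have "stably_zero R P M (f \<circ> pX)"
    by (rule stably_zero_via_projective[OF X(2) hom_id hom_comp[OF homs(2) f]]) simp
  then obtain fP where fP: "fP \<in> Hom P Q" "\<And>x. x \<in> carrier P \<Longrightarrow> pM (fP x) = (f \<circ> pX) x"
    by (rule stably_zero_lift[OF md_all(2,5,6) _ homs(4) surj(2)]) (assumption | rule that)+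
  have fPi: "fP \<circ> iX \<in> Hom X' Q" by (rule hom_comp[OF homs(1) fP(1)])
  have "(fP \<circ> iX) x \<in> iM ` carrier M'" if "x \<in> carrier X'" for x
    using that fP hom_closed[OF homs(1)] hom_closed[OF fP(1)]
    by (simp add: ker(2)[symmetric] comp_zero hom_zero[OF _ _ f])
  then obtain f' where f': "f' \<in> Hom X' M'" "\<And>x. x \<in> carrier X' \<Longrightarrow> iM (f' x) = (fP \<circ> iX) x"
    by (rule hom_factor_inj[OF md_all(1,4,5) homs(3) inj(2) fPi]) (assumption | rule that)+
  obtain \<xi> where \<xi>: "\<xi> \<in> Hom P N'" "\<And>x. x \<in> carrier X' \<Longrightarrow> \<xi> (iX x) = (\<phi>' \<circ> f') x"
    by (rule stably_zero_extend[OF md_all(1,2,7) zero[OF f'(1)] homs(1) inj(1)]) (assumption | rule that)+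
  define F where "F = (\<lambda>x. (\<phi>Q \<circ> fP) x \<ominus>\<^bsub>Q2\<^esub> (iN \<circ> \<xi>) x)"
  have F: "F \<in> Hom P Q2"
    unfolding F_def by (rule hom_minus[OF _ _ hom_comp[OF fP(1) \<phi>(2)] hom_comp[OF \<xi>(1) homs(5)]]) simp_all
  have "F x = \<zero>\<^bsub>Q2\<^esub>" if x: "x \<in> carrier P" "pX x = \<zero>\<^bsub>X\<^esub>" for x
  proof -
    from x obtain y where y: "y \<in> carrier X'" "x = iX y" using ker by blast
    have "\<phi>Q (fP x) = iN (\<xi> x)"
      using y f'(2)[OF y(1)] \<xi>(2)[OF y(1)] comm_i hom_closed[OF f'(1)] by force
    then show ?thesis
      unfolding F_def using x hom_closed[OF homs(5) hom_closed[OF \<xi>(1)]] by (simp add: minus_eq_zero_iff)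
  qed
  then obtain \<theta> where \<theta>: "\<theta> \<in> Hom X Q2" "\<And>x. x \<in> carrier P \<Longrightarrow> \<theta> (pX x) = F x"
    by (rule hom_factor_surj[OF md_all(2,3,8) homs(2) surj(1) F]) (assumption | rule that)+
  have "(\<phi> \<circ> f) x = pN (\<theta> x)" if x: "x \<in> carrier X" for x
  proof -
    from x surj(1) obtain u where u: "u \<in> carrier P" "x = pX u" by blast
    have c: "fP u \<in> carrier Q" "\<phi>Q (fP u) \<in> carrier Q2" "\<xi> u \<in> carrier N'" "iN (\<xi> u) \<in> carrier Q2"
      "\<phi> (f x) \<in> carrier N"
      using u hom_closed[OF fP(1)] hom_closed[OF \<phi>(2)] hom_closed[OF \<xi>(1)] hom_closed[OF homs(5)]
        x hom_closed[OF \<phi>(1) hom_closed[OF f]] by auto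
    have "pN (\<theta> x) = pN (\<phi>Q (fP u)) \<ominus>\<^bsub>N\<^esub> pN (iN (\<xi> u))"
      using u c \<theta>(2) by (simp add: F_def hom_diff[OF _ _ homs(6)])
    also have "\<dots> = \<phi> (f x) \<ominus>\<^bsub>N\<^esub> \<zero>\<^bsub>N\<^esub>"
      using u c fP(2) by (simp add: comm_p comp_zero)
    also have "\<dots> = \<phi> (f x)"
      using c by (simp add: a_minus_def uminus_eq_sc)
        (metis abelian_monoid.r_zero abelian_group.axioms(1) md_abelian_group md_all(9))
    finally show ?thesis by simp
  qed
  then show ?thesis by (rule stably_zero_via_projective[OF N(2) \<theta>(1) homs(6)])
qed

end

end

section \<open>Groups of affine transformations of the field with four elements\<close>

context finite_group
begin

lemma finsum_sc_left:
  assumes N: "md N" and "finite S" "x \<in> carrier N"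
  shows "(\<Oplus>\<^bsub>N\<^esub>i\<in>S. sc N (c i) x) = sc N (sum c S) x"
proof -
  interpret N: abelian_group N using N by (rule md_abelian_group)
  show ?thesis
    using assms(2,3) N
    by (induction S rule: finite_induct) (auto simp: sc_add_left Pi_def)
qed

lemma subspace_finsum:
  assumes M: "md M" and S: "subspace M S" and F: "\<And>i. i \<in> A \<Longrightarrow> F i \<in> S"
  shows "(\<Oplus>\<^bsub>M\<^esub>i\<in>A. F i) \<in> S"
proof -
  interpret M: abelian_group M using M by (rule md_abelian_group)
  have S': "S \<subseteq> carrier M" "\<zero>\<^bsub>M\<^esub> \<in> S" "\<And>x y. x \<in> S \<Longrightarrow> y \<in> S \<Longrightarrow> x \<oplus>\<^bsub>M\<^esub> y \<in> S"
    using S by (auto simp: subspace_def)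
  show ?thesis
  proof (cases "finite A")
    case True
    then show ?thesis using F
    proof (induction A rule: finite_induct)
      case (insert x A)
      then have "F x \<in> carrier M" "F \<in> A \<rightarrow> carrier M" using S' by auto
      then show ?case using insert S' by simp
    qed (simp add: S')
  qed (simp add: S')
qed

lemma submodule_md:
  assumes M: "md M" and S: "subspace M S" and ac: "\<And>g x. g \<in> carrier G \<Longrightarrow> x \<in> S \<Longrightarrow> ac M g x \<in> S"
  shows "md (M\<lparr>carrier := S\<rparr>)"
proof -
  interpret M: left_module R M by (fact M)
  have S': "S \<subseteq> carrier M" "\<zero>\<^bsub>M\<^esub> \<in> S" "\<And>x y. x \<in> S \<Longrightarrow> y \<in> S \<Longrightarrow> x \<oplus>\<^bsub>M\<^esub> y \<in> S"
    "\<And>c x. x \<in> S \<Longrightarrow> sc M c x \<in> S"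
    using S by (auto simp: subspace_def)
  have c: "x \<in> carrier M" if "x \<in> S" for x using that S' by auto
  have smult: "a \<odot>\<^bsub>M\<^esub> x \<in> S" if "a \<in> carrier R" "x \<in> S" for a x
    unfolding smult_eq_finsum[OF M that(1) c[OF that(2)]]
    by (rule subspace_finsum[OF M S]) (use that ac S' in auto)
  show ?thesis
  proof (rule left_moduleI[OF R_ring])
    show "abelian_group (M\<lparr>carrier := S\<rparr>)"
    proof (rule abelian_groupI)
      fix x assume "x \<in> carrier (M\<lparr>carrier := S\<rparr>)"
      then show "\<exists>y\<in>carrier (M\<lparr>carrier := S\<rparr>). y \<oplus>\<^bsub>M\<lparr>carrier := S\<rparr>\<^esub> x = \<zero>\<^bsub>M\<lparr>carrier := S\<rparr>\<^esub>"
        using S' M c uminus_eq_sc[OF M, of x] M.M.l_neg[of x]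
        by (intro bexI[of _ "sc M (-1) x"]) auto
    qed (use S' c in \<open>auto simp: M.M.a_ac\<close>)
  qed (use smult c in \<open>auto simp: M.smult_l_distr M.smult_r_distr M.smult_assoc1\<close>)
qed

end

text \<open>The two equations say that 0, 1, \<omega> and \<omega> + 1 form a copy of the field with
  four elements inside k.\<close>

locale F4 =
  fixes \<omega> :: "'k::field"
  assumes two: "(1 :: 'k) + 1 = 0" and omega: "\<omega> ^ 2 = \<omega> + 1"
begin

lemma two_eq_zero [simp]: "(2 :: 'k) = 0"
  using two by simp

lemma add_self [simp]: "x + x = (0::'k)" "x + (x + y) = y" for x y
  by (simp_all flip: add.assoc mult_2)

lemma omega_mult [simp]: "\<omega> * \<omega> = \<omega> + 1" "\<omega> * (\<omega> * x) = \<omega> * x + x"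
  using omega by (simp_all add: power2_eq_square flip: mult.assoc) (simp add: distrib_right)

lemma omega_neq [simp]: "\<omega> \<noteq> 0" "\<omega> \<noteq> 1" "\<omega> + 1 \<noteq> 0" "\<omega> + 1 \<noteq> 1" "\<omega> + 1 \<noteq> \<omega>"
proof -
  show 0: "\<omega> \<noteq> 0" using omega by auto
  show 1: "\<omega> \<noteq> 1" using omega by auto
  show "\<omega> + 1 \<noteq> 0"
  proof
    assume "\<omega> + 1 = 0"
    then have "(\<omega> + 1) + 1 = 0 + 1" by (rule arg_cong)
    then show False using 1 by (simp add: add.assoc)
  qed
qed (use omega in \<open>auto\<close>)

end

text \<open>The alternating group on four letters is the group of maps \<open>x \<mapsto> \<chi> x + \<beta>\<close> of the field
  \<open>\<bbbF>\<^sub>4 = {0, 1, \<omega>, \<omega>\<^sup>2}\<close> with \<open>\<chi> \<in> {1, \<omega>, \<omega>\<^sup>2}\<close>, and its Sylow subgroup consists of the translations.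
  Both are instances of the locale, with different ranges \<open>A\<close> of \<open>\<chi>\<close>.\<close>

locale affine_group = finite_group_universe G K U + F4 \<omega>
  for G :: "'g monoid" (structure) and K :: "'k::field itself" and U :: "'u itself" and \<omega> :: 'k +
  fixes \<chi> \<beta> :: "'g \<Rightarrow> 'k" and A :: "'k set"
  assumes chi_mult: "\<lbrakk>g \<in> carrier G; h \<in> carrier G\<rbrakk> \<Longrightarrow> \<chi> (g \<otimes> h) = \<chi> g * \<chi> h"
    and beta_mult: "\<lbrakk>g \<in> carrier G; h \<in> carrier G\<rbrakk> \<Longrightarrow> \<beta> (g \<otimes> h) = \<chi> g * \<beta> h + \<beta> g"
    and A: "A = {1} \<or> A = {1, \<omega>, \<omega> ^ 2}"
    and bij: "bij_betw (\<lambda>g. (\<chi> g, \<beta> g)) (carrier G) (A \<times> {0, 1, \<omega>, \<omega> ^ 2})"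
begin

lemma chi_A: "g \<in> carrier G \<Longrightarrow> \<chi> g \<in> A" and beta_F: "g \<in> carrier G \<Longrightarrow> \<beta> g \<in> {0, 1, \<omega>, \<omega> ^ 2}"
  using bij by (auto simp: bij_betw_def)

lemma chi_cases: "g \<in> carrier G \<Longrightarrow> \<chi> g = 1 \<or> \<chi> g = \<omega> \<or> \<chi> g = \<omega> + 1"
  using chi_A[of g] A omega by auto

lemma chi_cube [simp]: "g \<in> carrier G \<Longrightarrow> \<chi> g * (\<chi> g * \<chi> g) = 1" "g \<in> carrier G \<Longrightarrow> \<chi> g ^ 3 = 1"
  "g \<in> carrier G \<Longrightarrow> \<chi> g * (\<chi> g * (\<chi> g * x)) = x"
proof -
  assume g: "g \<in> carrier G"
  show 1: "\<chi> g * (\<chi> g * \<chi> g) = 1"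
    using chi_cases[OF g] by (elim disjE) (simp_all add: algebra_simps)
  then show "\<chi> g ^ 3 = 1" by (simp add: power3_eq_cube mult.assoc)
  show "\<chi> g * (\<chi> g * (\<chi> g * x)) = x" using 1 by (metis mult.assoc mult_1)
qed

lemma chi_nonzero [simp]: "g \<in> carrier G \<Longrightarrow> \<chi> g \<noteq> 0"
  using chi_cases[of g] by auto

lemma chi_one [simp]: "\<chi> \<one> = 1" and beta_one [simp]: "\<beta> \<one> = 0"
  using chi_mult[of \<one> \<one>] beta_mult[of \<one> \<one>] by auto

lemma chi_inv: "g \<in> carrier G \<Longrightarrow> \<chi> (inv g) = \<chi> g ^ 2"
  and beta_inv: "g \<in> carrier G \<Longrightarrow> \<beta> (inv g) = \<chi> g ^ 2 * \<beta> g"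
proof -
  assume g: "g \<in> carrier G"
  have "\<chi> g * \<chi> (inv g) = 1" using chi_mult[OF g inv_closed[OF g]] g by simp
  then have "\<chi> g ^ 2 * (\<chi> g * \<chi> (inv g)) = \<chi> g ^ 2" by simp
  then show "\<chi> (inv g) = \<chi> g ^ 2" using g by (simp add: power2_eq_square mult.assoc)
  have "\<chi> g * \<beta> (inv g) + \<beta> g = 0" using beta_mult[OF g inv_closed[OF g]] g by simp
  then have "\<chi> g * \<beta> (inv g) = \<beta> g" by (metis add.assoc add.right_neutral add_self(1))
  then have "\<chi> g ^ 2 * (\<chi> g * \<beta> (inv g)) = \<chi> g ^ 2 * \<beta> g" by simp
  then show "\<beta> (inv g) = \<chi> g ^ 2 * \<beta> g" using g by (simp add: power2_eq_square mult.assoc)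
qed

lemma group_eqI:
  "\<lbrakk>g \<in> carrier G; h \<in> carrier G; \<chi> g = \<chi> h; \<beta> g = \<beta> h\<rbrakk> \<Longrightarrow> g = h"
  using bij by (auto simp: bij_betw_def inj_on_def)

lemma ex_element:
  assumes "a \<in> A" "b \<in> {0, 1, \<omega>, \<omega> ^ 2}"
  obtains g where "g \<in> carrier G" "\<chi> g = a" "\<beta> g = b"
proof -
  have "(a, b) \<in> (\<lambda>g. (\<chi> g, \<beta> g)) ` carrier G"
    using assms bij by (auto simp: bij_betw_def)
  then show thesis using that by auto
qed

definition V where "V = {g \<in> carrier G. \<chi> g = 1}"
text \<open>The stabiliser of the point 0: a complement of \<open>V\<close>, of order three for the
  full affine group and trivial for the group of translations.\<close>

definition C where "C = {g \<in> carrier G. \<beta> g = 0}"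

lemma V_carrier [simp]: "v \<in> V \<Longrightarrow> v \<in> carrier G" and V_chi [simp]: "v \<in> V \<Longrightarrow> \<chi> v = 1"
  and C_carrier [simp]: "c \<in> C \<Longrightarrow> c \<in> carrier G" and C_beta [simp]: "c \<in> C \<Longrightarrow> \<beta> c = 0"
  by (auto simp: V_def C_def)

lemma V_one [simp]: "\<one> \<in> V" and V_mult [simp]: "u \<in> V \<Longrightarrow> v \<in> V \<Longrightarrow> u \<otimes> v \<in> V"
  and V_inv [simp]: "v \<in> V \<Longrightarrow> inv v \<in> V"
  and V_conj: "g \<in> carrier G \<Longrightarrow> v \<in> V \<Longrightarrow> g \<otimes> v \<otimes> inv g \<in> V"
  and V_conj': "g \<in> carrier G \<Longrightarrow> v \<in> V \<Longrightarrow> inv g \<otimes> v \<otimes> g \<in> V"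
  by (auto simp: V_def chi_mult chi_inv power2_eq_square mult.assoc simp del: V_carrier V_chi)

lemma C_mult [simp]: "c \<in> C \<Longrightarrow> d \<in> C \<Longrightarrow> c \<otimes> d \<in> C" and C_inv [simp]: "c \<in> C \<Longrightarrow> inv c \<in> C"
  and C_one [simp]: "\<one> \<in> C"
  by (auto simp: C_def beta_mult beta_inv simp del: C_carrier C_beta)

lemma finite_V [simp]: "finite V" and finite_C [simp]: "finite C"
  by (rule finite_subset[OF _ finite_carrier]; use V_carrier C_carrier in blast)+

lemma one_in_A: "1 \<in> A"
  using A by auto

lemma bij_V: "bij_betw \<beta> V {0, 1, \<omega>, \<omega> ^ 2}"
  unfolding bij_betw_def
proof
  show "inj_on \<beta> V" by (auto simp: inj_on_def intro: group_eqI)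
  show "\<beta> ` V = {0, 1, \<omega>, \<omega> ^ 2}"
  proof (rule equalityI)
    show "\<beta> ` V \<subseteq> {0, 1, \<omega>, \<omega> ^ 2}" using beta_F V_carrier by blast
    show "{0, 1, \<omega>, \<omega> ^ 2} \<subseteq> \<beta> ` V"
    proof
      fix b assume "b \<in> {0, 1, \<omega>, \<omega> ^ 2}"
      then obtain g where "g \<in> carrier G" "\<chi> g = 1" "\<beta> g = b"
        by (rule ex_element[OF one_in_A])
      then show "b \<in> \<beta> ` V" by (auto simp: V_def simp del: V_carrier V_chi)
    qed
  qed
qed

lemma bij_C: "bij_betw \<chi> C A"
  unfolding bij_betw_def
proof
  show "inj_on \<chi> C" by (auto simp: inj_on_def intro: group_eqI)
  show "\<chi> ` C = A"
  proof (rule equalityI)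
    show "\<chi> ` C \<subseteq> A" using chi_A C_carrier by blast
    show "A \<subseteq> \<chi> ` C"
    proof
      fix a assume "a \<in> A"
      then obtain g where "g \<in> carrier G" "\<chi> g = a" "\<beta> g = 0"
        by (rule ex_element[of a 0]) auto
      then show "a \<in> \<chi> ` C" by (auto simp: C_def simp del: C_carrier C_beta)
    qed
  qed
qed

lemma card_V: "card V = 4"
  using bij_betw_same_card[OF bij_V] omega by simp

text \<open>The index of \<open>V\<close> is 1 or 3, hence not merely invertible but equal to 1 in
  characteristic two. Averages over \<open>C\<close> therefore carry no normalising factor.\<close>

lemma of_nat_card_C: "of_nat (card C) = (1::'k)"
proof -
  have "card A = Suc 0 \<or> card A = Suc (Suc (Suc 0))" using A omega by auto
  then show ?thesis using bij_betw_same_card[OF bij_C] by auto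
qed

lemma coset_decomposition: "carrier G = (\<Union>c\<in>C. (\<lambda>v. c \<otimes> v) ` V)"
proof (intro equalityI subsetI)
  fix g assume g: "g \<in> carrier G"
  have "\<chi> g \<in> \<chi> ` C" using bij_C chi_A[OF g] by (simp add: bij_betw_def)
  then obtain c where c: "c \<in> C" "\<chi> c = \<chi> g" by (metis imageE)
  have "\<chi> (inv c \<otimes> g) = 1" using c g by (simp add: chi_mult chi_inv power2_eq_square mult.assoc)
  then have "inv c \<otimes> g \<in> V" using c g unfolding V_def by simp
  moreover have "g = c \<otimes> (inv c \<otimes> g)" using c g by (simp add: m_assoc[symmetric])
  ultimately show "g \<in> (\<Union>c\<in>C. (\<lambda>v. c \<otimes> v) ` V)" using c by blast
qed auto

lemma coset_disjoint: "pairwise (\<lambda>c d. disjnt ((\<lambda>v. c \<otimes> v) ` V) ((\<lambda>v. d \<otimes> v) ` V)) C"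
proof (rule pairwiseI)
  fix c d assume "c \<in> C" "d \<in> C" "c \<noteq> d"
  then have "\<chi> c \<noteq> \<chi> d" using bij_C by (auto simp: bij_betw_def inj_on_def)
  moreover have "\<chi> (c \<otimes> v) = \<chi> c" "\<chi> (d \<otimes> v) = \<chi> d" if "v \<in> V" for v
    using that \<open>c \<in> C\<close> \<open>d \<in> C\<close> by (simp_all add: chi_mult)
  ultimately show "disjnt ((\<lambda>v. c \<otimes> v) ` V) ((\<lambda>v. d \<otimes> v) ` V)"
    by (auto simp: disjnt_iff) metis
qed

lemma finsum_cosets:
  assumes N: "abelian_group N" and F: "\<And>g. g \<in> carrier G \<Longrightarrow> F g \<in> carrier N"
  shows "(\<Oplus>\<^bsub>N\<^esub>g\<in>carrier G. F g) = (\<Oplus>\<^bsub>N\<^esub>c\<in>C. \<Oplus>\<^bsub>N\<^esub>v\<in>V. F (c \<otimes> v))"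
proof -
  interpret N: abelian_group N by (fact N)
  have "(\<Oplus>\<^bsub>N\<^esub>g\<in>carrier G. F g) = (\<Oplus>\<^bsub>N\<^esub>c\<in>C. \<Oplus>\<^bsub>N\<^esub>g\<in>(\<lambda>v. c \<otimes> v) ` V. F g)"
    by (subst coset_decomposition, rule N.finsum_UN_disjoint) (use coset_disjoint F in auto)
  also have "\<dots> = (\<Oplus>\<^bsub>N\<^esub>c\<in>C. \<Oplus>\<^bsub>N\<^esub>v\<in>V. F (c \<otimes> v))"
  proof (rule N.finsum_cong'[OF refl])
    fix c assume c: "c \<in> C"
    show "(\<Oplus>\<^bsub>N\<^esub>g\<in>(\<lambda>v. c \<otimes> v) ` V. F g) = (\<Oplus>\<^bsub>N\<^esub>v\<in>V. F (c \<otimes> v))"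
      by (rule N.finsum_reindex) (use c F in \<open>auto simp: inj_on_def\<close>)
  qed (use F in \<open>auto intro!: N.finsum_closed\<close>)
  finally show ?thesis .
qed

lemma double [simp]: "x \<oplus>\<^bsub>M\<^esub> x = \<zero>\<^bsub>M\<^esub>"
  if "md M" "x \<in> carrier M" for M :: "('g \<Rightarrow> 'k, 'a) module"
  using sc_add_left[OF that, of 1 1] that by simp

lemma
  fixes M :: "('g \<Rightarrow> 'k, 'a) module"
  assumes M: "md M" and xy: "x \<in> carrier M" "y \<in> carrier M"
  shows add_eq_zero: "x \<oplus>\<^bsub>M\<^esub> y = \<zero>\<^bsub>M\<^esub> \<Longrightarrow> x = y"
    and add_cancel [simp]: "(x \<oplus>\<^bsub>M\<^esub> y) \<oplus>\<^bsub>M\<^esub> y = x"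
proof -
  interpret M: abelian_group M using M by (simp add: md_abelian_group)
  show "x \<oplus>\<^bsub>M\<^esub> y = \<zero>\<^bsub>M\<^esub> \<Longrightarrow> x = y" using M xy double[of M y] by (metis M.add.right_cancel)
  show "(x \<oplus>\<^bsub>M\<^esub> y) \<oplus>\<^bsub>M\<^esub> y = x" using M xy by (simp add: M.a_assoc)
qed

subsection \<open>The relative trace from the subgroup of translations\<close>

abbreviation trV where "trV \<equiv> rel_tr V"

definition Nm :: "('g \<Rightarrow> 'k, 'a) module \<Rightarrow> 'a \<Rightarrow> 'a" where
  "Nm M x = (\<Oplus>\<^bsub>M\<^esub>v\<in>V. ac M v x)"

definition invV :: "('g \<Rightarrow> 'k, 'a) module \<Rightarrow> 'a set" where
  "invV M = {x \<in> carrier M. \<forall>v\<in>V. ac M v x = x}"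

lemma V_subset: "V \<subseteq> carrier G"
  by auto

lemma V_translate: "u \<in> V \<Longrightarrow> (\<lambda>v. u \<otimes> v) ` V = V"
  by (rule endo_inj_surj) (auto simp: inj_on_def)

lemmas trV_Lin = rel_tr_Lin [OF V_subset]
lemmas trV_comp_hom_left = rel_tr_comp_hom_left [OF V_subset]
lemmas trV_plus = rel_tr_plus [OF V_subset]

lemma ac_trV:
  "md M \<Longrightarrow> md N \<Longrightarrow> h \<in> Lin M N \<Longrightarrow> u \<in> V \<Longrightarrow> x \<in> carrier M \<Longrightarrow>
    trV M N h (ac M u x) = ac N u (trV M N h x)"
  by (rule ac_rel_tr[OF V_subset]) (auto simp: V_translate)

lemma Nm_Lin: "md M \<Longrightarrow> Nm M \<in> Lin M M"
  unfolding Nm_def [abs_def] by (rule Lin_finsum) (auto intro: ac_Lin)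

text \<open>Conjugation by \<open>g\<close> permutes the normal subgroup \<open>V\<close>, so the
  norm element of \<open>V\<close> is central in the group algebra.\<close>

lemma ac_Nm: 
  assumes M: "md M" and g: "g \<in> carrier G" and x: "x \<in> carrier M"
  shows "ac M g (Nm M x) = Nm M (ac M g x)"
proof -
  interpret M: abelian_group M using M by (rule md_abelian_group)
  have inj: "inj_on (\<lambda>v. g \<otimes> v \<otimes> inv g) V"
    using g by (auto simp: inj_on_def)
  have img: "(\<lambda>v. g \<otimes> v \<otimes> inv g) ` V = V"
    by (rule endo_inj_surj) (use g inj V_conj in auto)
  have "ac M g (Nm M x) = (\<Oplus>\<^bsub>M\<^esub>v\<in>V. ac M g (ac M v x))"
    unfolding Nm_def by (rule finsum_hom) (use M g x in \<open>auto simp: md_abelian_group ac_add\<close>)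
  also have "\<dots> = (\<Oplus>\<^bsub>M\<^esub>v\<in>V. ac M (g \<otimes> v \<otimes> inv g) (ac M g x))"
    using M g x by (intro M.finsum_cong') (auto simp: ac_ac m_assoc)
  also have "\<dots> = (\<Oplus>\<^bsub>M\<^esub>v\<in>V. ac M v (ac M g x))"
    using M.finsum_reindex[OF _ inj, of "\<lambda>v. ac M v (ac M g x)"] img M g x by auto
  finally show ?thesis by (simp add: Nm_def)
qed

lemma Nm_hom:
  assumes M: "md M" and N: "md N" and f: "f \<in> Hom M N" and x: "x \<in> carrier M"
  shows "f (Nm M x) = Nm N (f x)"
proof -
  interpret N: abelian_group N using N by (simp add: md_abelian_group)
  have "f (Nm M x) = (\<Oplus>\<^bsub>N\<^esub>v\<in>V. f (ac M v x))"
    unfolding Nm_def by (rule finsum_hom) (use assms in \<open>auto simp: md_abelian_group hom_closed hom_add\<close>)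
  also have "\<dots> = Nm N (f x)"
    unfolding Nm_def using assms by (intro N.finsum_cong') (auto simp: hom_closed hom_ac)
  finally show ?thesis .
qed

text \<open>Transitivity of the trace, with the elements of \<open>C\<close> as representatives of
  the cosets of \<open>V\<close>.\<close>

lemma tr_eq_trV:
  assumes M: "md M" and N: "md N" and h: "h \<in> Lin M N" and x: "x \<in> carrier M"
  shows "tr M N h x = (\<Oplus>\<^bsub>N\<^esub>c\<in>C. ac N c (trV M N h (ac M (inv c) x)))"
proof -
  interpret N: abelian_group N using N by (simp add: md_abelian_group)
  have "tr M N h x = (\<Oplus>\<^bsub>N\<^esub>c\<in>C. \<Oplus>\<^bsub>N\<^esub>v\<in>V. ac N (c \<otimes> v) (h (ac M (inv (c \<otimes> v)) x)))"
    unfolding rel_tr_def by (rule finsum_cosets) (use assms in \<open>auto simp: md_abelian_group Lin_closed\<close>)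
  also have "\<dots> = (\<Oplus>\<^bsub>N\<^esub>c\<in>C. ac N c (trV M N h (ac M (inv c) x)))"
  proof (rule N.finsum_cong'[OF refl])
    fix c assume c: "c \<in> C"
    have "ac N c (trV M N h (ac M (inv c) x)) = (\<Oplus>\<^bsub>N\<^esub>v\<in>V. ac N c (ac N v (h (ac M (inv v) (ac M (inv c) x)))))"
      unfolding rel_tr_def by (rule finsum_hom) (use assms c in \<open>auto simp: md_abelian_group ac_add Lin_closed\<close>)
    also have "\<dots> = (\<Oplus>\<^bsub>N\<^esub>v\<in>V. ac N (c \<otimes> v) (h (ac M (inv (c \<otimes> v)) x)))"
      using assms c by (intro N.finsum_cong') (auto simp: ac_ac Lin_closed inv_mult_group)
    finally show "(\<Oplus>\<^bsub>N\<^esub>v\<in>V. ac N (c \<otimes> v) (h (ac M (inv (c \<otimes> v)) x))) =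
        ac N c (trV M N h (ac M (inv c) x))" by simp
  qed (use assms in \<open>auto simp: Lin_closed[OF trV_Lin]\<close>)
  finally show ?thesis .
qed

text \<open>If \<open>h\<close> does not see how translations move \<open>x\<close>, then each
  summand of the trace is \<open>v\<close> applied to \<open>h x\<close>. The hypothesis holds for
  invariant \<open>x\<close>, and also for \<open>x\<close> moved only within a subspace killed by
  \<open>h\<close>.\<close>

lemma trV_eq_Nm:
  assumes M: "md M" and N: "md N" and h: "h \<in> Lin M N" and x: "x \<in> carrier M"
    and eq: "\<And>v. v \<in> V \<Longrightarrow> h (ac M v x \<oplus>\<^bsub>M\<^esub> x) = \<zero>\<^bsub>N\<^esub>"
  shows "trV M N h x = Nm N (h x)"
proof -
  interpret N: abelian_group N using N by (simp add: md_abelian_group)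
  have hx: "h x \<in> carrier N" by (rule Lin_closed[OF h x])
  have "h (ac M v x) = h x" if v: "v \<in> V" for v
  proof (rule add_eq_zero[OF N])
    have c: "ac M v x \<in> carrier M" using M x v by simp
    show "h (ac M v x) \<in> carrier N" by (rule Lin_closed[OF h c])
    show "h (ac M v x) \<oplus>\<^bsub>N\<^esub> h x = \<zero>\<^bsub>N\<^esub>" using eq[OF v] Lin_add[OF h c x] by simp
  qed (rule hx)
  then have "h (ac M (inv v) x) = h x" if "v \<in> V" for v using that by simp
  then show ?thesis
    unfolding rel_tr_def Nm_def using N hx by (intro N.finsum_cong') auto
qed

lemma trV_invV:
  assumes "md M" "md N" "h \<in> Lin M N" "x \<in> invV M"
  shows "trV M N h x = Nm N (h x)"
  using assms by (intro trV_eq_Nm) (auto simp: invV_def Lin_zero)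

lemma invV_ac: "md M \<Longrightarrow> g \<in> carrier G \<Longrightarrow> x \<in> invV M \<Longrightarrow> ac M g x \<in> invV M"
proof -
  assume *: "md M" "g \<in> carrier G" "x \<in> invV M"
  have "ac M v (ac M g x) = ac M g x" if v: "v \<in> V" for v
  proof -
    have "ac M v (ac M g x) = ac M g (ac M (inv g \<otimes> v \<otimes> g) x)"
      using * v by (simp add: ac_ac invV_def m_assoc[symmetric])
    then show ?thesis using * V_conj'[OF *(2) v] by (simp add: invV_def)
  qed
  with * show ?thesis by (simp add: invV_def)
qed

text \<open>The translates of \<open>x\<close> under \<open>C\<close> are again invariant under the
  normal subgroup \<open>V\<close>, so each coset contributes a norm.\<close>

lemma tr_invV:
  assumes M: "md M" and N: "md N" and h: "h \<in> Lin M N" and x: "x \<in> invV M"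
  shows "tr M N h x \<in> Nm N ` carrier N"
proof -
  interpret N: abelian_group N using N by (simp add: md_abelian_group)
  have xc: "x \<in> carrier M" using x by (simp add: invV_def)
  let ?y = "\<lambda>c. ac N c (h (ac M (inv c) x))"
  have "tr M N h x = (\<Oplus>\<^bsub>N\<^esub>c\<in>C. Nm N (?y c))"
    unfolding tr_eq_trV[OF M N h xc]
  proof (rule N.finsum_cong'[OF refl])
    fix c assume c: "c \<in> C"
    have "trV M N h (ac M (inv c) x) = Nm N (h (ac M (inv c) x))"
      using M N h x c by (intro trV_invV invV_ac) auto
    then show "ac N c (trV M N h (ac M (inv c) x)) = Nm N (?y c)"
      using M N h xc c by (simp add: ac_Nm Lin_closed)
  qed (use M N h xc in \<open>auto simp: Lin_closed Lin_closed[OF Nm_Lin]\<close>)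
  also have "\<dots> = Nm N (\<Oplus>\<^bsub>N\<^esub>c\<in>C. ?y c)"
    by (rule finsum_hom[symmetric])
      (use M N h xc in \<open>auto simp: md_abelian_group Lin_closed Lin_closed[OF Nm_Lin] Lin_add[OF Nm_Lin]\<close>)
  finally show ?thesis
    using M N h xc by (auto intro!: imageI N.finsum_closed simp: Lin_closed)
qed

text \<open>Since \<open>f\<close> is equivariant under the whole group, every coset contributes
  \<open>f x\<close> itself to the full trace, and the number of cosets is 1 in k.\<close>

lemma hom_trV_tr:
  assumes M: "md M" and N: "md N" and h: "h \<in> Lin M N" and f: "f \<in> Hom M N" and x: "x \<in> carrier M"
    and eq: "\<And>x. x \<in> carrier M \<Longrightarrow> f x = trV M N h x"
  shows "f x = tr M N h x"
proof -
  interpret N: abelian_group N using N by (simp add: md_abelian_group)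
  have "tr M N h x = (\<Oplus>\<^bsub>N\<^esub>c\<in>C. sc N 1 (f x))"
    unfolding tr_eq_trV[OF M N h x]
  proof (rule N.finsum_cong'[OF refl])
    fix c assume c: "c \<in> C"
    have "ac N c (trV M N h (ac M (inv c) x)) = ac N c (f (ac M (inv c) x))"
      using M c x eq by simp
    also have "\<dots> = f x" using M N c x f by (simp add: hom_ac hom_closed)
    finally show "ac N c (trV M N h (ac M (inv c) x)) = sc N 1 (f x)"
      using N f x by (simp add: hom_closed)
  qed (use N f x in \<open>auto simp: hom_closed\<close>)
  also have "\<dots> = sc N (\<Sum>c\<in>C. 1) (f x)"
    by (rule finsum_sc_left[OF N finite_C hom_closed[OF f x]])
  also have "\<dots> = f x"
    using N f x by (simp add: of_nat_card_C hom_closed)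
  finally show ?thesis by simp
qed

text \<open>The square of the radical of kV is spanned by the norm element: (v - 1)(u - 1) is 0 when
  u = v, as u^2 = 1 in characteristic two, and is the sum of all four elements when u and v are
  distinct and nontrivial.\<close>

lemma V_product:
  assumes M: "md M" and u: "u \<in> V" and v: "v \<in> V" and x: "x \<in> carrier M"
  defines "y \<equiv> ac M u x \<oplus>\<^bsub>M\<^esub> x"
  shows "ac M v y \<oplus>\<^bsub>M\<^esub> y \<in> Nm M ` carrier M"
proof -
  interpret M: abelian_group M using M by (simp add: md_abelian_group)
  have zero: "\<zero>\<^bsub>M\<^esub> \<in> Nm M ` carrier M"
    using Lin_zero[OF M M Nm_Lin[OF M]] M by (metis image_eqI zero_closed)
  have expand: "ac M v y \<oplus>\<^bsub>M\<^esub> y = ac M (v \<otimes> u) x \<oplus>\<^bsub>M\<^esub> (ac M v x \<oplus>\<^bsub>M\<^esub> (ac M u x \<oplus>\<^bsub>M\<^esub> x))"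
    unfolding y_def using M u v x by (simp add: ac_add ac_ac M.a_assoc)
  have beta_vu: "\<beta> (v \<otimes> u) = \<beta> v + \<beta> u" using u v by (simp add: beta_mult add.commute)
  consider "u = \<one>" | "v = \<one>" | "u = v" | "u \<noteq> \<one>" "v \<noteq> \<one>" "u \<noteq> v" by blast
  then show ?thesis
  proof cases
    case 1
    then show ?thesis unfolding y_def using M v x zero by simp
  next
    case 2
    then show ?thesis unfolding y_def using M u x zero by simp
  next
    case 3
    then have "\<beta> (v \<otimes> u) = 0" using beta_vu by simp
    then have "v \<otimes> u = \<one>" using u v by (intro group_eqI) (simp_all add: chi_mult)
    then show ?thesis unfolding expand using M u x zero 3 by (simp add: M.a_ac)
  next
    case 4
    have ne: "\<beta> u \<noteq> \<beta> v" "\<beta> u \<noteq> 0" "\<beta> v \<noteq> 0"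
      using 4 u v group_eqI[of u v] group_eqI[of u \<one>] group_eqI[of v \<one>] by auto
    have ne': "\<beta> v + \<beta> u \<noteq> \<beta> v" "\<beta> v + \<beta> u \<noteq> \<beta> u" "\<beta> v + \<beta> u \<noteq> 0"
      using ne by (auto, metis add.assoc add.right_neutral add_self(1))
    have dist: "v \<otimes> u \<notin> {v, u, \<one>}" "v \<notin> {u, \<one>}" "u \<notin> {\<one>}"
      using 4 ne' beta_vu by (auto dest: arg_cong[of _ _ \<beta>] simp del: r_cancel_one l_cancel_one r_cancel_one' l_cancel_one')
    then have "card {v \<otimes> u, v, u, \<one>} = 4" by auto
    then have "{v \<otimes> u, v, u, \<one>} = V"
      using u v card_V by (intro card_subset_eq) auto
    then have "Nm M x = (\<Oplus>\<^bsub>M\<^esub>w\<in>{v \<otimes> u, v, u, \<one>}. ac M w x)" by (simp add: Nm_def)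
    also have "\<dots> = ac M (v \<otimes> u) x \<oplus>\<^bsub>M\<^esub> (ac M v x \<oplus>\<^bsub>M\<^esub> (ac M u x \<oplus>\<^bsub>M\<^esub> x))"
      using dist M u v x by simp
    finally show ?thesis using expand x by (metis image_eqI)
  qed
qed

text \<open>The degree-zero part of the ghost condition over V: a map k \<rightarrow> M is an
  invariant of \<open>M\<close>, and a map k \<rightarrow> N is stably zero exactly when the
  invariant is a norm.\<close>

definition V_ghost :: "('g \<Rightarrow> 'k, 'a) module \<Rightarrow> ('g \<Rightarrow> 'k, 'b) module \<Rightarrow> ('a \<Rightarrow> 'b) \<Rightarrow> bool" where
  "V_ghost M N f \<longleftrightarrow> f \<in> Hom M N \<and> (\<forall>x\<in>invV M. f x \<in> Nm N ` carrier N)"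

lemma Nm_invV: "md M \<Longrightarrow> x \<in> carrier M \<Longrightarrow> v \<in> V \<Longrightarrow> ac M v (Nm M x) = Nm M x"
proof -
  assume *: "md M" "x \<in> carrier M" "v \<in> V"
  interpret M: abelian_group M using * by (simp add: md_abelian_group)
  have "ac M v (Nm M x) = (\<Oplus>\<^bsub>M\<^esub>u\<in>V. ac M v (ac M u x))"
    unfolding Nm_def by (rule finsum_hom) (use * in \<open>auto simp: md_abelian_group ac_add\<close>)
  also have "\<dots> = (\<Oplus>\<^bsub>M\<^esub>u\<in>V. ac M (v \<otimes> u) x)"
    using * by (intro M.finsum_cong') (auto simp: ac_ac)
  also have "\<dots> = Nm M x"
    unfolding Nm_def using * by (intro finsum_translate[where F = "\<lambda>u. ac M u x"]) (auto simp: md_abelian_group V_translate)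
  finally show ?thesis .
qed

lemma subspace_Nm_image:
  assumes M: "md M"
  shows "subspace M (Nm M ` carrier M)"
proof -
  note L = Nm_Lin[OF M]
  have "\<zero>\<^bsub>M\<^esub> \<in> Nm M ` carrier M" using Lin_zero[OF M M L] M by (metis image_eqI zero_closed)
  moreover have "Nm M x \<oplus>\<^bsub>M\<^esub> Nm M y \<in> Nm M ` carrier M" if "x \<in> carrier M" "y \<in> carrier M" for x y
    using that M Lin_add[OF L that] by (metis add_closed image_eqI)
  moreover have "sc M c (Nm M x) \<in> Nm M ` carrier M" if "x \<in> carrier M" for c x
    using that M Lin_sc[OF L that] by (metis sc_closed image_eqI)
  ultimately show ?thesis using Lin_closed[OF L] by (auto simp: subspace_def)
qed

text \<open>The radical layers of \<open>M\<close> are killed one at a time by subtracting traces. Let \<open>W\<close> be the image of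
  the norm (the square of the radical) and \<open>Rad\<close> the elements moved by the translations only within \<open>W\<close>.
  Subtracting from the identity the trace of a section \<open>e\<close> of the norm gives a map \<open>p\<close> killing \<open>W\<close>, which
  therefore maps \<open>Rad\<close> to invariants; the first ghost maps those to norms, so \<open>f \<circ> p\<close> is changed by
  a trace to a map \<open>f2\<close> killing \<open>Rad\<close>. Now all values of \<open>f2\<close> are invariant, and the second ghost applies.\<close>

lemma V_ghost_comp:
  assumes M: "md M" and N: "md N" and L: "md L" and f: "V_ghost M N f" and g: "V_ghost N L g"
  obtains h where "h \<in> Lin M L" "\<And>x. x \<in> carrier M \<Longrightarrow> g (f x) = tr M L h x"
proof -
  interpret M: abelian_group M using M by (simp add: md_abelian_group)
  interpret N: abelian_group N using N by (simp add: md_abelian_group)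
  interpret L: abelian_group L using L by (simp add: md_abelian_group)
  note [simp] = M N L
  have fH: "f \<in> Hom M N" and gH: "g \<in> Hom N L"
    and fG: "\<And>x. x \<in> invV M \<Longrightarrow> f x \<in> Nm N ` carrier N"
    and gG: "\<And>x. x \<in> invV N \<Longrightarrow> g x \<in> Nm L ` carrier L"
    using f g by (auto simp: V_ghost_def)
  define W where "W = Nm M ` carrier M"
  have W: "subspace M W" unfolding W_def by (rule subspace_Nm_image[OF M])
  have Wc: "W \<subseteq> carrier M" and W0: "\<zero>\<^bsub>M\<^esub> \<in> W" and Wadd: "\<And>x y. x \<in> W \<Longrightarrow> y \<in> W \<Longrightarrow> x \<oplus>\<^bsub>M\<^esub> y \<in> W"
    and Wsc: "\<And>c x. x \<in> W \<Longrightarrow> sc M c x \<in> W"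
    using W by (auto simp: subspace_def)
  have W_inv: "ac M v x = x" if "v \<in> V" "x \<in> W" for v x
    using that Nm_invV[OF M] by (auto simp: W_def)
  have zero_sub: "subspace M {\<zero>\<^bsub>M\<^esub>}" "{\<zero>\<^bsub>M\<^esub>} \<subseteq> W" using W0 by (auto simp: subspace_def)
  have id: "(\<lambda>x. x) \<in> Lin M M" by (rule LinI) auto
  obtain e where e: "e \<in> Lin M M" "\<And>x. x \<in> W \<Longrightarrow> Nm M (e x) = x"
    by (rule linear_lift[OF M M M id Nm_Lin[OF M] W zero_sub]) (auto simp: W_def)
  define p where "p = (\<lambda>x. x \<oplus>\<^bsub>M\<^esub> trV M M e x)"
  have tre: "trV M M e \<in> Lin M M" by (rule trV_Lin[OF M M e(1)])
  have p: "p \<in> Lin M M" unfolding p_def by (rule Lin_plus[OF M M id tre])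
  have pW: "p x = \<zero>\<^bsub>M\<^esub>" if "x \<in> W" for x
  proof -
    have x: "x \<in> carrier M" using that Wc by auto
    then have "x \<in> invV M" using W_inv that by (auto simp: invV_def)
    then have "trV M M e x = x" using trV_invV[OF M M e(1)] e(2)[OF that] by simp
    then show ?thesis using x by (simp add: p_def)
  qed
  have p_ac: "p (ac M v x) = ac M v (p x)" if "v \<in> V" "x \<in> carrier M" for v x
    using that Lin_closed[OF tre] by (simp add: p_def ac_add ac_trV e(1))
  define Rad where "Rad = {x \<in> carrier M. \<forall>v\<in>V. ac M v x \<oplus>\<^bsub>M\<^esub> x \<in> W}"
  have Rad: "subspace M Rad"
    unfolding subspace_def
  proof (intro conjI ballI allI)
    show "\<zero>\<^bsub>M\<^esub> \<in> Rad" using W0 by (auto simp: Rad_def)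
  next
    fix x y assume xy: "x \<in> Rad" "y \<in> Rad"
    have "ac M v (x \<oplus>\<^bsub>M\<^esub> y) \<oplus>\<^bsub>M\<^esub> (x \<oplus>\<^bsub>M\<^esub> y) = (ac M v x \<oplus>\<^bsub>M\<^esub> x) \<oplus>\<^bsub>M\<^esub> (ac M v y \<oplus>\<^bsub>M\<^esub> y)" if "v \<in> V" for v
      using xy that by (simp add: Rad_def ac_add M.a_ac)
    then show "x \<oplus>\<^bsub>M\<^esub> y \<in> Rad" using xy Wadd by (simp add: Rad_def)
  next
    fix c x assume x: "x \<in> Rad"
    have "ac M v (sc M c x) \<oplus>\<^bsub>M\<^esub> sc M c x = sc M c (ac M v x \<oplus>\<^bsub>M\<^esub> x)" if "v \<in> V" for v
      using x that by (simp add: Rad_def ac_sc sc_add)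
    then show "sc M c x \<in> Rad" using x Wsc by (simp add: Rad_def)
  qed (auto simp: Rad_def)
  have W_Rad: "W \<subseteq> Rad" using Wc W_inv W0 by (auto simp: Rad_def)
  have moved: "ac M u x \<oplus>\<^bsub>M\<^esub> x \<in> Rad" if "u \<in> V" "x \<in> carrier M" for u x
    using that V_product[OF M that(1) _ that(2)] by (simp add: Rad_def W_def)
  have fp: "f \<circ> p \<in> Lin M N" by (rule Lin_comp[OF p hom_Lin[OF M N fH]])
  have fp_Rad: "(f \<circ> p) x \<in> Nm N ` carrier N" if x: "x \<in> Rad" for x
  proof -
    have xc: "x \<in> carrier M" using x by (simp add: Rad_def)
    have "ac M v (p x) = p x" if v: "v \<in> V" for v
    proof (rule add_eq_zero[OF M])
      have "ac M v (p x) \<oplus>\<^bsub>M\<^esub> p x = p (ac M v x \<oplus>\<^bsub>M\<^esub> x)"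
        using v xc by (simp add: p_ac Lin_add[OF p])
      also have "\<dots> = \<zero>\<^bsub>M\<^esub>" using x v by (intro pW) (simp add: Rad_def)
      finally show "ac M v (p x) \<oplus>\<^bsub>M\<^esub> p x = \<zero>\<^bsub>M\<^esub>" .
    qed (use v xc Lin_closed[OF p] in auto)
    then show ?thesis using fG[of "p x"] Lin_closed[OF p xc] by (simp add: invV_def)
  qed
  have fpW: "(f \<circ> p) x = \<zero>\<^bsub>N\<^esub>" if "x \<in> W" for x
    using pW[OF that] hom_zero[OF M N fH] by simp
  \<comment> \<open>The requirement that \<open>h0\<close> vanish on \<open>W\<close> is essential:
    elements of \<open>Rad\<close> are moved within \<open>W\<close>, so by \<open>trV_eq_Nm\<close>
    the trace of \<open>h0\<close> on \<open>Rad\<close> is the norm of its value. The map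
    \<open>h3\<close> below must vanish on \<open>Rad\<close> for the same reason.\<close>
  obtain h0 where h0: "h0 \<in> Lin M N" "\<And>x. x \<in> Rad \<Longrightarrow> Nm N (h0 x) = (f \<circ> p) x" "\<And>x. x \<in> W \<Longrightarrow> h0 x = \<zero>\<^bsub>N\<^esub>"
    by (rule linear_lift[OF M N N fp Nm_Lin[OF N] Rad W W_Rad fp_Rad fpW]) (assumption | rule that)+
  define f2 where "f2 = (\<lambda>x. (f \<circ> p) x \<oplus>\<^bsub>N\<^esub> trV M N h0 x)"
  have trh0: "trV M N h0 \<in> Lin M N" by (rule trV_Lin[OF M N h0(1)])
  have f2: "f2 \<in> Lin M N" unfolding f2_def by (rule Lin_plus[OF M N fp trh0])
  have f2_Rad: "f2 x = \<zero>\<^bsub>N\<^esub>" if x: "x \<in> Rad" for x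
  proof -
    have xc: "x \<in> carrier M" using x by (simp add: Rad_def)
    have "trV M N h0 x = Nm N (h0 x)"
      by (rule trV_eq_Nm[OF M N h0(1) xc], rule h0(3)) (use x in \<open>simp add: Rad_def\<close>)
    then show ?thesis using h0(2)[OF x] Lin_closed[OF fp xc] by (simp add: f2_def)
  qed
  have f2_ac: "f2 (ac M v x) = ac N v (f2 x)" if "v \<in> V" "x \<in> carrier M" for v x
    using that Lin_closed[OF trh0] Lin_closed[OF p] fH
    by (simp add: f2_def ac_add ac_trV h0(1) p_ac hom_ac hom_closed)
  have f2_inv: "f2 x \<in> invV N" if x: "x \<in> carrier M" for x
  proof -
    have "ac N v (f2 x) = f2 x" if v: "v \<in> V" for v
    proof (rule add_eq_zero[OF N])
      have "ac N v (f2 x) \<oplus>\<^bsub>N\<^esub> f2 x = f2 (ac M v x \<oplus>\<^bsub>M\<^esub> x)"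
        using v x by (simp add: f2_ac Lin_add[OF f2])
      also have "\<dots> = \<zero>\<^bsub>N\<^esub>" by (rule f2_Rad[OF moved[OF v x]])
      finally show "ac N v (f2 x) \<oplus>\<^bsub>N\<^esub> f2 x = \<zero>\<^bsub>N\<^esub>" .
    qed (use v x Lin_closed[OF f2] in auto)
    then show ?thesis using Lin_closed[OF f2 x] by (simp add: invV_def)
  qed
  have gf2: "g \<circ> f2 \<in> Lin M L" by (rule Lin_comp[OF f2 hom_Lin[OF N L gH]])
  have all_sub: "subspace M (carrier M)" "Rad \<subseteq> carrier M"
    by (auto simp: subspace_def Rad_def)
  have gf2_im: "(g \<circ> f2) x \<in> Nm L ` carrier L" if "x \<in> carrier M" for x
    using gG[OF f2_inv[OF that]] by simp
  have gf2_Rad: "(g \<circ> f2) x = \<zero>\<^bsub>L\<^esub>" if "x \<in> Rad" for x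
    using f2_Rad[OF that] hom_zero[OF N L gH] by simp
  obtain h3 where h3: "h3 \<in> Lin M L" "\<And>x. x \<in> carrier M \<Longrightarrow> Nm L (h3 x) = (g \<circ> f2) x"
    "\<And>x. x \<in> Rad \<Longrightarrow> h3 x = \<zero>\<^bsub>L\<^esub>"
    by (rule linear_lift[OF M L L gf2 Nm_Lin[OF L] all_sub(1) Rad all_sub(2) gf2_im gf2_Rad])
      (assumption | rule that)+
  have trh3: "trV M L h3 x = g (f2 x)" if x: "x \<in> carrier M" for x
    using trV_eq_Nm[OF M L h3(1) x h3(3)[OF moved[OF _ x]]] h3(2)[OF x] by simp
  define h1 where "h1 = g \<circ> h0"
  define h2 where "h2 = (g \<circ> f) \<circ> e"
  have gfH: "g \<circ> f \<in> Hom M L" by (rule hom_comp[OF fH gH])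
  have h1: "h1 \<in> Lin M L" unfolding h1_def by (rule Lin_comp[OF h0(1) hom_Lin[OF N L gH]])
  have h2: "h2 \<in> Lin M L" unfolding h2_def by (rule Lin_comp[OF e(1) hom_Lin[OF M L gfH]])
  let ?h = "\<lambda>x. (h3 x \<oplus>\<^bsub>L\<^esub> h1 x) \<oplus>\<^bsub>L\<^esub> h2 x"
  have h31: "(\<lambda>x. h3 x \<oplus>\<^bsub>L\<^esub> h1 x) \<in> Lin M L" by (rule Lin_plus[OF M L h3(1) h1])
  have h: "?h \<in> Lin M L" by (rule Lin_plus[OF M L h31 h2])
  \<comment> \<open>Undo the two corrections, using that signs do not matter: x is p x plus the
    trace of \<open>e\<close> at x, and f (p x) is f2 x plus the trace of \<open>h0\<close> at x.
    All three resulting terms are traces from \<open>V\<close>.\<close>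
  have key: "(g \<circ> f) x = trV M L ?h x" if x: "x \<in> carrier M" for x
  proof -
    have c: "p x \<in> carrier M" "trV M M e x \<in> carrier M" "f (p x) \<in> carrier N" "trV M N h0 x \<in> carrier N"
      "f2 x \<in> carrier N" "g (f2 x) \<in> carrier L"
      using x Lin_closed[OF p] Lin_closed[OF tre] Lin_closed[OF fp] Lin_closed[OF trh0] Lin_closed[OF f2] gH
      by (auto simp: hom_closed)
    have "x = p x \<oplus>\<^bsub>M\<^esub> trV M M e x" using x c by (simp add: p_def)
    then have "(g \<circ> f) x = (g \<circ> f) (p x) \<oplus>\<^bsub>L\<^esub> (g \<circ> f) (trV M M e x)"
      using c hom_add[OF gfH] by metis
    also have "(g \<circ> f) (trV M M e x) = trV M L h2 x"
      unfolding h2_def by (rule trV_comp_hom_left[OF M M L e(1) gfH x])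
    also have "f (p x) = f2 x \<oplus>\<^bsub>N\<^esub> trV M N h0 x" using c by (simp add: f2_def)
    then have "(g \<circ> f) (p x) = g (f2 x) \<oplus>\<^bsub>L\<^esub> g (trV M N h0 x)" using c hom_add[OF gH] by simp
    also have "g (trV M N h0 x) = trV M L h1 x"
      unfolding h1_def by (rule trV_comp_hom_left[OF M N L h0(1) gH x])
    also have "g (f2 x) = trV M L h3 x" using trh3[OF x] by simp
    finally show ?thesis
      using x by (simp add: trV_plus[OF M L h31 h2 x] trV_plus[OF M L h3(1) h1 x])
  qed
  have "g (f x) = tr M L ?h x" if "x \<in> carrier M" for x
    using hom_trV_tr[OF M L h gfH that key] by simp
  with h show thesis by (rule that)
qed

end

section \<open>Eigenvectors and the one-dimensional simple modules they span\<close>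

context finite_group
begin

lemma trivial_modulesI:
  fixes T :: "('g \<Rightarrow> 'k, 'a) module"
  assumes T: "md T" and bij: "bij_betw f (carrier T) UNIV"
    and add: "\<And>x y. x \<in> carrier T \<Longrightarrow> y \<in> carrier T \<Longrightarrow> f (x \<oplus>\<^bsub>T\<^esub> y) = f x + f y"
    and sc: "\<And>c x. x \<in> carrier T \<Longrightarrow> f (sc T c x) = c * f x"
    and ac: "\<And>g x. g \<in> carrier G \<Longrightarrow> x \<in> carrier T \<Longrightarrow> ac T g x = x"
  shows "T \<in> trivial_modules G"
proof -
  interpret T: abelian_group T using T by (rule md_abelian_group)
  have "f (a \<odot>\<^bsub>T\<^esub> x) = a \<odot>\<^bsub>trivial_module G\<^esub> f x" if "a \<in> carrier R" and x: "x \<in> carrier T" for a x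
  proof -
    have "a \<odot>\<^bsub>T\<^esub> x = (\<Oplus>\<^bsub>T\<^esub>g\<in>carrier G. sc T (a g) x)"
      unfolding smult_eq_finsum[OF T that] using T x ac by (intro T.finsum_cong') auto
    also have "\<dots> = sc T (\<Sum>g\<in>carrier G. a g) x"
      by (rule finsum_sc_left[OF T finite_carrier x])
    finally show ?thesis using sc[OF x] by (simp add: trivial_module_def)
  qed
  then have "f \<in> left_module_hom R T (trivial_module G)"
    using add by (simp add: left_module_hom_def trivial_module_def)
  moreover have "bij_betw f (carrier T) (carrier (trivial_module G :: ('g \<Rightarrow> 'k, 'k) module))"
    using bij by (simp add: trivial_module_def)
  ultimately show ?thesis
    using T unfolding trivial_modules_def left_module_isomorphic_def by blast
qed

lemma kernel_submodule:
  assumes M: "md M" and N: "md N" and f: "f \<in> Hom M N"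
  shows "submodule {x \<in> carrier M. f x = \<zero>\<^bsub>N\<^esub>} R M"
proof -
  interpret M: left_module R M by (fact M)
  interpret N: left_module R N by (fact N)
  show ?thesis
  proof (intro submodule.intro submodule_axioms.intro M.M.add.subgroupI)
    fix x assume x: "x \<in> {x \<in> carrier M. f x = \<zero>\<^bsub>N\<^esub>}"
    then show "\<ominus>\<^bsub>M\<^esub> x \<in> {x \<in> carrier M. f x = \<zero>\<^bsub>N\<^esub>}"
      using M N f by (simp add: uminus_eq_sc hom_sc)
    show "a \<odot>\<^bsub>M\<^esub> x \<in> {x \<in> carrier M. f x = \<zero>\<^bsub>N\<^esub>}" if a: "a \<in> carrier R" for a
    proof -
      have "a \<odot>\<^bsub>N\<^esub> \<zero>\<^bsub>N\<^esub> \<oplus>\<^bsub>N\<^esub> a \<odot>\<^bsub>N\<^esub> \<zero>\<^bsub>N\<^esub> = a \<odot>\<^bsub>N\<^esub> \<zero>\<^bsub>N\<^esub>"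
        using a by (simp flip: N.smult_r_distr)
      then have "a \<odot>\<^bsub>N\<^esub> \<zero>\<^bsub>N\<^esub> = \<zero>\<^bsub>N\<^esub>" using a by (simp add: N.M.add.r_cancel_one')
      then show ?thesis using a x f by (simp add: hom_smult)
    qed
  next
    show "{x \<in> carrier M. f x = \<zero>\<^bsub>N\<^esub>} \<noteq> {}" using hom_zero[OF M N f] zero_closed[OF M] by blast
  qed (use f N in \<open>auto simp: hom_add\<close>)
qed

end

context affine_group
begin

text \<open>Only the residue of \<open>j\<close> modulo 3 matters, since the values of \<chi> are
  cube roots of unity.\<close>

definition eigenvector :: "('g \<Rightarrow> 'k, 'a) module \<Rightarrow> nat \<Rightarrow> 'a \<Rightarrow> bool" where
  "eigenvector M j x \<longleftrightarrow> x \<in> carrier M \<and> (\<forall>g\<in>carrier G. ac M g x = sc M (\<chi> g ^ j) x)"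

definition line :: "('g \<Rightarrow> 'k, 'a) module \<Rightarrow> 'a \<Rightarrow> ('g \<Rightarrow> 'k, 'a) module" where
  "line M x = M\<lparr>carrier := range (\<lambda>c. sc M c x)\<rparr>"

lemma eigenvector_invV: "md M \<Longrightarrow> eigenvector M j x \<Longrightarrow> x \<in> invV M"
  by (auto simp: eigenvector_def invV_def)

lemma line_simps:
  "carrier (line M x) = range (\<lambda>c. sc M c x)" "\<zero>\<^bsub>line M x\<^esub> = \<zero>\<^bsub>M\<^esub>"
  "add (line M x) = add M" "smult (line M x) = smult M" "sc (line M x) = sc M" "ac (line M x) = ac M"
  by (simp_all add: line_def sc_def [abs_def] ac_def [abs_def])

lemma line_md:
  assumes M: "md M" and x: "eigenvector M j x"
  shows "md (line M x)"
  unfolding line_def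
proof (rule submodule_md[OF M])
  have xc: "x \<in> carrier M" using x by (simp add: eigenvector_def)
  show "subspace M (range (\<lambda>c. sc M c x))"
    unfolding subspace_def
  proof (intro conjI ballI allI)
    show "\<zero>\<^bsub>M\<^esub> \<in> range (\<lambda>c. sc M c x)" using M xc by (intro image_eqI[of _ _ 0]) auto
    show "y \<oplus>\<^bsub>M\<^esub> z \<in> range (\<lambda>c. sc M c x)" if "y \<in> range (\<lambda>c. sc M c x)" "z \<in> range (\<lambda>c. sc M c x)" for y z
      using that M xc by (auto simp flip: sc_add_left)
  qed (use M xc in auto)
  show "ac M g y \<in> range (\<lambda>c. sc M c x)" if "g \<in> carrier G" "y \<in> range (\<lambda>c. sc M c x)" for g y
    using that M x by (auto simp: eigenvector_def ac_sc)
qed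

lemma line_simple:
  assumes M: "md M" and x: "eigenvector M j x" and nz: "x \<noteq> \<zero>\<^bsub>M\<^esub>"
  shows "simple_module R (line M x)"
  unfolding simple_module_def
proof (intro conjI allI impI)
  have xc: "x \<in> carrier M" using x by (simp add: eigenvector_def)
  show "md (line M x)" by (rule line_md[OF M x])
  have "x \<in> carrier (line M x)" unfolding line_simps using M xc by (intro image_eqI[of _ _ 1]) auto
  then show "carrier (line M x) \<noteq> {\<zero>\<^bsub>line M x\<^esub>}" using nz by (auto simp: line_simps)
  fix H assume H: "submodule H R (line M x)"
  interpret H: submodule H R "line M x" by (fact H)
  have sub: "H \<subseteq> carrier (line M x)" and z: "\<zero>\<^bsub>M\<^esub> \<in> H"
    using H.subset H.one_closed by (simp_all add: line_simps)
  have scH: "sc M c y \<in> H" if "y \<in> H" for c y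
    using H.smult_closed[OF delta_closed[OF one_closed] that, of c] by (simp add: sc_def line_simps)
  show "H = {\<zero>\<^bsub>line M x\<^esub>} \<or> H = carrier (line M x)"
  proof (cases "H = {\<zero>\<^bsub>M\<^esub>}")
    case False
    then obtain y where y: "y \<in> H" "y \<noteq> \<zero>\<^bsub>M\<^esub>" using z by blast
    then obtain c where c: "y = sc M c x" using sub by (auto simp: line_simps)
    then have "c \<noteq> 0" using y M xc by auto
    then have "sc M d x \<in> H" for d
      using scH[OF y(1), of "d * inverse c"] c M xc by (simp add: mult.assoc)
    then show ?thesis using sub by (auto simp: line_simps)
  qed (simp add: line_simps)
qed

lemma line_trivial:
  assumes M: "md M" and x: "eigenvector M 0 x" and nz: "x \<noteq> \<zero>\<^bsub>M\<^esub>"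
  shows "line M x \<in> trivial_modules G"
proof -
  have xc: "x \<in> carrier M" and inv: "\<And>g. g \<in> carrier G \<Longrightarrow> ac M g x = x"
    using x M by (auto simp: eigenvector_def)
  have inj: "c = d" if "sc M c x = sc M d x" for c d
  proof (rule ccontr)
    assume ne: "c \<noteq> d"
    have "sc M (c + d) x = \<zero>\<^bsub>M\<^esub>" using that M xc by (simp add: sc_add_left)
    then have "sc M (inverse (c + d)) (sc M (c + d) x) = \<zero>\<^bsub>M\<^esub>" using M by simp
    moreover have "c + d \<noteq> 0" using ne by (metis add.right_neutral add_self(2))
    ultimately show False using M xc nz by simp
  qed
  define f where "f y = (THE c. sc M c x = y)" for y
  have f: "f (sc M c x) = c" for c
    unfolding f_def using inj by blast
  show ?thesis
  proof (rule trivial_modulesI[OF line_md[OF M x], of f])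
    show "bij_betw f (carrier (line M x)) UNIV"
      by (rule bij_betw_byWitness[where f' = "\<lambda>c. sc M c x"]) (auto simp: line_simps f)
  qed (use M xc inv in \<open>auto simp: line_simps f ac_sc simp flip: sc_add_left\<close>)
qed

text \<open>The inclusion of the line through \<open>x\<close> is a test map of degree 0. By
  Higman's criterion \<open>f\<close> restricted to the line is a trace, and a trace takes the
  invariant \<open>x\<close> to a norm.\<close>

lemma ghost_eigenvector:
  fixes M N :: "('g \<Rightarrow> 'k, 'u) module"
  assumes M: "md M" and N: "md N" and f: "is_ghost_wrt R \<S> M N f" and x: "eigenvector M j x"
    and S: "x \<noteq> \<zero>\<^bsub>M\<^esub> \<Longrightarrow> line M x \<in> \<S>"
  shows "f x \<in> Nm N ` carrier N"
proof (cases "x = \<zero>\<^bsub>M\<^esub>")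
  case True
  have "f \<in> Hom M N" using f by (simp add: is_ghost_wrt_def)
  moreover have "\<zero>\<^bsub>N\<^esub> \<in> Nm N ` carrier N" using subspace_Nm_image[OF N] by (simp add: subspace_def)
  ultimately show ?thesis using True hom_zero[OF M N] by simp
next
  case False
  have xc: "x \<in> carrier M" using x by (simp add: eigenvector_def)
  have L: "md (line M x)" by (rule line_md[OF M x])
  have "id \<in> Hom (line M x) M"
    using M xc by (auto simp: left_module_hom_def line_simps)
  moreover have "is_Omega R 0 (line M x) (line M x)" by (simp add: is_Omega_def)
  ultimately have "stably_zero R (line M x) N (f \<circ> id)"
    using f S[OF False] unfolding is_ghost_wrt_def by blast
  then obtain h where h: "h \<in> Lin (line M x) N" "\<And>y. y \<in> carrier (line M x) \<Longrightarrow> f y = tr (line M x) N h y"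
    using stably_zero_iff_tr[OF L N] by auto
  have xl: "x \<in> carrier (line M x)" unfolding line_simps using M xc by (intro image_eqI[of _ _ 1]) auto
  then have "x \<in> invV (line M x)"
    using eigenvector_invV[OF M x] by (simp add: invV_def line_simps)
  from tr_invV[OF L N h(1) this] h(2)[OF xl] show ?thesis by simp
qed

text \<open>The invariants are a representation of the quotient by \<open>V\<close>, which is cyclic
  of order dividing 3, and k contains the cube roots of unity.\<close>

lemma eigenvector_decomposition:
  assumes M: "md M" and x: "x \<in> invV M"
  obtains x0 x1 x2 where "eigenvector M 0 x0" "eigenvector M 1 x1" "eigenvector M 2 x2"
    "x = x0 \<oplus>\<^bsub>M\<^esub> (x1 \<oplus>\<^bsub>M\<^esub> x2)"
proof -
  interpret M: abelian_group M using M by (rule md_abelian_group)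
  have xc: "x \<in> carrier M" using x by (simp add: invV_def)
  \<comment> \<open>The usual isotypic projection: \<open>\<chi> c ^ (2 * j)\<close> is the inverse
    of \<open>\<chi> c ^ j\<close>, and the factor 1/|C| is 1.\<close>
  define y where "y j = (\<Oplus>\<^bsub>M\<^esub>c\<in>C. sc M (\<chi> c ^ (2 * j)) (ac M c x))" for j :: nat
  have yc: "y j \<in> carrier M" for j
    unfolding y_def using M xc by (intro M.finsum_closed) auto
  have y_V: "ac M v (y j) = y j" if v: "v \<in> V" for v j
  proof -
    have "ac M v (y j) = (\<Oplus>\<^bsub>M\<^esub>c\<in>C. ac M v (sc M (\<chi> c ^ (2 * j)) (ac M c x)))"
      unfolding y_def by (rule finsum_hom) (use M xc v in \<open>auto simp: md_abelian_group ac_add\<close>)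
    also have "\<dots> = y j"
      unfolding y_def
    proof (rule M.finsum_cong'[OF refl])
      fix c assume c: "c \<in> C"
      have "ac M v (ac M c x) = ac M c x"
        using invV_ac[OF M C_carrier[OF c] x] v by (simp add: invV_def)
      then show "ac M v (sc M (\<chi> c ^ (2 * j)) (ac M c x)) = sc M (\<chi> c ^ (2 * j)) (ac M c x)"
        using M xc c v by (simp add: ac_sc)
    qed (use M xc in auto)
    finally show ?thesis .
  qed
  have y_C: "ac M d (y j) = sc M (\<chi> d ^ j) (y j)" if d: "d \<in> C" for d j
  proof -
    have inj: "inj_on (\<lambda>c. d \<otimes> c) C" using d by (auto simp: inj_on_def)
    have img: "(\<lambda>c. d \<otimes> c) ` C = C" by (rule endo_inj_surj) (use d inj in auto)
    have "sc M (\<chi> d ^ j) (y j) = (\<Oplus>\<^bsub>M\<^esub>c\<in>C. sc M (\<chi> d ^ j) (sc M (\<chi> c ^ (2 * j)) (ac M c x)))"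
      unfolding y_def by (rule finsum_hom) (use M xc in \<open>auto simp: md_abelian_group sc_add\<close>)
    also have "\<dots> = (\<Oplus>\<^bsub>M\<^esub>c\<in>C. sc M (\<chi> d ^ j * \<chi> c ^ (2 * j)) (ac M c x))"
      using M xc by (intro M.finsum_cong') auto
    also have "\<dots> = (\<Oplus>\<^bsub>M\<^esub>c\<in>C. sc M (\<chi> d ^ j * \<chi> (d \<otimes> c) ^ (2 * j)) (ac M (d \<otimes> c) x))"
      using M.finsum_reindex[OF _ inj, of "\<lambda>c. sc M (\<chi> d ^ j * \<chi> c ^ (2 * j)) (ac M c x)"] img M xc by auto
    also have "\<dots> = (\<Oplus>\<^bsub>M\<^esub>c\<in>C. ac M d (sc M (\<chi> c ^ (2 * j)) (ac M c x)))"
    proof (rule M.finsum_cong'[OF refl])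
      fix c assume c: "c \<in> C"
      have "\<chi> d ^ j * \<chi> d ^ (2 * j) = (\<chi> d ^ 3) ^ j"
        by (simp flip: power_add power_mult)
      also have "\<dots> = 1" using d by simp
      finally have "\<chi> d ^ j * \<chi> (d \<otimes> c) ^ (2 * j) = \<chi> c ^ (2 * j)"
        using c d by (simp add: chi_mult power_mult_distrib flip: mult.assoc)
      then show "sc M (\<chi> d ^ j * \<chi> (d \<otimes> c) ^ (2 * j)) (ac M (d \<otimes> c) x) =
          ac M d (sc M (\<chi> c ^ (2 * j)) (ac M c x))"
        using M xc c d by (simp add: ac_sc ac_ac)
    qed (use M xc d in auto)
    also have "\<dots> = ac M d (y j)"
      unfolding y_def by (rule finsum_hom[symmetric]) (use M xc d in \<open>auto simp: md_abelian_group ac_add\<close>)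
    finally show ?thesis by simp
  qed
  have eig: "eigenvector M j (y j)" for j
    unfolding eigenvector_def
  proof (intro conjI ballI yc)
    fix g assume g: "g \<in> carrier G"
    then obtain c v where cv: "c \<in> C" "v \<in> V" "g = c \<otimes> v" using coset_decomposition by blast
    then have "ac M g (y j) = ac M c (ac M v (y j))" using M yc by (simp add: ac_ac)
    also have "\<dots> = sc M (\<chi> c ^ j) (y j)" using cv y_V y_C by simp
    finally show "ac M g (y j) = sc M (\<chi> g ^ j) (y j)" using cv by (simp add: chi_mult)
  qed
  have "y 0 \<oplus>\<^bsub>M\<^esub> (y 1 \<oplus>\<^bsub>M\<^esub> y 2) = (\<Oplus>\<^bsub>M\<^esub>c\<in>C. sc M (\<chi> c ^ 0) (ac M c x) \<oplus>\<^bsub>M\<^esub> (sc M (\<chi> c ^ 2) (ac M c x) \<oplus>\<^bsub>M\<^esub> sc M (\<chi> c ^ 4) (ac M c x)))"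
    unfolding y_def using M xc by (simp add: M.finsum_addf Pi_def)
  \<comment> \<open>Orthogonality of characters: the coefficient 1 + \<chi> + \<chi>^2 vanishes at a
    nontrivial cube root of unity and is 3 = 1 at the identity.\<close>
  also have "\<dots> = (\<Oplus>\<^bsub>M\<^esub>c\<in>C. if \<one> = c then x else \<zero>\<^bsub>M\<^esub>)"
  proof (rule M.finsum_cong'[OF refl])
    fix c assume c: "c \<in> C"
    have eq: "sc M (\<chi> c ^ 0) (ac M c x) \<oplus>\<^bsub>M\<^esub> (sc M (\<chi> c ^ 2) (ac M c x) \<oplus>\<^bsub>M\<^esub> sc M (\<chi> c ^ 4) (ac M c x)) =
        sc M (1 + (\<chi> c ^ 2 + \<chi> c ^ 4)) (ac M c x)"
      using M xc c by (simp add: sc_add_left)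
    have pow: "\<chi> c ^ 4 = \<chi> c"
      using power_add[of "\<chi> c" 3 1] chi_cube(2)[OF C_carrier[OF c]] by simp
    show "sc M (\<chi> c ^ 0) (ac M c x) \<oplus>\<^bsub>M\<^esub> (sc M (\<chi> c ^ 2) (ac M c x) \<oplus>\<^bsub>M\<^esub> sc M (\<chi> c ^ 4) (ac M c x)) =
        (if \<one> = c then x else \<zero>\<^bsub>M\<^esub>)"
    proof (cases "\<one> = c")
      case True
      then show ?thesis unfolding eq unfolding pow using M xc by auto
    next
      case False
      then have "\<chi> c \<noteq> 1" using c group_eqI[of c \<one>] by auto
      then have "\<chi> c = \<omega> \<or> \<chi> c = \<omega> + 1" using chi_cases[OF C_carrier[OF c]] by auto
      then have "1 + (\<chi> c ^ 2 + \<chi> c) = 0"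
        by (elim disjE) (simp_all add: power2_eq_square algebra_simps)
      then show ?thesis unfolding eq unfolding pow using M xc c False by simp
    qed
  qed (use xc in auto)
  also have "\<dots> = x" using xc by (intro M.finsum_singleton) auto
  finally have "x = y 0 \<oplus>\<^bsub>M\<^esub> (y 1 \<oplus>\<^bsub>M\<^esub> y 2)" by simp
  with eig show thesis by (intro that)
qed

lemma Nm_image_add:
  "md N \<Longrightarrow> y \<in> Nm N ` carrier N \<Longrightarrow> z \<in> Nm N ` carrier N \<Longrightarrow> y \<oplus>\<^bsub>N\<^esub> z \<in> Nm N ` carrier N"
  using subspace_Nm_image[of N] unfolding subspace_def by blast

lemma simple_ghost_V_ghost:
  fixes M N :: "('g \<Rightarrow> 'k, 'u) module"
  assumes M: "md M" and N: "md N" and f: "is_ghost_wrt R {S. simple_module R S} M N f"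
  shows "V_ghost M N f"
  unfolding V_ghost_def
proof (intro conjI ballI)
  show fH: "f \<in> Hom M N" using f by (simp add: is_ghost_wrt_def)
  fix x assume "x \<in> invV M"
  then obtain x0 x1 x2 where x: "eigenvector M 0 x0" "eigenvector M 1 x1" "eigenvector M 2 x2"
    "x = x0 \<oplus>\<^bsub>M\<^esub> (x1 \<oplus>\<^bsub>M\<^esub> x2)"
    by (rule eigenvector_decomposition[OF M])
  have *: "f y \<in> Nm N ` carrier N" if "eigenvector M j y" for j y
    by (rule ghost_eigenvector[OF M N f that]) (simp add: line_simple[OF M that])
  have "f x = f x0 \<oplus>\<^bsub>N\<^esub> (f x1 \<oplus>\<^bsub>N\<^esub> f x2)"
    using x M by (simp add: hom_add[OF fH] eigenvector_def)
  then show "f x \<in> Nm N ` carrier N"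
    using *[OF x(1)] *[OF x(2)] *[OF x(3)] by (simp only: Nm_image_add[OF N])
qed

text \<open>When \<open>A\<close> is \<open>{1}\<close> the group consists of translations, so every
  invariant has weight 0 and spans a copy of the trivial module.\<close>

lemma trivial_ghost_V_ghost:
  fixes M N :: "('g \<Rightarrow> 'k, 'u) module"
  assumes "A = {1}" and M: "md M" and N: "md N" and f: "is_ghost_wrt R (trivial_modules G) M N f"
  shows "V_ghost M N f"
  unfolding V_ghost_def
proof (intro conjI ballI)
  show fH: "f \<in> Hom M N" using f by (simp add: is_ghost_wrt_def)
  fix x assume x: "x \<in> invV M"
  have "g \<in> V" if "g \<in> carrier G" for g using that chi_A[OF that] assms(1) unfolding V_def by auto
  then have "eigenvector M 0 x" using x M by (auto simp: eigenvector_def invV_def)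
  then show "f x \<in> Nm N ` carrier N"
    by (rule ghost_eigenvector[OF M N f]) (rule line_trivial[OF M \<open>eigenvector M 0 x\<close>])
qed

end

section \<open>Subquotients of the permutation module on four points\<close>

context affine_group
begin

text \<open>The permutation module \<open>k[\<bbbF>\<^sub>4]\<close> in terms of the moments \<open>m i = (\<Sum>x. x ^ i * \<mu> x)\<close> of
  \<open>\<mu> \<in> k[\<bbbF>\<^sub>4]\<close>, twisted by \<open>\<chi> ^ j\<close>: the element \<open>x \<mapsto> \<chi> x + \<beta>\<close> acts by the binomial formula. The moment
  \<open>m 0\<close> is the top of the module, \<open>m 3\<close> its socle.\<close>

definition rho :: "nat \<Rightarrow> 'g \<Rightarrow> (nat \<Rightarrow> 'k) \<Rightarrow> nat \<Rightarrow> 'k" where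
  "rho j g m = (\<lambda>i. if g \<notin> carrier G then 0 else \<chi> g ^ j *
     (if i = 0 then m 0
      else if i = 1 then \<chi> g * m 1 + \<beta> g * m 0
      else if i = 2 then \<chi> g * \<chi> g * m 2 + \<beta> g * \<beta> g * m 0
      else if i = 3 then m 3 + \<chi> g * \<chi> g * \<beta> g * m 2 + \<chi> g * \<beta> g * \<beta> g * m 1 + \<beta> g * \<beta> g * \<beta> g * m 0
      else 0))"

definition trunc :: "nat set \<Rightarrow> (nat \<Rightarrow> 'k) \<Rightarrow> nat \<Rightarrow> 'k" where
  "trunc I m = (\<lambda>i. if i \<in> I then m i else 0)"

definition vec :: "nat set \<Rightarrow> (nat \<Rightarrow> 'k) ring" where
  "vec I = \<lparr>carrier = {m. \<forall>i. i \<notin> I \<longrightarrow> m i = 0}, monoid.mult = (\<lambda>m n. m), one = (\<lambda>i. 0),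
     zero = (\<lambda>i. 0), add = (\<lambda>m n i. m i + n i)\<rparr>"

text \<open>For \<open>j = 0\<close>, the set \<open>{0, 1, 2, 3}\<close> gives P,
  \<open>{1, 2, 3}\<close> gives \<Omega>k, \<open>{0, 1, 2}\<close> gives the inverse of \<Omega>
  applied to k, \<open>{1, 2}\<close> gives rad P / soc P, and \<open>{0, 1}\<close> gives
  L.\<close>

definition D :: "nat \<Rightarrow> nat set \<Rightarrow> ('g \<Rightarrow> 'k, nat \<Rightarrow> 'k) module" where
  "D j I = rep_module (vec I) (\<lambda>c m i. c * m i) (\<lambda>g m. trunc I (rho j g m))"

text \<open>Order the moments by which of them enter the formula for which: 0 lies below 1 and 2,
  and these lie below 3. Upward closed sets give submodules of P, and convex sets give
  subquotients.\<close>

definition convex :: "nat set \<Rightarrow> bool" where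
  "convex I \<longleftrightarrow> I \<subseteq> {0, 1, 2, 3} \<and> (0 \<in> I \<and> 3 \<in> I \<longrightarrow> 1 \<in> I \<and> 2 \<in> I)"

lemma convex_sets [simp]:
  "convex {0, 1, 2, 3}" "convex {0, 1}" "convex {2, 3}" "convex {0}" "convex {1}" "convex {2}" "convex {3}"
  "convex {1, 2}" "convex {1, 2, 3}" "convex {0, 1, 2}"
  by (auto simp: convex_def)

text \<open>The simplifier rewrites \<open>1\<close> to \<open>Suc 0\<close>, so the facts are
  supplied in that form as well.\<close>

lemmas convex_sets_Suc [simp] = convex_sets [unfolded One_nat_def]

lemma rho_rho:
  assumes g: "g \<in> carrier G" and h: "h \<in> carrier G"
  shows "rho j g (rho j h m) = rho j (g \<otimes> h) m"
proof
  fix i :: nat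
  consider "i = 0" | "i = 1" | "i = 2" | "i = 3" | "i \<notin> {0, 1, 2, 3}" by auto
  then show "rho j g (rho j h m) i = rho j (g \<otimes> h) m i"
    by cases (use g h in \<open>simp_all add: rho_def chi_mult beta_mult power_mult_distrib algebra_simps\<close>)
qed

text \<open>By convexity, a moment outside \<open>I\<close> that receives something from
  \<open>I\<close> contributes nothing back to \<open>I\<close>; hence truncating between two
  actions loses nothing.\<close>

lemma rho_trunc:
  assumes I: "convex I" and m: "\<And>i. i \<notin> I \<Longrightarrow> m i = 0" and i: "i \<in> I"
  shows "rho j g (trunc I (rho j h m)) i = rho j g (rho j h m) i"
proof -
  have I3: "0 \<in> I \<Longrightarrow> 3 \<in> I \<Longrightarrow> 1 \<in> I \<and> 2 \<in> I" using I by (auto simp: convex_def)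
  have zero: "rho j h m 0 = 0" if "0 \<notin> I" using m[OF that] by (simp add: rho_def)
  have one: "rho j h m 1 = 0" if "1 \<notin> I" "0 \<notin> I" using m that by (simp add: rho_def)
  have two: "rho j h m 2 = 0" if "2 \<notin> I" "0 \<notin> I" using m that by (simp add: rho_def)
  have t: "trunc I (rho j h m) l = rho j h m l" if "l \<in> I \<or> rho j h m l = 0" for l
    using that by (auto simp: trunc_def)
  consider "i = 0" | "i = 1" | "i = 2" | "i = 3" | "i \<notin> {0, 1, 2, 3}" by auto
  then show ?thesis
  proof cases
    case 4
    then have "trunc I (rho j h m) l = rho j h m l" if "l \<in> {0, 1, 2, 3}" for l
      using that i I3 zero one two by (intro t) auto
    then show ?thesis unfolding rho_def[of j g] by simp
  next
    case 2
    then have "trunc I (rho j h m) l = rho j h m l" if "l \<in> {0, 1}" for l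
      using that i zero by (intro t) auto
    with 2 show ?thesis unfolding rho_def[of j g] by simp
  next
    case 3
    then have "trunc I (rho j h m) l = rho j h m l" if "l \<in> {0, 2}" for l
      using that i zero by (intro t) auto
    with 3 show ?thesis unfolding rho_def[of j g] by simp
  qed (use i in \<open>simp_all add: rho_def[of j g] trunc_def\<close>)
qed

lemma D_simps:
  "carrier (D j I) = {m. \<forall>i. i \<notin> I \<longrightarrow> m i = 0}"
  "\<zero>\<^bsub>D j I\<^esub> = (\<lambda>i. 0)"
  "m \<oplus>\<^bsub>D j I\<^esub> n = (\<lambda>i. m i + n i)"
  by (simp_all add: D_def rep_module_def vec_def)

lemma
  assumes I: "convex I"
  shows D_md: "md (D j I)"
    and D_sc: "m \<in> carrier (D j I) \<Longrightarrow> sc (D j I) c m = (\<lambda>i. c * m i)"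
    and D_ac: "m \<in> carrier (D j I) \<Longrightarrow> g \<in> carrier G \<Longrightarrow> ac (D j I) g m = trunc I (rho j g m)"
proof -
  let ?s = "\<lambda>c m i. c * m i" and ?r = "\<lambda>g m. trunc I (rho j g m)"
  have B: "abelian_group (vec I)"
  proof (rule abelian_groupI)
    fix m assume "m \<in> carrier (vec I)"
    then show "\<exists>n\<in>carrier (vec I). n \<oplus>\<^bsub>vec I\<^esub> m = \<zero>\<^bsub>vec I\<^esub>"
      by (intro bexI[of _ m]) (auto simp: vec_def)
  qed (auto simp: vec_def add_ac)
  have 1: "\<And>c x. x \<in> carrier (vec I) \<Longrightarrow> ?s c x \<in> carrier (vec I)"
    "\<And>c d x. x \<in> carrier (vec I) \<Longrightarrow> ?s (c + d) x = ?s c x \<oplus>\<^bsub>vec I\<^esub> ?s d x"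
    "\<And>c x y. x \<in> carrier (vec I) \<Longrightarrow> y \<in> carrier (vec I) \<Longrightarrow> ?s c (x \<oplus>\<^bsub>vec I\<^esub> y) = ?s c x \<oplus>\<^bsub>vec I\<^esub> ?s c y"
    "\<And>c d x. x \<in> carrier (vec I) \<Longrightarrow> ?s c (?s d x) = ?s (c * d) x"
    "\<And>x. x \<in> carrier (vec I) \<Longrightarrow> ?s 1 x = x"
    by (auto simp: vec_def algebra_simps)
  have 2: "\<And>g x. g \<in> carrier G \<Longrightarrow> x \<in> carrier (vec I) \<Longrightarrow> ?r g x \<in> carrier (vec I)"
    "\<And>g x y. g \<in> carrier G \<Longrightarrow> x \<in> carrier (vec I) \<Longrightarrow> y \<in> carrier (vec I) \<Longrightarrow> ?r g (x \<oplus>\<^bsub>vec I\<^esub> y) = ?r g x \<oplus>\<^bsub>vec I\<^esub> ?r g y"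
    "\<And>g c x. g \<in> carrier G \<Longrightarrow> x \<in> carrier (vec I) \<Longrightarrow> ?r g (?s c x) = ?s c (?r g x)"
    by (auto simp: vec_def trunc_def rho_def algebra_simps fun_eq_iff)
  have 3: "?r g (?r h x) = ?r (g \<otimes> h) x" if "g \<in> carrier G" "h \<in> carrier G" "x \<in> carrier (vec I)" for g h x
  proof
    fix i :: nat
    show "?r g (?r h x) i = ?r (g \<otimes> h) x i"
    proof (cases "i \<in> I")
      case True
      then have "rho j g (trunc I (rho j h x)) i = rho j g (rho j h x) i"
        using that by (intro rho_trunc[OF I]) (auto simp: vec_def)
      then show ?thesis using True by (simp add: rho_rho[OF that(1,2)] trunc_def)
    qed (simp add: trunc_def)
  qed
  have 4: "?r \<one> x = x" if "x \<in> carrier (vec I)" for x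
  proof
    fix i :: nat
    show "?r \<one> x i = x i"
      using that I by (cases "i \<in> I") (auto simp: vec_def trunc_def rho_def convex_def)
  qed
  show "md (D j I)"
    unfolding D_def by (rule rep_module_md[OF B 1 2 3 4])
  show "sc (D j I) c m = ?s c m" if "m \<in> carrier (D j I)"
    unfolding D_def using that by (intro rep_module_sc[OF B 1 2 3 4]) (simp_all add: D_simps vec_def)
  show "ac (D j I) g m = ?r g m" if "m \<in> carrier (D j I)" "g \<in> carrier G"
    unfolding D_def using that by (intro rep_module_ac[OF B 1 2 3 4]) (simp_all add: D_simps vec_def)
qed

lemma D_periodic: "D (j + 3) I = D j I"
proof -
  have "rho (j + 3) = rho j"
    by (auto simp: rho_def fun_eq_iff power_add)
  then show ?thesis by (simp add: D_def)
qed

lemma D_homI: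
  assumes "convex I" "convex I'"
    and cl: "\<And>m. m \<in> carrier (D j I) \<Longrightarrow> F m \<in> carrier (D j' I')"
    and "\<And>m n. m \<in> carrier (D j I) \<Longrightarrow> n \<in> carrier (D j I) \<Longrightarrow> F (\<lambda>i. m i + n i) = (\<lambda>i. F m i + F n i)"
    and "\<And>c m. m \<in> carrier (D j I) \<Longrightarrow> F (\<lambda>i. c * m i) = (\<lambda>i. c * F m i)"
    and "\<And>g m. g \<in> carrier G \<Longrightarrow> m \<in> carrier (D j I) \<Longrightarrow>
      F (trunc I (rho j g m)) = trunc I' (rho j' g (F m))"
  shows "F \<in> Hom (D j I) (D j' I')"
proof (rule hom_LinI[OF _ _ LinI])
  show "F (sc (D j I) c m) = sc (D j' I') c (F m)" if "m \<in> carrier (D j I)" for c m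
    using assms that by (simp add: D_sc)
  show "F (ac (D j I) g m) = ac (D j' I') g (F m)" if "g \<in> carrier G" "m \<in> carrier (D j I)" for g m
    using assms that by (simp add: D_ac)
  show "F (m \<oplus>\<^bsub>D j I\<^esub> n) = F m \<oplus>\<^bsub>D j' I'\<^esub> F n" if "m \<in> carrier (D j I)" "n \<in> carrier (D j I)" for m n
    using assms that by (simp add: D_simps(3))
qed (use assms in \<open>auto simp: D_md\<close>)

text \<open>The hypotheses \<open>up\<close> say that \<open>J\<close> is upward closed in
  \<open>I\<close>, which is what makes its span a submodule and truncation to the complement
  equivariant.\<close>

lemma D_ses:
  assumes I: "convex I" and J: "convex J" "J \<subseteq> I" and Q: "convex Q" "Q = I - J"
    and up: "0 \<in> J \<Longrightarrow> I \<subseteq> J" "1 \<in> J \<or> 2 \<in> J \<Longrightarrow> 3 \<in> I \<Longrightarrow> 3 \<in> J"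
  shows "short_exact_sequence R (D j J) (D j I) (D j Q) id (trunc Q)"
  unfolding short_exact_sequence_def
proof (intro conjI)
  have up0: "Q = {}" if "0 \<in> J" using up(1) that Q by auto
  have I4: "I \<subseteq> {0, 1, 2, 3}" using I by (simp add: convex_def)
  show "id \<in> Hom (D j J) (D j I)"
  proof (rule D_homI[OF J(1) I])
    fix g m assume m: "m \<in> carrier (D j J)"
    have m': "m i = 0" if "i \<notin> J" for i using m that by (simp add: D_simps)
    have "rho j g m i = 0" if i: "i \<in> I" "i \<notin> J" for i
    proof -
      have "0 \<notin> J" using up(1) i by auto
      moreover have "1 \<notin> J" "2 \<notin> J" if "i = 3" using up(2) i that by auto
      ultimately show ?thesis using m' i by (auto simp: rho_def)
    qed
    then show "id (trunc J (rho j g m)) = trunc I (rho j g (id m))"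
      using J(2) by (auto simp: trunc_def fun_eq_iff)
  qed (use J(2) in \<open>auto simp: D_simps\<close>)
  show "trunc Q \<in> Hom (D j I) (D j Q)"
  proof (rule D_homI[OF I Q(1)])
    fix g m assume m: "m \<in> carrier (D j I)"
    have m': "m i = 0" if "i \<notin> I" for i using m that by (simp add: D_simps)
    have "rho j g (trunc Q m) i = rho j g m i" if i: "i \<in> Q" for i
    proof -
      have t: "trunc Q m l = m l" if "l \<notin> J" for l using that m' Q by (auto simp: trunc_def)
      have "0 \<notin> J" using up0 i by auto
      moreover have "1 \<notin> J" "2 \<notin> J" if "i = 3" using up(2) i that Q by auto
      moreover have "i \<notin> J" using i Q by auto
      ultimately show ?thesis using t by (auto simp: rho_def)
    qed
    then show "trunc Q (trunc I (rho j g m)) = trunc Q (rho j g (trunc Q m))"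
      using Q(2) by (auto simp: trunc_def fun_eq_iff)
  qed (auto simp: D_simps trunc_def fun_eq_iff)
  have "trunc Q m = (\<lambda>i. 0) \<longleftrightarrow> m \<in> carrier (D j J)" if "m \<in> carrier (D j I)" for m
    using that Q by (auto simp: D_simps trunc_def fun_eq_iff)
  then show "id ` carrier (D j J) = a_kernel (D j I) (D j Q) (trunc Q)"
    using J(2) by (auto simp: a_kernel_def' D_simps)
  show "trunc Q ` carrier (D j I) = carrier (D j Q)"
  proof (intro equalityI subsetI)
    fix m assume m: "m \<in> carrier (D j Q)"
    then have "m = trunc Q m" "m \<in> carrier (D j I)" using Q by (auto simp: D_simps trunc_def fun_eq_iff)
    then show "m \<in> trunc Q ` carrier (D j I)" by blast
  qed (auto simp: D_simps trunc_def)
qed (use assms in \<open>auto simp: D_md\<close>)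

definition shift :: "(nat \<Rightarrow> 'k) \<Rightarrow> nat \<Rightarrow> 'k" where
  "shift m = (\<lambda>i. if i = 2 then m 0 else if i = 3 then m 1 else 0)"

text \<open>Moment 2 enters moment 3 by the formula by which moment 0 enters moment 1, up to the
  factor \<chi>^2. Thus the kernel \<open>{2, 3}\<close> of P \<rightarrow> L is L twisted by
  \<chi>^2, which is the periodicity of L.\<close>

lemma L_ses:
  "short_exact_sequence R (D (j + 2) {0, 1}) (D j {0, 1, 2, 3}) (D j {0, 1}) shift (trunc {0, 1})"
proof -
  have *: "short_exact_sequence R (D j {2, 3}) (D j {0, 1, 2, 3}) (D j {0, 1}) id (trunc {0, 1})"
    by (rule D_ses) auto
  have "shift \<in> Hom (D (j + 2) {0, 1}) (D j {0, 1, 2, 3})"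
    by (rule D_homI) (auto simp: D_simps shift_def trunc_def rho_def fun_eq_iff power_add power2_eq_square algebra_simps)
  moreover have "inj_on shift (carrier (D (j + 2) {0, 1}))"
  proof (rule inj_onI)
    fix m n assume mn: "m \<in> carrier (D (j + 2) {0, 1})" "n \<in> carrier (D (j + 2) {0, 1})" "shift m = shift n"
    have "m 0 = n 0" "m 1 = n 1"
      using fun_cong[OF mn(3), of 2] fun_cong[OF mn(3), of 3] by (simp_all add: shift_def)
    show "m = n"
    proof
      fix i show "m i = n i"
        using mn(1,2) \<open>m 0 = n 0\<close> \<open>m 1 = n 1\<close> by (cases "i \<in> {0, 1}") (auto simp: D_simps)
    qed
  qed
  moreover have "shift ` carrier (D (j + 2) {0, 1}) = id ` carrier (D j {2, 3})"
  proof (intro equalityI subsetI)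
    fix m assume m: "m \<in> id ` carrier (D j {2, 3})"
    define n where "n = (\<lambda>i::nat. if i = 0 then m 2 else if i = 1 then m 3 else 0)"
    have "m = shift n" using m by (auto simp: n_def D_simps shift_def fun_eq_iff)
    moreover have "n \<in> carrier (D (j + 2) {0, 1})" by (auto simp: n_def D_simps)
    ultimately show "m \<in> shift ` carrier (D (j + 2) {0, 1})" by blast
  qed (auto simp: D_simps shift_def)
  ultimately show ?thesis
    using * D_md[of "{0, 1}" "j + 2"] by (simp add: short_exact_sequence_def)
qed

text \<open>On L only the entry at 1 is nonzero. The entry at 3 extends the map to P so that it is
  compatible with the exact sequences of \<open>L_ses\<close>; the map induced on the kernels is
  again \<open>phi\<close>, which is therefore its own image under \<Omega>.\<close>

definition phi :: "(nat \<Rightarrow> 'k) \<Rightarrow> nat \<Rightarrow> 'k" where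
  "phi m = (\<lambda>i. if i = 1 then m 0 else if i = 3 then m 2 else 0)"

lemma phi_hom: "phi \<in> Hom (D j {0, 1}) (D (j + 2) {0, 1})"
  and phi_hom': "phi \<in> Hom (D j {0, 1, 2, 3}) (D (j + 2) {0, 1, 2, 3})"
  by (rule D_homI; auto simp: D_simps phi_def trunc_def rho_def fun_eq_iff power_add power2_eq_square algebra_simps)+

lemma sum_V: "(\<Sum>v\<in>V. f (\<beta> v)) = f 0 + (f 1 + (f \<omega> + (f (\<omega> + 1) :: 'k)))"
proof -
  have "(\<Sum>v\<in>V. f (\<beta> v)) = sum f {0, 1, \<omega>, \<omega> ^ 2}"
    by (rule sum.reindex_bij_betw[OF bij_V])
  then show ?thesis using omega by simp
qed

lemma D_finsum_apply:
  assumes I: "convex I" and "finite S" "\<And>x. x \<in> S \<Longrightarrow> F x \<in> carrier (D j I)"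
  shows "(\<Oplus>\<^bsub>D j I\<^esub>x\<in>S. F x) i = (\<Sum>x\<in>S. F x i)"
proof -
  interpret abelian_group "D j I" using D_md[OF I] by (rule md_abelian_group)
  show ?thesis using assms(2,3)
  proof (induction S rule: finite_induct)
    case (insert x S)
    have "F \<in> S \<rightarrow> carrier (D j I)" "F x \<in> carrier (D j I)" using insert by auto
    then have "(\<Oplus>\<^bsub>D j I\<^esub>x\<in>insert x S. F x) = F x \<oplus>\<^bsub>D j I\<^esub> (\<Oplus>\<^bsub>D j I\<^esub>x\<in>S. F x)"
      using insert by (intro finsum_insert) auto
    then show ?case using insert by (simp add: D_simps(3))
  qed (simp add: D_simps)
qed

lemma rho_V: "v \<in> V \<Longrightarrow> rho j v m = (\<lambda>i. if i = 0 then m 0 else if i = 1 then m 1 + \<beta> v * m 0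
    else if i = 2 then m 2 + \<beta> v * \<beta> v * m 0
    else if i = 3 then m 3 + \<beta> v * m 2 + \<beta> v * \<beta> v * m 1 + \<beta> v * \<beta> v * \<beta> v * m 0 else 0)"
  by (auto simp: rho_def fun_eq_iff)

lemma beta_inv_V: "v \<in> V \<Longrightarrow> \<beta> (inv v) = \<beta> v"
  by (simp add: beta_inv)

lemma D_projective:
  obtains h where "h \<in> Lin (D j {0, 1, 2, 3}) (D j {0, 1, 2, 3})"
    "\<And>m. m \<in> carrier (D j {0, 1, 2, 3}) \<Longrightarrow> tr (D j {0, 1, 2, 3}) (D j {0, 1, 2, 3}) h m = m"
proof -
  let ?P = "D j {0, 1, 2, 3}"
  \<comment> \<open>In terms of the measure \<mu> this is the projection to the point mass at 0: 1 -
    x^3 is the indicator function of 0, so the mass there is \<open>m 0 + m 3\<close>, and the point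
    mass at 0 has moments 1, 0, 0, 0. Its four translates add up to the identity.\<close>
  define h :: "(nat \<Rightarrow> 'k) \<Rightarrow> nat \<Rightarrow> 'k" where "h m = (\<lambda>i. if i = 0 then m 0 + m 3 else 0)" for m
  have P: "md ?P" by (simp add: D_md)
  have h: "h \<in> Lin ?P ?P"
    by (rule LinI) (auto simp: D_sc D_simps h_def fun_eq_iff algebra_simps)
  have "trV ?P ?P h m = id m" if m: "m \<in> carrier ?P" for m
  proof
    fix i :: nat
    define F where "F b = (let s = m 0 + (m 3 + b * m 2 + b * b * m 1 + b * b * b * m 0) in
        if i = 0 then s else if i = 1 then b * s else if i = 2 then b * b * s
        else if i = 3 then b * b * b * s else 0)" for b
    have c: "h (ac ?P (inv v) m) \<in> carrier ?P" if "v \<in> V" for v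
      using P m that by (intro Lin_closed[OF h]) simp
    have "trV ?P ?P h m i = (\<Sum>v\<in>V. ac ?P v (h (ac ?P (inv v) m)) i)"
      unfolding rel_tr_def using P c by (intro D_finsum_apply) auto
    also have "\<dots> = (\<Sum>v\<in>V. trunc {0, 1, 2, 3} (rho j v (h (trunc {0, 1, 2, 3} (rho j (inv v) m)))) i)"
      using c m by (intro sum.cong) (auto simp: D_ac)
    also have "\<dots> = (\<Sum>v\<in>V. F (\<beta> v))"
      by (intro sum.cong) (auto simp: trunc_def rho_V h_def beta_inv_V F_def Let_def)
    also have "\<dots> = F 0 + (F 1 + (F \<omega> + F (\<omega> + 1)))"
      by (rule sum_V)
    also have "\<dots> = m i"
      using m by (auto simp: D_simps F_def Let_def algebra_simps)
    finally show "trV ?P ?P h m i = id m i" by simp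
  qed
  then have "id m = tr ?P ?P h m" if "m \<in> carrier ?P" for m
    using hom_trV_tr[OF P P h hom_id that] by auto
  then show thesis using h by (intro that) auto
qed

text \<open>Each coordinate of a conjugate is a polynomial of degree at most 2 in b = \<beta> v, the
  action contributing one factor b on either side. The power sums of exponents 0, 1, 2 over the
  field with four elements vanish.\<close>

lemma trV_L_zero:
  assumes h: "h \<in> Lin (D j {0, 1}) (D j' {0, 1})" and m: "m \<in> carrier (D j {0, 1})"
  shows "trV (D j {0, 1}) (D j' {0, 1}) h m = (\<lambda>i. 0)"
proof
  fix i :: nat
  let ?M = "D j {0, 1}" and ?N = "D j' {0, 1}"
  have M: "md ?M" and N: "md ?N" by (simp_all add: D_md)
  define e :: "nat \<Rightarrow> 'k" where "e = (\<lambda>i. if i = 1 then 1 else 0)"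
  define F where "F b = (if i = 0 then h m 0 + b * m 0 * h e 0
      else if i = 1 then h m 1 + b * m 0 * h e 1 + b * (h m 0 + b * m 0 * h e 0) else 0)" for b
  have e: "e \<in> carrier ?M" by (simp add: D_simps e_def)
  have he: "h e \<in> carrier ?N" and hm: "h m \<in> carrier ?N" using h e m by (auto simp: Lin_closed)
  have h_ac: "h (ac ?M (inv v) m) = (\<lambda>i. h m i + \<beta> v * m 0 * h e i)" if v: "v \<in> V" for v
  proof -
    have "ac ?M (inv v) m = m \<oplus>\<^bsub>?M\<^esub> sc ?M (\<beta> v * m 0) e"
      using m e v by (auto simp: D_ac D_sc D_simps trunc_def rho_V beta_inv_V e_def fun_eq_iff)
    then have "h (ac ?M (inv v) m) = h m \<oplus>\<^bsub>?N\<^esub> sc ?N (\<beta> v * m 0) (h e)"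
      using M m e h by (simp add: Lin_add Lin_sc)
    then show ?thesis using he by (simp add: D_sc D_simps(3))
  qed
  have c: "h (ac ?M (inv v) m) \<in> carrier ?N" if "v \<in> V" for v
    using M m that by (intro Lin_closed[OF h]) simp
  have "trV ?M ?N h m i = (\<Sum>v\<in>V. ac ?N v (h (ac ?M (inv v) m)) i)"
    unfolding rel_tr_def using N c by (intro D_finsum_apply) auto
  also have "\<dots> = (\<Sum>v\<in>V. trunc {0, 1} (rho j' v (\<lambda>i. h m i + \<beta> v * m 0 * h e i)) i)"
  proof (rule sum.cong[OF refl])
    fix v assume v: "v \<in> V"
    show "ac ?N v (h (ac ?M (inv v) m)) i = trunc {0, 1} (rho j' v (\<lambda>i. h m i + \<beta> v * m 0 * h e i)) i"
      using D_ac[OF convex_sets(2) c[OF v] V_carrier[OF v]] h_ac[OF v] by simp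
  qed
  also have "\<dots> = (\<Sum>v\<in>V. F (\<beta> v))"
    by (intro sum.cong) (auto simp: trunc_def rho_V F_def)
  also have "\<dots> = F 0 + (F 1 + (F \<omega> + F (\<omega> + 1)))"
    by (rule sum_V)
  also have "\<dots> = 0"
    by (auto simp: F_def algebra_simps)
  finally show "trV ?M ?N h m i = 0" .
qed

lemma tr_L_zero:
  assumes h: "h \<in> Lin (D j {0, 1}) (D j' {0, 1})" and m: "m \<in> carrier (D j {0, 1})"
  shows "tr (D j {0, 1}) (D j' {0, 1}) h m = (\<lambda>i. 0)"
proof -
  let ?M = "D j {0, 1}" and ?N = "D j' {0, 1}"
  have M: "md ?M" and N: "md ?N" by (simp_all add: D_md)
  interpret N: abelian_group ?N using N by (rule md_abelian_group)
  have "tr ?M ?N h m = (\<Oplus>\<^bsub>?N\<^esub>c\<in>C. \<zero>\<^bsub>?N\<^esub>)"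
    unfolding tr_eq_trV[OF M N h m]
  proof (rule N.finsum_cong'[OF refl])
    fix c assume c: "c \<in> C"
    have "trV ?M ?N h (ac ?M (inv c) m) = \<zero>\<^bsub>?N\<^esub>"
      unfolding D_simps using M m c by (intro trV_L_zero[OF h]) simp
    then show "ac ?N c (trV ?M ?N h (ac ?M (inv c) m)) = \<zero>\<^bsub>?N\<^esub>" using N c by simp
  qed (rule Pi_I, rule N.zero_closed)
  also have "\<dots> = \<zero>\<^bsub>?N\<^esub>" by (rule N.finsum_zero)
  finally show ?thesis unfolding D_simps(2) .
qed

end

section \<open>Exact sequences, triangles and thick subcategories in the universe\<close>

lemma short_exact_sequence_transport:
  assumes ses: "short_exact_sequence R A B C f g"
    and A: "\<And>x. x \<in> carrier A \<Longrightarrow> J' (J x) = x" and B: "\<And>x. x \<in> carrier B \<Longrightarrow> J' (J x) = x"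
    and C: "\<And>x. x \<in> carrier C \<Longrightarrow> J' (J x) = x"
  shows "short_exact_sequence R (transport J J' A) (transport J J' B) (transport J J' C) (J \<circ> f \<circ> J') (J \<circ> g \<circ> J')"
proof -
  note s = short_exact_sequenceD[OF ses]
  have fB: "f x \<in> carrier B" if "x \<in> carrier A" for x using hom_closed[OF s(4) that] .
  have gC: "g x \<in> carrier C" if "x \<in> carrier B" for x using hom_closed[OF s(5) that] .
  interpret C: left_module R C by (rule s(3))
  have "J (g x) = J \<zero>\<^bsub>C\<^esub> \<longleftrightarrow> x \<in> f ` carrier A" if "x \<in> carrier B" for x
    using s(8)[OF that] C gC[OF that] C.M.zero_closed by metis
  then have ker: "(J \<circ> f \<circ> J') ` carrier (transport J J' A) = a_kernel (transport J J' B) (transport J J' C) (J \<circ> g \<circ> J')"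
    using fB by (auto simp: a_kernel_def' transport_simps A B image_iff)
  have inj: "inj_on (J \<circ> f \<circ> J') (carrier (transport J J' A))"
  proof (rule inj_onI)
    fix x y assume xy: "x \<in> carrier (transport J J' A)" "y \<in> carrier (transport J J' A)"
      "(J \<circ> f \<circ> J') x = (J \<circ> f \<circ> J') y"
    then obtain u v where uv: "u \<in> carrier A" "v \<in> carrier A" "x = J u" "y = J v"
      by (auto simp: transport_simps)
    then have "J (f u) = J (f v)" using xy(3) A by simp
    then have "f u = f v" using B[OF fB[OF uv(1)]] B[OF fB[OF uv(2)]] by metis
    then show "x = y" using inj_onD[OF s(6)] uv by blast
  qed
  have surj: "(J \<circ> g \<circ> J') ` carrier (transport J J' B) = carrier (transport J J' C)"
    by (simp add: transport_simps image_image B s(7)[symmetric] cong: image_cong)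
  have "J' \<in> left_module_hom R (transport J J' A) A" "J' \<in> left_module_hom R (transport J J' B) B"
    "J \<in> left_module_hom R B (transport J J' B)" "J \<in> left_module_hom R C (transport J J' C)"
    by (rule transport_hom[OF s(1)] transport_hom[OF s(2)] transport_hom[OF s(3)]; use A B C in blast)+
  from hom_comp[OF this(1) hom_comp[OF s(4) this(3)]] hom_comp[OF this(2) hom_comp[OF s(5) this(4)]]
  have "J \<circ> f \<circ> J' \<in> left_module_hom R (transport J J' A) (transport J J' B)"
    "J \<circ> g \<circ> J' \<in> left_module_hom R (transport J J' B) (transport J J' C)"
    by (simp_all add: comp_assoc)
  moreover have "left_module R (transport J J' A)" "left_module R (transport J J' B)" "left_module R (transport J J' C)"
    by (rule left_module_transport[OF s(1)] left_module_transport[OF s(2)] left_module_transport[OF s(3)];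
        use A B C in blast)+
  ultimately show ?thesis
    unfolding short_exact_sequence_def using ker inj surj by simp
qed

lemma is_syzygyI: "projective_module R P \<Longrightarrow> short_exact_sequence R X' P X i p \<Longrightarrow> is_syzygy R X X'"
  unfolding is_syzygy_def by blast

lemma relpowp_invariant:
  assumes "(P ^^ n) x y" "\<And>x y. P x y \<Longrightarrow> Q x \<longleftrightarrow> Q y"
  shows "Q x \<longleftrightarrow> Q y"
  using assms by (induction n arbitrary: y) (auto elim!: relcomppE)

context finite_group_universe
begin

lemma stably_zero_zero:
  fixes M N :: "('g \<Rightarrow> 'k, 'u) module"
  assumes M: "md M" and N: "md N" and f: "\<And>x. x \<in> carrier M \<Longrightarrow> f x = \<zero>\<^bsub>N\<^esub>"
  shows "stably_zero R M N f"
proof -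
  interpret N: abelian_group N using N by (rule md_abelian_group)
  have h: "(\<lambda>x. \<zero>\<^bsub>N\<^esub>) \<in> Lin M N" by (rule LinI) (use N in auto)
  have "tr M N (\<lambda>x. \<zero>\<^bsub>N\<^esub>) x = (\<Oplus>\<^bsub>N\<^esub>g\<in>carrier G. \<zero>\<^bsub>N\<^esub>)" for x
    unfolding rel_tr_def using N by (intro N.finsum_cong') auto
  then have "tr M N (\<lambda>x. \<zero>\<^bsub>N\<^esub>) x = \<zero>\<^bsub>N\<^esub>" for x by simp
  then show ?thesis
    unfolding stably_zero_iff_tr[OF M N] using h f by (intro bexI[of _ "\<lambda>x. \<zero>\<^bsub>N\<^esub>"]) auto
qed

lemma stably_equal_refl:
  fixes M N :: "('g \<Rightarrow> 'k, 'u) module"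
  assumes "md M" "md N" "\<And>x. x \<in> carrier M \<Longrightarrow> f x \<in> carrier N" "\<And>x. x \<in> carrier M \<Longrightarrow> f x = g x"
  shows "stably_equal R M N f g"
  unfolding stably_equal_def using assms(1,2)
proof (rule stably_zero_zero)
  fix x assume "x \<in> carrier M"
  then show "f x \<ominus>\<^bsub>N\<^esub> g x = \<zero>\<^bsub>N\<^esub>" using assms(2-4) minus_eq_zero_iff[OF assms(2)] by metis
qed

lemma stable_isomorphism_id:
  fixes M :: "('g \<Rightarrow> 'k, 'u) module"
  shows "md M \<Longrightarrow> stable_isomorphism R M M id"
  unfolding stable_isomorphism_def
  by (intro conjI bexI[of _ id] hom_id stably_equal_refl) auto

lemma exact_triangle_of_ses:
  fixes X Y Z :: "('g \<Rightarrow> 'k, 'u) module"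
  assumes ses: "short_exact_sequence R X Y Z u v"
  shows "exact_triangle R X Y Z u v"
proof -
  note s = short_exact_sequenceD[OF ses]
  have "stably_equal R X Y (u \<circ> id) (id \<circ> u)" "stably_equal R Y Z (v \<circ> id) (id \<circ> v)"
    using s by (auto intro!: stably_equal_refl simp: hom_closed)
  then show ?thesis
    unfolding exact_triangle_def using ses s stable_isomorphism_id by blast
qed

lemma stmod_finitely_generated:
  fixes M :: "('g \<Rightarrow> 'k, 'u) module"
  shows "finitely_generated_module R M \<Longrightarrow> M \<in> stmod R"
  unfolding stmod_def using stable_isomorphism_id finitely_generated_module_def by blast

text \<open>This guarantees that \<open>Thick\<close> contains nothing but modules, which is what
  the upper bounds use about its objects.\<close>

lemma thick_all: "thick_subcategory R {M :: ('g \<Rightarrow> 'k, 'u) module. md M}"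
  by (auto simp: thick_subcategory_def is_syzygy_def short_exact_sequence_def exact_triangle_def stable_retract_def)

lemma Thick_md:
  fixes M :: "('g \<Rightarrow> 'k, 'u) module"
  assumes "M \<in> Thick R (trivial_modules G)"
  shows "md M"
proof -
  have "trivial_modules G \<subseteq> {M :: ('g \<Rightarrow> 'k, 'u) module. md M}"
    by (auto simp: trivial_modules_def)
  then show ?thesis using assms thick_all unfolding Thick_def by blast
qed

end

section \<open>Copies of the subquotients in the universe\<close>

locale affine_group_copy = affine_group G K U \<omega> \<chi> \<beta> A
  for G :: "'g monoid" (structure) and K :: "'k::field itself" and U :: "'u itself" and \<omega> \<chi> \<beta> A +
  fixes J :: "(nat \<Rightarrow> 'k) \<Rightarrow> 'u" and J' :: "'u \<Rightarrow> nat \<Rightarrow> 'k"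
  assumes J'_J: "(\<And>i. i \<notin> {0, 1, 2, 3} \<Longrightarrow> m i = 0) \<Longrightarrow> J' (J m) = m"
begin

text \<open>A single coding \<open>J\<close> serves all twists \<open>j\<close> and all index sets
  \<open>I\<close>, so that lifted maps between different subquotients compose without further
  identifications.\<close>

definition T :: "nat \<Rightarrow> nat set \<Rightarrow> ('g \<Rightarrow> 'k, 'u) module" where
  "T j I = transport J J' (D j I)"

abbreviation lift where "lift F \<equiv> J \<circ> F \<circ> J'"

lemma J'_J_D: "convex I \<Longrightarrow> m \<in> carrier (D j I) \<Longrightarrow> J' (J m) = m"
  by (rule J'_J) (auto simp: convex_def D_simps)

lemma T_md: "convex I \<Longrightarrow> md (T j I)"
  unfolding T_def by (rule left_module_transport[OF D_md]) (auto intro: J'_J_D)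

lemma T_carrier: "carrier (T j I) = J ` carrier (D j I)"
  by (simp add: T_def transport_simps)

lemma J_hom: "convex I \<Longrightarrow> J \<in> Hom (D j I) (T j I)"
  and J'_hom: "convex I \<Longrightarrow> J' \<in> Hom (T j I) (D j I)"
  unfolding T_def by (auto intro!: transport_hom D_md J'_J_D)

lemma J_J': "convex I \<Longrightarrow> x \<in> carrier (T j I) \<Longrightarrow> J (J' x) = x"
  by (auto simp: T_carrier J'_J_D)

lemma lift_hom:
  "convex I \<Longrightarrow> convex I' \<Longrightarrow> F \<in> Hom (D j I) (D j' I') \<Longrightarrow> lift F \<in> Hom (T j I) (T j' I')"
  using hom_comp[OF J'_hom hom_comp[OF _ J_hom]] by (simp add: comp_assoc)

lemma T_ses:
  assumes "short_exact_sequence R (D j I) (D j' I') (D j'' I'') f g" "convex I" "convex I'" "convex I''"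
  shows "short_exact_sequence R (T j I) (T j' I') (T j'' I'') (lift f) (lift g)"
  unfolding T_def by (rule short_exact_sequence_transport[OF assms(1)]) (use assms J'_J_D in auto)

lemma T_projective: "projective_module R (T j {0, 1, 2, 3})"
proof -
  obtain h where h: "h \<in> Lin (D j {0, 1, 2, 3}) (D j {0, 1, 2, 3})"
    "\<And>m. m \<in> carrier (D j {0, 1, 2, 3}) \<Longrightarrow> tr (D j {0, 1, 2, 3}) (D j {0, 1, 2, 3}) h m = m"
    by (rule D_projective) (assumption | rule that)+
  have c: "convex {0, 1, 2, 3}" by (rule convex_sets)
  note retract = tr_id_retract[OF D_md[OF c] T_md[OF c] h(1) _ J'_hom[OF c] J_hom[OF c]]
  have 1: "lift h \<in> Lin (T j {0, 1, 2, 3}) (T j {0, 1, 2, 3})"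
    by (rule retract(1)) (use h(2) J_J'[OF c] in blast)+
  have 2: "tr (T j {0, 1, 2, 3}) (T j {0, 1, 2, 3}) (lift h) x = x" if "x \<in> carrier (T j {0, 1, 2, 3})" for x
    by (rule retract(2)) (use h(2) J_J'[OF c] that in blast)+
  show ?thesis by (rule projective_if_tr_id[OF T_md[OF c] 1 2])
qed

lemma T_syzygy:
  assumes "convex I" "convex I'" "I \<union> I' = {0, 1, 2, 3}" "I \<inter> I' = {}" "0 \<notin> I'" "1 \<in> I' \<or> 2 \<in> I' \<Longrightarrow> 3 \<in> I'"
  shows "is_syzygy R (T j I) (T j I')"
proof -
  have "I' \<subseteq> {0, 1, 2, 3}" "I = {0, 1, 2, 3} - I'" using assms(3,4) by blast+
  then have "short_exact_sequence R (D j I') (D j {0, 1, 2, 3}) (D j I) id (trunc I)"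
    using assms(1,2,5,6) by (intro D_ses[OF convex_sets(1)]) blast+
  from T_ses[OF this assms(2) convex_sets(1) assms(1)] show ?thesis by (rule is_syzygyI[OF T_projective])
qed

lemma L_syzygy: "is_syzygy R (T j {0, 1}) (T (j + 2) {0, 1})"
  by (rule is_syzygyI[OF T_projective T_ses[OF L_ses convex_sets(2,1,2)]])

text \<open>The moments 0, 1, 2, 3 have weights 1, \<chi>, \<chi>^2 and \<chi>^3 = 1, so both the
  top and the socle of P are trivial modules.\<close>

lemma T_trivial:
  assumes "p = 0 \<or> p = 3"
  shows "T 0 {p} \<in> trivial_modules G"
proof (rule trivial_modulesI[where f = "\<lambda>x. J' x p"])
  have c: "convex {p}" using assms by auto
  have one: "p \<in> {0, 1, 2, 3}" using assms by auto
  show "md (T 0 {p})" by (rule T_md[OF c])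
  show "bij_betw (\<lambda>x. J' x p) (carrier (T 0 {p})) UNIV"
  proof (rule bij_betw_byWitness[where f' = "\<lambda>c. J (\<lambda>i. if i = p then c else 0)"])
    have e: "(\<lambda>i. if i = p then d else 0) \<in> carrier (D 0 {p})" for d by (simp add: D_simps)
    show "\<forall>x\<in>carrier (T 0 {p}). J (\<lambda>i. if i = p then J' x p else 0) = x"
    proof
      fix x assume "x \<in> carrier (T 0 {p})"
      then obtain m where m: "m \<in> carrier (D 0 {p})" "x = J m" by (auto simp: T_carrier)
      then have "(\<lambda>i. if i = p then m p else 0) = m" by (auto simp: D_simps)
      moreover have "J' x = m" using m J'_J_D[OF c] by simp
      ultimately show "J (\<lambda>i. if i = p then J' x p else 0) = x" using m(2) by metis
    qed
    show "\<forall>d\<in>UNIV. J' (J (\<lambda>i. if i = p then d else 0)) p = d"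
      using J'_J_D[OF c e] by simp
    show "(\<lambda>d. J (\<lambda>i. if i = p then d else 0)) ` UNIV \<subseteq> carrier (T 0 {p})"
      using e by (auto simp: T_carrier)
  qed auto
  have J'c: "J' x \<in> carrier (D 0 {p})" if "x \<in> carrier (T 0 {p})" for x
    by (rule hom_closed[OF J'_hom[OF c] that])
  show "J' (x \<oplus>\<^bsub>T 0 {p}\<^esub> y) p = J' x p + J' y p" if "x \<in> carrier (T 0 {p})" "y \<in> carrier (T 0 {p})" for x y
    using that by (simp add: hom_add[OF J'_hom[OF c]] D_simps(3))
  show "J' (sc (T 0 {p}) d x) p = d * J' x p" if "x \<in> carrier (T 0 {p})" for d x
    using that J'c by (simp add: hom_sc[OF J'_hom[OF c]] D_sc[OF c])
  show "ac (T 0 {p}) g x = x" if g: "g \<in> carrier G" and x: "x \<in> carrier (T 0 {p})" for g x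
  proof -
    have "J' (ac (T 0 {p}) g x) = trunc {p} (rho 0 g (J' x))"
      using g x J'c by (simp add: hom_ac[OF J'_hom[OF c]] D_ac[OF c])
    also have "\<dots> = J' x"
      using J'c[OF x] assms g by (auto simp: D_simps trunc_def rho_def fun_eq_iff)
    finally have "J (J' (ac (T 0 {p}) g x)) = J (J' x)" by simp
    then show ?thesis using J_J'[OF c x] J_J'[OF c ac_closed[OF T_md[OF c] g x]] by simp
  qed
qed

subsection \<open>A nonzero ghost\<close>

text \<open>By Higman's criterion \<open>phi\<close> would be a trace, and all traces between twists
  of L vanish, whereas \<open>phi\<close> takes the generator with moments 1, 0 to a nonzero
  vector.\<close>

lemma phi_not_stably_zero: "\<not> stably_zero R (T 0 {0, 1}) (T 2 {0, 1}) (lift phi)"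
proof
  let ?M = "T 0 {0, 1}" and ?N = "T 2 {0, 1}" and ?M' = "D 0 {0, 1}" and ?N' = "D 2 {0, 1}"
  have md: "md ?M" "md ?N" "md ?M'" "md ?N'" by (simp_all add: T_md D_md)
  assume "stably_zero R ?M ?N (lift phi)"
  then obtain h where h: "h \<in> Lin ?M ?N" "\<And>x. x \<in> carrier ?M \<Longrightarrow> lift phi x = tr ?M ?N h x"
    unfolding stably_zero_iff_tr[OF md(1,2)] by blast
  define m :: "nat \<Rightarrow> 'k" where "m = (\<lambda>i. if i = 0 then 1 else 0)"
  have m: "m \<in> carrier ?M'" by (simp add: D_simps m_def)
  have phi_m: "phi m \<in> carrier ?N'" by (simp add: D_simps m_def phi_def)
  have hJ: "h \<circ> J \<in> Lin ?M' ?N" by (rule Lin_comp[OF hom_Lin[OF md(3,1) J_hom] h(1)]) simp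
  have JhJ: "J' \<circ> (h \<circ> J) \<in> Lin ?M' ?N'" by (rule Lin_comp[OF hJ hom_Lin[OF md(2,4) J'_hom]]) simp
  have Jm: "J m \<in> carrier ?M" using m by (auto simp: T_carrier)
  have "phi m = J' (lift phi (J m))" using m phi_m by (simp add: J'_J_D[of "{0, 1}"])
  also have "\<dots> = J' (tr ?M ?N h (J m))" using h(2)[OF Jm] by simp
  also have "\<dots> = J' (tr ?M' ?N (h \<circ> J) m)"
    using tr_comp_hom_right[OF md(1,2,3) h(1) J_hom m] by simp
  also have "\<dots> = tr ?M' ?N' (J' \<circ> (h \<circ> J)) m"
    using tr_comp_hom_left[OF md(3,2,4) hJ J'_hom m] by simp
  also have "\<dots> = (\<lambda>i. 0)" by (rule tr_L_zero[OF JhJ m])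
  finally have "phi m 1 = 0" by simp
  then show False by (simp add: phi_def m_def)
qed

text \<open>All twists are taken together because \<Omega> changes the twist of L; in this form the
  property can be invariant under \<Omega>.\<close>

definition killed :: "('g \<Rightarrow> 'k, 'u) module \<Rightarrow> bool" where
  "killed X \<longleftrightarrow> (\<forall>j. \<forall>f\<in>Hom X (T j {0, 1}). stably_zero R X (T (j + 2) {0, 1}) (lift phi \<circ> f))"

text \<open>The map \<open>phi\<close> kills (v - 1)L. If \<open>phi \<circ> f\<close> were nonzero
  at \<open>s\<close>, then (v - 1)s would be a nonzero element of the kernel of
  \<open>phi \<circ> f\<close>, a proper submodule of a simple module. No classification of simple
  modules enters.\<close>

lemma killed_simple:
  assumes S: "simple_module R S"
  shows "killed S"
  unfolding killed_def
proof (intro allI ballI)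
  fix j f assume f: "f \<in> Hom S (T j {0, 1})"
  let ?M = "T j {0, 1}" and ?N = "T (j + 2) {0, 1}"
  have md: "md S" "md ?M" "md ?N" using S by (simp_all add: simple_module_def T_md)
  have c: "convex {0, 1}" by (rule convex_sets)
  have phiH: "lift phi \<in> Hom ?M ?N" by (rule lift_hom[OF c c phi_hom])
  have pf: "lift phi \<circ> f \<in> Hom S ?N" by (rule hom_comp[OF f phiH])
  define Z where "Z = {x \<in> carrier S. (lift phi \<circ> f) x = \<zero>\<^bsub>?N\<^esub>}"
  have "submodule Z R S" unfolding Z_def by (rule kernel_submodule[OF md(1,3) pf])
  then have Z: "Z = {\<zero>\<^bsub>S\<^esub>} \<or> Z = carrier S" using S by (simp add: simple_module_def)
  have "Z = carrier S"
  proof (rule ccontr)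
    assume ne: "Z \<noteq> carrier S"
    then obtain s where s: "s \<in> carrier S" "(lift phi \<circ> f) s \<noteq> \<zero>\<^bsub>?N\<^esub>" by (auto simp: Z_def)
    have fs: "f s \<in> carrier ?M" by (rule hom_closed[OF f s(1)])
    define m where "m = J' (f s)"
    have m: "m \<in> carrier (D j {0, 1})" unfolding m_def by (rule hom_closed[OF J'_hom[OF c] fs])
    have zN: "J (\<lambda>i. 0) = \<zero>\<^bsub>?N\<^esub>" by (simp add: T_def transport_simps D_simps)
    have m0: "m 0 \<noteq> 0"
    proof
      assume "m 0 = 0"
      then have "phi m = (\<lambda>i. 0)" using m by (auto simp: phi_def D_simps fun_eq_iff)
      then show False using s(2) zN by (simp add: m_def)
    qed
    have "1 \<in> \<beta> ` V" using bij_V by (simp add: bij_betw_def)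
    then obtain v where v: "v \<in> V" "\<beta> v = 1" by (metis imageE)
    \<comment> \<open>For the translation \<open>v\<close> by 1, \<open>f t\<close> has moment 1
      equal to \<open>m 0\<close>, which is nonzero because \<open>phi\<close> does not kill
      \<open>f s\<close>.\<close>
    define t where "t = ac S v s \<ominus>\<^bsub>S\<^esub> s"
    have tc: "t \<in> carrier S" using md s v by (simp add: t_def)
    have ft: "f t = ac ?M v (f s) \<ominus>\<^bsub>?M\<^esub> f s"
      using md s v f by (simp add: t_def hom_diff[OF md(1,2) f] hom_ac)
    have D_v: "J' (ac ?M v (f s)) = (\<lambda>i. if i = 1 then m 1 + m 0 else m i)"
    proof -
      have "J' (ac ?M v (f s)) = ac (D j {0, 1}) v m"
        unfolding m_def by (rule hom_ac[OF J'_hom[OF c] V_carrier[OF v(1)] fs])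
      also have "\<dots> = trunc {0, 1} (rho j v m)" by (rule D_ac[OF c m V_carrier[OF v(1)]])
      also have "\<dots> = (\<lambda>i. if i = 1 then m 1 + m 0 else m i)"
        using v m by (auto simp: trunc_def rho_V D_simps fun_eq_iff)
      finally show ?thesis .
    qed
    have "f t \<noteq> \<zero>\<^bsub>?M\<^esub>"
    proof
      assume "f t = \<zero>\<^bsub>?M\<^esub>"
      then have "J' (ac ?M v (f s)) = m"
        using ft md fs v by (simp add: minus_eq_zero_iff m_def)
      with D_v have "m 1 + m 0 = m 1" by metis
      then show False using m0 by simp
    qed
    then have "t \<noteq> \<zero>\<^bsub>S\<^esub>" using hom_zero[OF md(1,2) f] by auto
    moreover have "t \<in> Z"
    proof -
      have c': "(lift phi \<circ> f) s \<in> carrier ?N" by (rule hom_closed[OF pf s(1)])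
      have "phi (J' (ac ?M v (f s))) = phi m" unfolding D_v using m by (auto simp: phi_def D_simps)
      then have eq: "(lift phi \<circ> f) (ac S v s) = (lift phi \<circ> f) s"
        using v s f by (simp add: m_def hom_ac)
      have "(lift phi \<circ> f) t = (lift phi \<circ> f) (ac S v s) \<ominus>\<^bsub>?N\<^esub> (lift phi \<circ> f) s"
        unfolding t_def by (rule hom_diff[OF md(1,3) pf ac_closed[OF md(1) V_carrier[OF v(1)] s(1)] s(1)])
      also have "\<dots> = \<zero>\<^bsub>?N\<^esub>" by (simp only: eq minus_eq_zero_iff[OF md(3) c' c'])
      finally have "(lift phi \<circ> f) t = \<zero>\<^bsub>?N\<^esub>" .
      then show ?thesis using tc by (simp add: Z_def)
    qed
    ultimately show False using Z ne by blast
  qed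
  then have "(lift phi \<circ> f) x = \<zero>\<^bsub>?N\<^esub>" if "x \<in> carrier S" for x
    using that by (auto simp: Z_def)
  then show "stably_zero R S ?N (lift phi \<circ> f)" by (rule stably_zero_zero[OF md(1,3)])
qed

text \<open>Under the sequences of \<open>L_ses\<close> the map \<open>phi\<close> is its own shift,
  so \<open>shift_down\<close> and \<open>shift_up\<close> apply with a twist increased by
  2.\<close>

lemma killed_syzygy:
  assumes "is_syzygy R X X'"
  shows "killed X \<longleftrightarrow> killed X'"
proof -
  obtain P iX pX where X: "short_exact_sequence R X' P X iX pX" and P: "projective_module R P"
    using assms unfolding is_syzygy_def by blast
  have c: "convex {0, 1}" "convex {0, 1, 2, 3}" by (rule convex_sets)+
  note ses = T_ses[OF L_ses c(1,2,1)]
  have T3: "T (j + 3) I = T j I" for j I by (simp only: T_def D_periodic)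
  have T3': "T (j + 1 + 2) I = T j I" for j I using T3[of j I] by (simp add: numeral_3_eq_3)
  have phi1: "lift phi \<in> Hom (T j {0, 1}) (T (j + 2) {0, 1})" for j by (rule lift_hom[OF c(1) c(1) phi_hom])
  have phi2: "lift phi \<in> Hom (T j {0, 1, 2, 3}) (T (j + 2) {0, 1, 2, 3})" for j
    by (rule lift_hom[OF c(2) c(2) phi_hom'])
  have ci: "lift phi (lift shift x) = lift shift (lift phi x)" if "x \<in> carrier (T (j + 2) {0, 1})" for j x
  proof -
    from that obtain m where m: "m \<in> carrier (D (j + 2) {0, 1})" "x = J m" by (auto simp: T_carrier)
    have "J' (J (shift m)) = shift m" "J' (J (phi m)) = phi m"
      by (rule J'_J; auto simp: shift_def phi_def)+
    moreover have "phi (shift m) = shift (phi m)" by (auto simp: shift_def phi_def fun_eq_iff)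
    ultimately show ?thesis using m J'_J_D[OF c(1) m(1)] by simp
  qed
  have cp: "lift (trunc {0, 1}) (lift phi x) = lift phi (lift (trunc {0, 1}) x)"
    if "x \<in> carrier (T j {0, 1, 2, 3})" for j x
  proof -
    from that obtain m where m: "m \<in> carrier (D j {0, 1, 2, 3})" "x = J m" by (auto simp: T_carrier)
    have "J' (J (phi m)) = phi m" by (rule J'_J) (auto simp: phi_def)
    moreover have "J' (J (trunc {0, 1} m)) = trunc {0, 1} m" by (rule J'_J) (auto simp: trunc_def)
    moreover have "trunc {0, 1} (phi m) = phi (trunc {0, 1} m)" by (auto simp: trunc_def phi_def fun_eq_iff)
    ultimately show ?thesis using m J'_J_D[OF c(2) m(1)] by simp
  qed
  show ?thesis
  proof
    assume "killed X"
    then have zero: "stably_zero R X (T (j + 2) {0, 1}) (lift phi \<circ> f)" if "f \<in> Hom X (T j {0, 1})" for j f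
      using that by (simp add: killed_def)
    have *: "stably_zero R X' (T (j + 2 + 2) {0, 1}) (lift phi \<circ> f)" if "f \<in> Hom X' (T (j + 2) {0, 1})" for j f
      by (rule shift_down[OF X P ses[of j] T_projective ses[of "j + 2"] T_projective
            phi1[of j] phi2[of j] phi1[of "j + 2"] ci[of _ j] cp[of _ j] zero[of _ j] that])
    \<comment> \<open>Twists are periodic modulo 3, so every twist \<open>j\<close> occurs as the
      shifted twist \<open>(j + 1) + 2\<close>.\<close>
    have "stably_zero R X' (T (j + 2) {0, 1}) (lift phi \<circ> f)" if "f \<in> Hom X' (T j {0, 1})" for j f
      using *[of f "j + 1"] T3'[of j "{0, 1}"] T3'[of "j + 2" "{0, 1}"] that by (simp add: add.assoc)
    then show "killed X'" by (simp add: killed_def)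
  next
    assume "killed X'"
    then have zero: "stably_zero R X' (T (j + 2 + 2) {0, 1}) (lift phi \<circ> f)" if "f \<in> Hom X' (T (j + 2) {0, 1})" for j f
      using that unfolding killed_def by blast
    have "stably_zero R X (T (j + 2) {0, 1}) (lift phi \<circ> f)" if "f \<in> Hom X (T j {0, 1})" for j f
      by (rule shift_up[OF X P ses[of j] T_projective ses[of "j + 2"] T_projective
            phi1[of j] phi2[of j] phi1[of "j + 2"] ci[of _ j] cp[of _ j] zero[of _ j] that])
    then show "killed X" by (simp add: killed_def)
  qed
qed

lemma phi_simple_ghost:
  "is_ghost_wrt R {S. simple_module R S} (T 0 {0, 1}) (T 2 {0, 1}) (lift phi)"
  unfolding is_ghost_wrt_def
proof (intro conjI ballI allI impI)
  have c: "convex {0, 1}" by (rule convex_sets)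
  show "lift phi \<in> Hom (T 0 {0, 1}) (T 2 {0, 1})"
    using lift_hom[OF c c phi_hom[of 0]] by (simp add: numeral_2_eq_2)
  fix S X :: "('g \<Rightarrow> 'k, 'u) module" and i f
  assume S: "S \<in> {S. simple_module R S}" and X: "is_Omega R i S X" and f: "f \<in> Hom X (T 0 {0, 1})"
  have "killed S \<longleftrightarrow> killed X"
    using X relpowp_invariant[where P = "is_syzygy R" and Q = killed, OF _ killed_syzygy]
    unfolding is_Omega_def by (auto split: if_splits)
  then have "killed X" using S killed_simple by simp
  then have "stably_zero R X (T (0 + 2) {0, 1}) (lift phi \<circ> f)" using f unfolding killed_def by blast
  then show "stably_zero R X (T 2 {0, 1}) (lift phi \<circ> f)" unfolding add_0 .
qed

end

section \<open>L is finitely generated and lies in the thick subcategory of k\<close>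

context affine_group_copy
begin

lemma T_retract:
  assumes "F \<in> Hom (D j I) (D j I')" "F' \<in> Hom (D j I') (D j I)" "convex I" "convex I'"
    and "\<And>m. m \<in> carrier (D j I) \<Longrightarrow> F' (F m) = m"
  shows "stable_retract R (T j I) (T j I')"
proof -
  have "(lift F' \<circ> lift F) x = id x" if "x \<in> carrier (T j I)" for x
  proof -
    from that obtain m where m: "m \<in> carrier (D j I)" "x = J m" by (auto simp: T_carrier)
    then show ?thesis
      using J'_J_D[OF assms(3) m(1)] J'_J_D[OF assms(4) hom_closed[OF assms(1) m(1)]] assms(5) by simp
  qed
  then have "stably_equal R (T j I) (T j I) (lift F' \<circ> lift F) id"
    using T_md[OF assms(3)] by (intro stably_equal_refl) auto
  then show ?thesis
    unfolding stable_retract_def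
    using T_md[OF assms(3)] T_md[OF assms(4)] lift_hom[OF assms(3,4,1)] lift_hom[OF assms(4,3,2)] by blast
qed

text \<open>The quotient of \<Omega>k by its socle is the sum of the moments 1 and 2; it gives the
  line of moment 2 as a retract. Dividing the inverse shift of k, with moments 0, 1, 2, by this line
  leaves L.\<close>

lemma L_thick:
  assumes thick: "thick_subcategory R \<C>" and triv: "trivial_modules G \<subseteq> \<C>"
  shows "T 0 {0, 1} \<in> \<C>" "T 2 {0, 1} \<in> \<C>"
proof -
  have syz: "X' \<in> \<C>" if "X \<in> \<C>" "is_syzygy R X X'" for X X'
    using thick that unfolding thick_subcategory_def by blast
  have cosyz: "X \<in> \<C>" if "X' \<in> \<C>" "is_syzygy R X X'" for X X'
    using thick that unfolding thick_subcategory_def by blast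
  have cone: "Z \<in> \<C>" if "X \<in> \<C>" "Y \<in> \<C>" "short_exact_sequence R X Y Z u v" for X Y Z u v
    using thick that exact_triangle_of_ses unfolding thick_subcategory_def by blast
  have retract: "X \<in> \<C>" if "Y \<in> \<C>" "stable_retract R X Y" for X Y
    using thick that unfolding thick_subcategory_def by blast
  have t0: "T 0 {0} \<in> \<C>" and t3: "T 0 {3} \<in> \<C>" using T_trivial triv by blast+
  have "T 0 {1, 2, 3} \<in> \<C>" by (rule syz[OF t0 T_syzygy]) auto
  moreover have "short_exact_sequence R (D 0 {3}) (D 0 {1, 2, 3}) (D 0 {1, 2}) id (trunc {1, 2})"
    by (rule D_ses) auto
  ultimately have t12: "T 0 {1, 2} \<in> \<C>" by (rule cone[OF t3 _ T_ses]) (rule convex_sets)+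
  \<comment> \<open>Neither of the moments 1 and 2 enters the formula for the other, so each of them
    is both a submodule and a quotient. One sequence supplies the inclusion of \<open>{2}\<close>,
    the other the projection onto it.\<close>
  have "short_exact_sequence R (D 0 {2}) (D 0 {1, 2}) (D 0 {1}) id (trunc {1})"
    "short_exact_sequence R (D 0 {1}) (D 0 {1, 2}) (D 0 {2}) id (trunc {2})"
    by (rule D_ses; auto)+
  note homs = short_exact_sequenceD(4)[OF this(1)] short_exact_sequenceD(5)[OF this(2)]
  have "stable_retract R (T 0 {2}) (T 0 {1, 2})"
    by (rule T_retract[OF homs convex_sets(6) convex_sets(8)]) (auto simp: D_simps trunc_def)
  then have t2: "T 0 {2} \<in> \<C>" by (rule retract[OF t12])
  have "T 0 {0, 1, 2} \<in> \<C>" by (rule cosyz[OF t3 T_syzygy]) auto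
  moreover have "short_exact_sequence R (D 0 {2}) (D 0 {0, 1, 2}) (D 0 {0, 1}) id (trunc {0, 1})"
    by (rule D_ses) auto
  ultimately show L0: "T 0 {0, 1} \<in> \<C>" by (rule cone[OF t2 _ T_ses]) (rule convex_sets)+
  have "is_syzygy R (T 0 {0, 1}) (T 2 {0, 1})" using L_syzygy[of 0] unfolding add_0 .
  then show "T 2 {0, 1} \<in> \<C>" by (rule syz[OF L0])
qed

lemma L_finitely_generated: "finitely_generated_module R (T j {0, 1})"
  unfolding finitely_generated_module_def
proof (intro conjI exI allI impI)
  have c: "convex {0, 1}" by (rule convex_sets)
  let ?e = "\<lambda>l::nat. \<lambda>i::nat. if i = l then 1 else (0::'k)"
  let ?X = "J ` {?e 0, ?e 1}"
  show md: "md (T j {0, 1})" by (rule T_md[OF c])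
  show "finite ?X" by simp
  have e: "?e 0 \<in> carrier (D j {0, 1})" "?e 1 \<in> carrier (D j {0, 1})" by (simp_all add: D_simps)
  then show "?X \<subseteq> carrier (T j {0, 1})" by (auto simp: T_carrier)
  fix H assume H: "submodule H R (T j {0, 1}) \<and> ?X \<subseteq> H"
  then interpret H: submodule H R "T j {0, 1}" by blast
  have scH: "sc (T j {0, 1}) c y \<in> H" if "y \<in> H" for c y
    using H.smult_closed[OF delta_closed[OF one_closed] that, of c] by (simp add: sc_def)
  show "H = carrier (T j {0, 1})"
  proof (intro equalityI subsetI)
    show "x \<in> carrier (T j {0, 1})" if "x \<in> H" for x using that H.subset by auto
    fix x assume "x \<in> carrier (T j {0, 1})"
    then obtain m where m: "m \<in> carrier (D j {0, 1})" "x = J m" by (auto simp: T_carrier)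
    have "m = sc (D j {0, 1}) (m 0) (?e 0) \<oplus>\<^bsub>D j {0, 1}\<^esub> sc (D j {0, 1}) (m 1) (?e 1)"
      unfolding D_sc[OF c e(1)] D_sc[OF c e(2)] using m(1) by (auto simp: D_simps fun_eq_iff)
    then have "x = J (sc (D j {0, 1}) (m 0) (?e 0) \<oplus>\<^bsub>D j {0, 1}\<^esub> sc (D j {0, 1}) (m 1) (?e 1))"
      using m(2) by metis
    also have "\<dots> = sc (T j {0, 1}) (m 0) (J (?e 0)) \<oplus>\<^bsub>T j {0, 1}\<^esub> sc (T j {0, 1}) (m 1) (J (?e 1))"
      using hom_add[OF J_hom[OF c] sc_closed[OF D_md[OF c] e(1)] sc_closed[OF D_md[OF c] e(2)]]
        hom_sc[OF J_hom[OF c] e(1)] hom_sc[OF J_hom[OF c] e(2)] by metis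
    also have "\<dots> \<in> H"
      using H scH H.m_closed by simp
    finally show "x \<in> H" .
  qed
qed

subsection \<open>Two ghosts over the full affine group\<close>

text \<open>An eigenvector of weight \<open>\<chi>\<close> or \<open>\<chi>\<^sup>2\<close> is the image of a homogeneous element of
  \<open>\<Omega>k = D 0 {1, 2, 3}\<close>. The first ghost extends from there to the projective module, hence descends
  to \<open>\<Omega>\<^sup>-\<^sup>1k = D 0 {0, 1, 2}\<close>, where the second ghost applies.\<close>

lemma two_trivial_ghosts_eigenvector:
  fixes M N L :: "('g \<Rightarrow> 'k, 'u) module"
  assumes M: "md M" and N: "md N" and L: "md L"
    and f: "is_ghost_wrt R (trivial_modules G) M N f" and g: "is_ghost_wrt R (trivial_modules G) N L g"
    and x: "eigenvector M j x" and j: "j = 1 \<or> j = 2"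
  shows "g (f x) \<in> Nm L ` carrier L"
proof -
  let ?P = "T 0 {0, 1, 2, 3}" and ?O = "T 0 {1, 2, 3}" and ?O' = "T 0 {0, 1, 2}"
  have cP: "convex {0, 1, 2, 3}" and cO: "convex {1, 2, 3}" and cO': "convex {0, 1, 2}" by (rule convex_sets)+
  note md = T_md[OF cP] T_md[OF cO] T_md[OF cO']
  have fH: "f \<in> Hom M N" and gH: "g \<in> Hom N L" using f g by (auto simp: is_ghost_wrt_def)
  have xc: "x \<in> carrier M" and eig: "\<And>h. h \<in> carrier G \<Longrightarrow> ac M h x = sc M (\<chi> h ^ j) x"
    using x by (auto simp: eigenvector_def)
  \<comment> \<open>In \<Omega>k the moment 0 is absent, so translations leave the moment
    \<open>j\<close> unchanged and the group scales it by \<chi>^j. Reading it off is therefore an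
    equivariant map onto the line of \<open>x\<close>.\<close>
  define \<psi> where "\<psi> y = sc M (J' y j) x" for y
  have \<psi>: "\<psi> \<in> Hom ?O M"
  proof (rule hom_LinI[OF md(2) M LinI])
    have J'c: "J' y \<in> carrier (D 0 {1, 2, 3})" if "y \<in> carrier ?O" for y
      by (rule hom_closed[OF J'_hom[OF cO] that])
    show "\<psi> y \<in> carrier M" if "y \<in> carrier ?O" for y using M xc by (simp add: \<psi>_def)
    show "\<psi> (y \<oplus>\<^bsub>?O\<^esub> z) = \<psi> y \<oplus>\<^bsub>M\<^esub> \<psi> z" if "y \<in> carrier ?O" "z \<in> carrier ?O" for y z
    proof -
      have "J' (y \<oplus>\<^bsub>?O\<^esub> z) = (\<lambda>i. J' y i + J' z i)"
        unfolding hom_add[OF J'_hom[OF cO] that] by (rule D_simps(3))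
      then show ?thesis using M xc by (simp add: \<psi>_def sc_add_left)
    qed
    show "\<psi> (sc ?O c y) = sc M c (\<psi> y)" if "y \<in> carrier ?O" for c y
    proof -
      have "J' (sc ?O c y) = (\<lambda>i. c * J' y i)"
        unfolding hom_sc[OF J'_hom[OF cO] that] by (rule D_sc[OF cO J'c[OF that]])
      then show ?thesis using M xc by (simp add: \<psi>_def)
    qed
    show "\<psi> (ac ?O h y) = ac M h (\<psi> y)" if h: "h \<in> carrier G" and y: "y \<in> carrier ?O" for h y
    proof -
      have "J' (ac ?O h y) = trunc {1, 2, 3} (rho 0 h (J' y))"
        unfolding hom_ac[OF J'_hom[OF cO] h y] by (rule D_ac[OF cO J'c[OF y] h])
      moreover have "J' y 0 = 0" using J'c[OF y] by (simp add: D_simps)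
      ultimately have "J' (ac ?O h y) j = \<chi> h ^ j * J' y j"
        using j h by (auto simp: trunc_def rho_def power2_eq_square)
      then show ?thesis using M xc h eig by (simp add: \<psi>_def ac_sc mult.commute)
    qed
  qed
  have syz: "is_syzygy R (T 0 {0}) ?O" by (rule T_syzygy) auto
  have "is_Omega R 1 (T 0 {0}) ?O" using syz by (auto simp: is_Omega_def relcompp_apply)
  moreover have "T 0 {0} \<in> trivial_modules G" by (rule T_trivial) simp
  ultimately have sz: "stably_zero R ?O N (f \<circ> \<psi>)"
    using f \<psi> unfolding is_ghost_wrt_def by blast
  have ses: "short_exact_sequence R (D 0 {1, 2, 3}) (D 0 {0, 1, 2, 3}) (D 0 {0}) id (trunc {0})"
    by (rule D_ses) auto
  have i: "lift id \<in> Hom ?O ?P" "inj_on (lift id) (carrier ?O)"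
    using short_exact_sequenceD(4,6)[OF T_ses[OF ses cO cP convex_sets(4)]] .
  obtain \<theta> where \<theta>: "\<theta> \<in> Hom ?P N" "\<And>y. y \<in> carrier ?O \<Longrightarrow> \<theta> (lift id y) = (f \<circ> \<psi>) y"
    by (rule stably_zero_extend[OF md(2,1) N sz i]) (assumption | rule that)+
  have ses': "short_exact_sequence R (D 0 {3}) (D 0 {0, 1, 2, 3}) (D 0 {0, 1, 2}) id (trunc {0, 1, 2})"
    by (rule D_ses) auto
  note ses'_T = T_ses[OF ses' convex_sets(7) cP cO']
  note p = short_exact_sequenceD(5,7)[OF ses'_T]
  \<comment> \<open>The socle of P is the moment 3, which \<psi> ignores; this is what allows
    \<theta> to descend.\<close>
  have ker: "\<theta> y = \<zero>\<^bsub>N\<^esub>" if y: "y \<in> carrier ?P" "lift (trunc {0, 1, 2}) y = \<zero>\<^bsub>?O'\<^esub>" for y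
  proof -
    obtain z where z: "z \<in> carrier (T 0 {3})" "y = lift id z"
      using short_exact_sequenceD(8)[OF ses'_T y(1)] y(2) by blast
    then obtain m where m: "m \<in> carrier (D 0 {3})" "z = J m" by (auto simp: T_carrier)
    then have "z \<in> carrier ?O" by (auto simp: T_carrier D_simps)
    then have "\<theta> y = f (\<psi> z)" using \<theta>(2) z(2) by simp
    moreover have "J' z j = 0" using m J'_J_D[OF convex_sets(7) m(1)] j by (auto simp: D_simps)
    ultimately show ?thesis using M xc hom_zero[OF M N fH] by (simp add: \<psi>_def)
  qed
  obtain \<theta>' where \<theta>': "\<theta>' \<in> Hom ?O' N" "\<And>y. y \<in> carrier ?P \<Longrightarrow> \<theta>' (lift (trunc {0, 1, 2}) y) = \<theta> y"
    by (rule hom_factor_surj[OF md(1,3) N p \<theta>(1) ker]) (assumption | rule that)+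
  have syz': "is_syzygy R ?O' (T 0 {3})" by (rule T_syzygy) auto
  have "is_Omega R (-1) (T 0 {3}) ?O'" using syz' by (auto simp: is_Omega_def relcompp_apply)
  moreover have "T 0 {3} \<in> trivial_modules G" by (rule T_trivial) simp
  ultimately have "stably_zero R ?O' L (g \<circ> \<theta>')"
    using g \<theta>'(1) unfolding is_ghost_wrt_def by blast
  then obtain h where h: "h \<in> Lin ?O' L" "\<And>y. y \<in> carrier ?O' \<Longrightarrow> g (\<theta>' y) = tr ?O' L h y"
    using stably_zero_iff_tr[OF md(3) L] by auto
  define e :: "nat \<Rightarrow> 'k" where "e = (\<lambda>i. if i = j then 1 else 0)"
  have e: "e \<in> carrier (D 0 {1, 2, 3})" "e \<in> carrier (D 0 {0, 1, 2, 3})" "e \<in> carrier (D 0 {0, 1, 2})"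
    using j by (auto simp: e_def D_simps)
  have Je: "J' (J e) = e" by (rule J'_J_D[OF cP e(2)])
  have trunc_e: "trunc {0, 1, 2} e = e" using e(3) by (auto simp: trunc_def D_simps fun_eq_iff)
  have "\<theta>' (J e) = \<theta> (J e)"
    using \<theta>'(2)[of "J e"] e(2) Je trunc_e by (simp add: T_carrier)
  also have "\<dots> = f (\<psi> (J e))"
    using \<theta>(2)[of "J e"] e(1) Je by (simp add: T_carrier)
  also have "\<psi> (J e) = x" using M xc Je by (simp add: \<psi>_def e_def)
  finally have fx: "\<theta>' (J e) = f x" .
  have JeO: "J e \<in> carrier ?O'" using e(3) by (auto simp: T_carrier)
  \<comment> \<open>This is the gain from passing to \<open>?O'\<close>: translations move
    \<open>e\<close> only in moment 3, which has been divided out, so \<open>e\<close> is now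
    invariant and a trace takes it to a norm.\<close>
  have "ac ?O' v (J e) = J e" if v: "v \<in> V" for v
  proof -
    have "ac ?O' v (J e) = J (ac (D 0 {0, 1, 2}) v e)"
      using hom_ac[OF J_hom[OF cO'] V_carrier[OF v] e(3)] by simp
    also have "ac (D 0 {0, 1, 2}) v e = trunc {0, 1, 2} (rho 0 v e)"
      by (rule D_ac[OF cO' e(3) V_carrier[OF v]])
    also have "\<dots> = e" using v j by (auto simp: trunc_def rho_V e_def fun_eq_iff)
    finally show ?thesis .
  qed
  then have "J e \<in> invV ?O'" using JeO by (simp add: invV_def)
  from tr_invV[OF md(3) L h(1) this] h(2)[OF JeO] fx show ?thesis by simp
qed

text \<open>The weight-zero component of an invariant becomes a norm under the first ghost alone,
  and \<open>g\<close> preserves norms. The components of weights \<chi> and \<chi>^2 need both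
  ghosts.\<close>

lemma two_trivial_ghosts_V_ghost:
  fixes M N L :: "('g \<Rightarrow> 'k, 'u) module"
  assumes M: "md M" and N: "md N" and L: "md L"
    and f: "is_ghost_wrt R (trivial_modules G) M N f" and g: "is_ghost_wrt R (trivial_modules G) N L g"
  shows "V_ghost M L (g \<circ> f)"
  unfolding V_ghost_def
proof (intro conjI ballI)
  have fH: "f \<in> Hom M N" and gH: "g \<in> Hom N L" using f g by (auto simp: is_ghost_wrt_def)
  show gf: "g \<circ> f \<in> Hom M L" by (rule hom_comp[OF fH gH])
  fix x assume "x \<in> invV M"
  then obtain x0 x1 x2 where x: "eigenvector M 0 x0" "eigenvector M 1 x1" "eigenvector M 2 x2"
    "x = x0 \<oplus>\<^bsub>M\<^esub> (x1 \<oplus>\<^bsub>M\<^esub> x2)"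
    by (rule eigenvector_decomposition[OF M])
  have "f x0 \<in> Nm N ` carrier N"
    by (rule ghost_eigenvector[OF M N f x(1)]) (rule line_trivial[OF M x(1)])
  then obtain y where "y \<in> carrier N" "f x0 = Nm N y" by blast
  then have 0: "(g \<circ> f) x0 \<in> Nm L ` carrier L"
    using Nm_hom[OF N L gH, of y] hom_closed[OF gH, of y] by auto
  have 1: "(g \<circ> f) x1 \<in> Nm L ` carrier L" and 2: "(g \<circ> f) x2 \<in> Nm L ` carrier L"
    using two_trivial_ghosts_eigenvector[OF M N L f g x(2)] two_trivial_ghosts_eigenvector[OF M N L f g x(3)]
    by simp_all
  have "(g \<circ> f) x = (g \<circ> f) x0 \<oplus>\<^bsub>L\<^esub> ((g \<circ> f) x1 \<oplus>\<^bsub>L\<^esub> (g \<circ> f) x2)"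
    using x M hom_add[OF gf] by (simp add: eigenvector_def)
  then show "(g \<circ> f) x \<in> Nm L ` carrier L"
    using 0 1 2 by (simp only: Nm_image_add[OF L])
qed

subsection \<open>The ghost numbers\<close>

lemma ghost_number_ge_2:
  assumes L: "T 0 {0, 1} \<in> \<C>" "T 2 {0, 1} \<in> \<C>"
    and ghost: "is_ghost_wrt R \<S> (T 0 {0, 1}) (T 2 {0, 1}) (lift phi)"
  shows "2 \<le> ghost_number_wrt R \<S> \<C>"
  unfolding ghost_number_wrt_def
proof (rule Inf_greatest)
  fix e assume "e \<in> {enat n | n. \<forall>M f. (\<forall>i\<le>n. M i \<in> \<C>) \<and> (\<forall>i<n. is_ghost_wrt R \<S> (M i) (M (Suc i)) (f i)) \<longrightarrow>
     stably_zero R (M 0) (M n) (composite f n)}"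
  then obtain n where n: "e = enat n"
    and zero: "\<And>M f. (\<forall>i\<le>n. M i \<in> \<C>) \<and> (\<forall>i<n. is_ghost_wrt R \<S> (M i) (M (Suc i)) (f i)) \<Longrightarrow>
     stably_zero R (M 0) (M n) (composite f n)" by blast
  have phi: "lift phi \<in> Hom (T 0 {0, 1}) (T 2 {0, 1})" using ghost by (simp add: is_ghost_wrt_def)
  \<comment> \<open>The empty composite is the identity of L; were it stably zero, so would be
    \<open>phi\<close>, which factors through it.\<close>
  have "n \<noteq> 0"
  proof
    assume n0: "n = 0"
    have "stably_zero R (T 0 {0, 1}) (T 0 {0, 1}) id"
      using zero[of "\<lambda>_. T 0 {0, 1}"] L(1) by (simp add: n0)
    then have "stably_zero R (T 0 {0, 1}) (T 2 {0, 1}) (lift phi)"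
      by (rule stably_zero_comp[OF _ phi hom_id]) simp
    then show False using phi_not_stably_zero by blast
  qed
  moreover have "n \<noteq> 1"
  proof
    assume n1: "n = 1"
    have "stably_zero R (T 0 {0, 1}) (T 2 {0, 1}) (composite (\<lambda>_. lift phi) (Suc 0))"
      using zero[of "\<lambda>i. if i = 0 then T 0 {0, 1} else T 2 {0, 1}" "\<lambda>_. lift phi"] L ghost by (simp add: n1)
    then show False using phi_not_stably_zero by (simp add: comp_def)
  qed
  ultimately have "2 \<le> n" by simp
  then show "2 \<le> e" unfolding n by (metis enat_ord_simps(1) numeral_eq_enat)
qed

lemma ghost_number_le:
  assumes "\<And>M f. (\<forall>i\<le>n. M i \<in> \<C>) \<Longrightarrow> (\<forall>i<n. is_ghost_wrt R \<S> (M i) (M (Suc i)) (f i)) \<Longrightarrow>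
     stably_zero R (M 0) (M n) (composite f n)"
  shows "ghost_number_wrt R \<S> \<C> \<le> enat n"
  unfolding ghost_number_wrt_def by (rule Inf_lower) (use assms in blast)

lemma V_ghost_comp_stably_zero:
  fixes M N L :: "('g \<Rightarrow> 'k, 'u) module"
  assumes "md M" "md N" "md L" "V_ghost M N f" "V_ghost N L g" "\<And>x. F x = g (f x)"
  shows "stably_zero R M L F"
proof -
  obtain h where "h \<in> Lin M L" "\<And>x. x \<in> carrier M \<Longrightarrow> g (f x) = tr M L h x"
    by (rule V_ghost_comp[OF assms(1-5)]) (assumption | rule that)+
  then show ?thesis using stably_zero_iff_tr[OF assms(1,3)] assms(6) by auto
qed

theorem simple_ghost_number_eq_2: "simple_ghost_number TYPE('k) TYPE('u) G = 2"
proof (rule antisym)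
  have "simple_ghost_number TYPE('k) TYPE('u) G \<le> enat 2"
    unfolding simple_ghost_number_def Let_def
  proof (rule ghost_number_le)
    fix M :: "nat \<Rightarrow> ('g \<Rightarrow> 'k, 'u) module" and f
    assume M: "\<forall>i\<le>2. M i \<in> stmod R" and f: "\<forall>i<2. is_ghost_wrt R {S. simple_module R S} (M i) (M (Suc i)) (f i)"
    have md: "md (M 0)" "md (M 1)" "md (M 2)" using M by (auto simp: stmod_def)
    have "V_ghost (M 0) (M 1) (f 0)" "V_ghost (M 1) (M 2) (f 1)"
      using simple_ghost_V_ghost[OF md(1,2)] simple_ghost_V_ghost[OF md(2,3)] f
      by (auto simp: numeral_2_eq_2 One_nat_def)
    then show "stably_zero R (M 0) (M 2) (composite f 2)"
      by (rule V_ghost_comp_stably_zero[OF md]) (simp add: numeral_2_eq_2)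
  qed
  then show "simple_ghost_number TYPE('k) TYPE('u) G \<le> 2" by (simp add: numeral_eq_enat)
  show "2 \<le> simple_ghost_number TYPE('k) TYPE('u) G"
    unfolding simple_ghost_number_def Let_def
    by (rule ghost_number_ge_2[OF _ _ phi_simple_ghost]) (rule stmod_finitely_generated[OF L_finitely_generated])+
qed

text \<open>This makes every simple ghost a ghost, so that \<open>phi\<close> bounds the ghost
  number as well.\<close>

lemma trivial_module_simple: "S \<in> trivial_modules G \<Longrightarrow> simple_module R (S :: ('g \<Rightarrow> 'k, 'u) module)"
proof -
  assume S: "S \<in> trivial_modules G"
  then obtain f where md: "md S" and f: "f \<in> left_module_hom R S (trivial_module G)" "bij_betw f (carrier S) UNIV"
    by (auto simp: trivial_modules_def left_module_isomorphic_def trivial_module_def)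
  have delta_sum: "(\<Sum>g\<in>carrier G. delta h c g) = c" if "h \<in> carrier G" for h c
    using that by (simp add: delta_def)
  have f_smult: "f (delta h c \<odot>\<^bsub>S\<^esub> x) = c * f x" if "h \<in> carrier G" "x \<in> carrier S" for h c x
    using hom_smult[OF f(1) delta_closed[OF that(1)] that(2), of c] that(1)
    by (simp add: trivial_module_def delta_sum)
  have inj: "x = y" if "x \<in> carrier S" "y \<in> carrier S" "f x = f y" for x y
    using f(2) that by (auto simp: bij_betw_def inj_on_def)
  obtain x where x: "x \<in> carrier S" "f x = 1"
    using f(2) by (metis UNIV_I bij_betw_imp_surj_on imageE)
  have eig: "eigenvector S 0 x"
    using x md f_smult by (auto simp: eigenvector_def ac_def intro!: inj ac_closed[unfolded ac_def])
  have "f \<zero>\<^bsub>S\<^esub> = 0" using f_smult[of \<one> "\<zero>\<^bsub>S\<^esub>" 0] md sc_zero_right[OF md, of 0] by (simp add: sc_def)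
  then have nz: "x \<noteq> \<zero>\<^bsub>S\<^esub>" using x by auto
  have "y \<in> range (\<lambda>c. sc S c x)" if "y \<in> carrier S" for y
  proof (rule image_eqI)
    show "y = sc S (f y) x" using that x md f_smult[of \<one> x] by (intro inj) (auto simp: sc_def intro!: sc_closed[unfolded sc_def])
  qed simp
  then have "range (\<lambda>c. sc S c x) = carrier S" using x md by auto
  then have "line S x = S" by (simp add: line_def)
  then show "simple_module R S" using line_simple[OF md eig nz] by simp
qed

lemma ghost_number_ge: "2 \<le> ghost_number TYPE('k) TYPE('u) G"
  unfolding ghost_number_def Let_def
proof (rule ghost_number_ge_2)
  show "T 0 {0, 1} \<in> Thick R (trivial_modules G)" "T 2 {0, 1} \<in> Thick R (trivial_modules G)"
    unfolding Thick_def using L_thick by blast+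
  show "is_ghost_wrt R (trivial_modules G) (T 0 {0, 1}) (T 2 {0, 1}) (lift phi)"
    using phi_simple_ghost trivial_module_simple unfolding is_ghost_wrt_def by blast
qed

theorem ghost_number_eq_2:
  assumes "A = {1}"
  shows "ghost_number TYPE('k) TYPE('u) G = 2"
proof (rule antisym)
  have "ghost_number TYPE('k) TYPE('u) G \<le> enat 2"
    unfolding ghost_number_def Let_def
  proof (rule ghost_number_le)
    fix M :: "nat \<Rightarrow> ('g \<Rightarrow> 'k, 'u) module" and f
    assume M: "\<forall>i\<le>2. M i \<in> Thick R (trivial_modules G)"
      and f: "\<forall>i<2. is_ghost_wrt R (trivial_modules G) (M i) (M (Suc i)) (f i)"
    have md: "md (M 0)" "md (M 1)" "md (M 2)" using M by (auto intro: Thick_md)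
    have "V_ghost (M 0) (M 1) (f 0)" "V_ghost (M 1) (M 2) (f 1)"
      using trivial_ghost_V_ghost[OF assms md(1,2)] trivial_ghost_V_ghost[OF assms md(2,3)] f
      by (auto simp: numeral_2_eq_2 One_nat_def)
    then show "stably_zero R (M 0) (M 2) (composite f 2)"
      by (rule V_ghost_comp_stably_zero[OF md]) (simp add: numeral_2_eq_2)
  qed
  then show "ghost_number TYPE('k) TYPE('u) G \<le> 2" by (simp add: numeral_eq_enat)
qed (rule ghost_number_ge)

text \<open>Four ghosts are grouped in two pairs; each pair composes to a \<open>V_ghost\<close>,
  and a composite of two of these is a trace.\<close>

theorem ghost_number_le_4: "ghost_number TYPE('k) TYPE('u) G \<le> 4"
proof -
  have "ghost_number TYPE('k) TYPE('u) G \<le> enat 4"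
    unfolding ghost_number_def Let_def
  proof (rule ghost_number_le)
    fix M :: "nat \<Rightarrow> ('g \<Rightarrow> 'k, 'u) module" and f
    assume M: "\<forall>i\<le>4. M i \<in> Thick R (trivial_modules G)"
      and f: "\<forall>i<4. is_ghost_wrt R (trivial_modules G) (M i) (M (Suc i)) (f i)"
    have md: "md (M i)" if "i \<le> 4" for i using M that by (auto intro: Thick_md)
    have g: "is_ghost_wrt R (trivial_modules G) (M i) (M (Suc i)) (f i)" if "i < 4" for i using f that by blast
    have "V_ghost (M 0) (M (Suc (Suc 0))) (f (Suc 0) \<circ> f 0)"
      by (rule two_trivial_ghosts_V_ghost[OF _ _ _ g g]) (auto intro: md)
    moreover have "V_ghost (M (Suc (Suc 0))) (M (Suc (Suc (Suc (Suc 0))))) (f (Suc (Suc (Suc 0))) \<circ> f (Suc (Suc 0)))"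
      by (rule two_trivial_ghosts_V_ghost[OF _ _ _ g g]) (auto intro: md)
    ultimately have "stably_zero R (M 0) (M (Suc (Suc (Suc (Suc 0))))) (composite f (Suc (Suc (Suc (Suc 0)))))"
      by (rule V_ghost_comp_stably_zero[rotated 3]) (auto intro: md)
    then show "stably_zero R (M 0) (M 4) (composite f 4)" by (simp add: numeral_eq_Suc)
  qed
  then show ?thesis by (simp add: numeral_eq_enat)
qed

end

section \<open>The alternating group on four letters\<close>

text \<open>The four moments are embedded into the universe one by one by \<iota>, and the resulting
  4-tuple is coded by a single element.\<close>

lemma ex_encoding:
  fixes \<iota> :: "'k::zero \<Rightarrow> 'u"
  assumes "infinite (UNIV :: 'u set)" and \<iota>: "inj \<iota>"
  obtains J :: "(nat \<Rightarrow> 'k) \<Rightarrow> 'u" and J' where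
    "\<And>m. (\<And>i. i \<notin> {0, 1, 2, 3} \<Longrightarrow> m i = 0) \<Longrightarrow> J' (J m) = m"
proof -
  obtain J0 :: "(nat \<Rightarrow> 'u) \<Rightarrow> 'u" where J0: "inj_on J0 ({0, 1, 2, 3} \<rightarrow>\<^sub>E UNIV)"
    using ex_inj_on_PiE[OF assms(1), of "{0, 1, 2, 3 :: nat}"] by auto
  define B where "B = {m :: nat \<Rightarrow> 'k. \<forall>i. i \<notin> {0, 1, 2, 3} \<longrightarrow> m i = 0}"
  define J where "J m = J0 (\<lambda>i\<in>{0, 1, 2, 3}. \<iota> (m i))" for m
  have "inj_on J B"
  proof (rule inj_onI)
    fix m n assume mn: "m \<in> B" "n \<in> B" "J m = J n"
    have eq: "(\<lambda>i\<in>{0, 1, 2, 3}. \<iota> (m i)) = (\<lambda>i\<in>{0, 1, 2, 3}. \<iota> (n i))"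
      by (rule inj_onD[OF J0]) (use mn(3) in \<open>auto simp: J_def\<close>)
    show "m = n"
    proof
      fix i
      show "m i = n i"
      proof (cases "i \<in> {0, 1, 2, 3}")
        case True
        then have "\<iota> (m i) = \<iota> (n i)" using fun_cong[OF eq, of i] by (simp only: restrict_apply if_True)
        then show ?thesis using \<iota> by (simp add: inj_eq)
      qed (use mn in \<open>auto simp: B_def\<close>)
    qed
  qed
  then have inv: "inv_into B J (J m) = m" if "m \<in> B" for m using that by simp
  show thesis by (rule that[of "inv_into B J" J], rule inv) (simp add: B_def)
qed

section \<open>Identification of permutations with affine maps\<close>

context F4
begin

definition label :: "nat \<Rightarrow> 'k" where
  "label i = (if i = 1 then 0 else if i = 2 then 1 else if i = 3 then \<omega> else \<omega> + 1)"

text \<open>For an affine map the constant term is the image of the point 0, labelled by 1, and the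
  linear coefficient is the difference of the images of the points 1 and 0; in characteristic two
  the difference is a sum.\<close>

definition slope :: "(nat \<Rightarrow> nat) \<Rightarrow> 'k" where "slope p = label (p 2) + label (p 1)"
definition offset :: "(nat \<Rightarrow> nat) \<Rightarrow> 'k" where "offset p = label (p 1)"

definition affine :: "(nat \<Rightarrow> nat) \<Rightarrow> bool" where
  "affine p \<longleftrightarrow> (\<forall>i\<in>{1, 2, 3, 4}. label (p i) = slope p * label i + offset p)"

lemma affine_comp:
  assumes p: "affine p" and q: "affine q" "q ` {1, 2, 3, 4} \<subseteq> {1, 2, 3, 4}"
  shows "affine (p \<circ> q)" "slope (p \<circ> q) = slope p * slope q" "offset (p \<circ> q) = slope p * offset q + offset p"
proof -
  have *: "label (p (q i)) = slope p * (slope q * label i + offset q) + offset p" if "i \<in> {1, 2, 3, 4}" for i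
  proof -
    have "q i \<in> {1, 2, 3, 4}" using q(2) that by blast
    then have "label (p (q i)) = slope p * label (q i) + offset p" using p unfolding affine_def by blast
    also have "label (q i) = slope q * label i + offset q" using q(1) that unfolding affine_def by blast
    finally show ?thesis .
  qed
  show o: "offset (p \<circ> q) = slope p * offset q + offset p"
    using *[of 1] by (simp add: offset_def label_def)
  show s: "slope (p \<circ> q) = slope p * slope q"
    using *[of 1] *[of 2] by (simp add: slope_def[of "p \<circ> q"] label_def algebra_simps)
  show "affine (p \<circ> q)"
    unfolding affine_def o s using * by (simp add: algebra_simps)
qed

abbreviation "A4 \<equiv> alt_group 4"
text \<open>The translation by 1. The next two permutations are the translation by \<omega> and the
  multiplication by \<omega>, which fixes 0 and rotates the other points; together they generate all
  affine maps considered here.\<close>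

abbreviation "tr_a \<equiv> transpose 1 2 \<circ> transpose 3 (4::nat)"
abbreviation "tr_b \<equiv> transpose 1 3 \<circ> transpose 2 (4::nat)"
abbreviation "rot \<equiv> transpose 2 3 \<circ> transpose 3 (4::nat)"

lemma A4_image: "p \<in> carrier A4 \<Longrightarrow> p ` {1, 2, 3, 4} \<subseteq> {1, 2, 3, 4}"
proof -
  assume "p \<in> carrier A4"
  then have "p permutes {1..4}" by (simp add: alt_group_carrier)
  then have "p ` {1..4} = {1..4}" by (rule permutes_image)
  moreover have "{1..4} = {1, 2, 3, 4 :: nat}" by auto
  ultimately show ?thesis by simp
qed

lemma A4_mult: "p \<otimes>\<^bsub>A4\<^esub> q = p \<circ> q" and A4_one: "\<one>\<^bsub>A4\<^esub> = id"
  by (simp_all add: alt_group_mult alt_group_one)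

lemma A4_comp: "p \<in> carrier A4 \<Longrightarrow> q \<in> carrier A4 \<Longrightarrow> p \<circ> q \<in> carrier A4"
  using group.is_monoid[OF alt_group_is_group[of 4]] monoid.m_closed[of A4 p q] by (simp add: A4_mult)

lemma generators:
  "id \<in> carrier A4" "tr_a \<in> carrier A4" "tr_b \<in> carrier A4" "rot \<in> carrier A4"
  by (auto simp: alt_group_carrier permutes_id evenperm_id evenperm_comp evenperm_swap permutation_swap_id
      intro!: permutes_compose permutes_swap_id)

lemma generators_affine:
  "affine id" "affine tr_a" "affine tr_b" "affine rot"
  "slope id = 1" "slope tr_a = 1" "slope tr_b = 1" "slope rot = \<omega>"
  "offset id = 0" "offset tr_a = 1" "offset tr_b = \<omega>" "offset rot = 0"
  by (auto simp: affine_def slope_def offset_def label_def transpose_def algebra_simps)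

lemma ex_affine:
  assumes "a \<in> {1, \<omega>, \<omega> ^ 2}" "b \<in> {0, 1, \<omega>, \<omega> ^ 2}"
  shows "\<exists>p\<in>carrier A4. affine p \<and> slope p = a \<and> offset p = b"
proof -
  define good where "good p a b \<longleftrightarrow> p \<in> carrier A4 \<and> affine p \<and> slope p = a \<and> offset p = b" for p a b
  have comp: "good (p \<circ> q) (a * a') (a * b' + b)" if "good p a b" "good q a' b'" for p q a b a' b'
    using that affine_comp[of p q] A4_comp[of p q] A4_image[of q] by (auto simp: good_def)
  have gens: "good id 1 0" "good tr_a 1 1" "good tr_b 1 \<omega>" "good rot \<omega> 0"
    using generators generators_affine by (simp_all add: good_def)
  have rots: "\<exists>p. good p a 0"
    using assms(1) comp[OF gens(4) gens(4)] gens by (auto simp: power2_eq_square)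
  moreover have "\<exists>p. good p 1 b"
    using assms(2) comp[OF gens(2) gens(3)] gens omega by auto
  ultimately obtain p q where "good p a 0" "good q 1 b" by blast
  then have "good (q \<circ> p) a b" using comp[of q 1 b p a 0] by simp
  then show ?thesis by (auto simp: good_def)
qed

lemma card_A4: "card (carrier A4) = 12"
  using alt_group_card_carrier[of 4] by (simp add: fact_numeral)

text \<open>Counting: there are 12 pairs of slope and offset, each realised by an affine even
  permutation, and the alternating group has 12 elements. Hence all its elements are affine, and
  slope and offset determine them.\<close>

lemma
  shows A4_bij: "bij_betw (\<lambda>p. (slope p, offset p)) (carrier A4) ({1, \<omega>, \<omega> ^ 2} \<times> {0, 1, \<omega>, \<omega> ^ 2})"
    and A4_affine: "p \<in> carrier A4 \<Longrightarrow> affine p"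
proof -
  let ?F = "{1, \<omega>, \<omega> ^ 2} \<times> {0, 1, \<omega>, \<omega> ^ 2}" and ?f = "\<lambda>p. (slope p, offset p)"
  let ?S = "{p \<in> carrier A4. affine p}"
  have fin: "finite (carrier A4)" using card_A4 by (metis card.infinite zero_neq_numeral)
  have cardF: "card ?F = 12" using omega by (simp add: card_cartesian_product)
  have sub: "?F \<subseteq> ?f ` ?S"
  proof
    fix x assume "x \<in> ?F"
    then have "fst x \<in> {1, \<omega>, \<omega> ^ 2}" "snd x \<in> {0, 1, \<omega>, \<omega> ^ 2}" by (simp_all only: mem_Times_iff)
    from ex_affine[OF this] obtain p where "p \<in> carrier A4" "affine p" "slope p = fst x" "offset p = snd x"
      by blast
    then show "x \<in> ?f ` ?S" by (intro image_eqI[of _ _ p]) simp_all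
  qed
  have "12 \<le> card (?f ` ?S)"
    using card_mono[OF _ sub] fin cardF by simp
  also have "\<dots> \<le> card ?S" using fin by (intro card_image_le) simp
  finally have "?S = carrier A4"
    using fin card_A4 by (intro card_seteq) auto
  then show aff: "affine p" if "p \<in> carrier A4" for p using that by blast
  have le: "card (?f ` carrier A4) \<le> 12" using card_image_le[OF fin, of ?f] card_A4 by simp
  have sub': "?F \<subseteq> ?f ` carrier A4" using sub by blast
  have eq: "?F = ?f ` carrier A4"
    using fin le cardF by (intro card_seteq sub') auto
  have "inj_on ?f (carrier A4)"
    using fin cardF card_A4 eq by (intro eq_card_imp_inj_on) auto
  with eq show "bij_betw ?f (carrier A4) ?F" by (simp add: bij_betw_def)
qed

lemma A4_slope_mult:
  "p \<in> carrier A4 \<Longrightarrow> q \<in> carrier A4 \<Longrightarrow> slope (p \<otimes>\<^bsub>A4\<^esub> q) = slope p * slope q"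
  and A4_offset_mult:
  "p \<in> carrier A4 \<Longrightarrow> q \<in> carrier A4 \<Longrightarrow> offset (p \<otimes>\<^bsub>A4\<^esub> q) = slope p * offset q + offset p"
  using affine_comp A4_affine A4_image by (auto simp: A4_mult)

lemma A4_affine_group:
  assumes "infinite (UNIV :: 'u set)"
  shows "affine_group TYPE('u) A4 \<omega> slope offset {1, \<omega>, \<omega> ^ 2}"
proof -
  interpret group A4 by (rule alt_group_is_group)
  show ?thesis
  proof
    show "finite (carrier A4)" using card_A4 by (metis card.infinite zero_neq_numeral)
  qed (use assms two omega A4_slope_mult A4_offset_mult A4_bij in auto)
qed

text \<open>The fourth power of each element of \<open>V\<close> is the identity, while its slope is
  a cube root of unity, so the slope is 1. The four elements then have distinct offsets, which
  exhaust the field with four elements.\<close>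

lemma sylow_affine_group:
  assumes "infinite (UNIV :: 'u set)" and V: "sylow_subgroup 2 V A4"
  shows "affine_group TYPE('u) (A4\<lparr>carrier := V\<rparr>) \<omega> slope offset {1}"
proof -
  interpret G: group A4 by (rule alt_group_is_group)
  have sub: "subgroup V A4" using V by (simp add: sylow_subgroup_def)
  interpret V: group "A4\<lparr>carrier := V\<rparr>" by (rule G.subgroup_imp_group[OF sub])
  have Vc: "V \<subseteq> carrier A4" by (rule subgroup.subset[OF sub])
  have "multiplicity 2 (12::nat) = 2" by (rule multiplicity_eqI) simp_all
  then have card: "card V = 4"
    using V by (simp add: sylow_subgroup_def order_def card_A4)
  then have fin: "finite V" by (metis card.infinite zero_neq_numeral)
  have one: "slope v = 1" if v: "v \<in> V" for v
  proof -
    have pow: "slope (v [^]\<^bsub>A4\<^esub> n) = slope v ^ n" for n :: nat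
    proof (induction n)
      case 0
      then show ?case by (simp only: G.nat_pow_0 A4_one generators_affine(5) power_0)
    next
      case (Suc n)
      have "v \<in> carrier A4" using v Vc by blast
      then show ?case using Suc by (simp add: A4_slope_mult mult.commute)
    qed
    have "v [^]\<^bsub>A4\<lparr>carrier := V\<rparr>\<^esub> order (A4\<lparr>carrier := V\<rparr>) = \<one>\<^bsub>A4\<lparr>carrier := V\<rparr>\<^esub>"
      using v by (intro V.pow_order_eq_1) simp
    then have "v [^]\<^bsub>A4\<^esub> (4::nat) = \<one>\<^bsub>A4\<^esub>"
      by (simp add: order_def card G.nat_pow_consistent[symmetric])
    then have 4: "slope v ^ 4 = 1" using pow[of 4] by (simp only: A4_one generators_affine(5))
    have "slope v \<in> {1, \<omega>, \<omega> ^ 2}" using A4_bij v Vc by (auto simp: bij_betw_def)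
    with 4 show ?thesis using omega by (auto simp: eval_nat_numeral algebra_simps)
  qed
  have inj: "inj_on (\<lambda>p. (slope p, offset p)) V"
    by (rule inj_on_subset[OF bij_betw_imp_inj_on[OF A4_bij] Vc])
  have "offset v \<in> {0, 1, \<omega>, \<omega> ^ 2}" if "v \<in> V" for v
  proof -
    have "(slope v, offset v) \<in> {1, \<omega>, \<omega> ^ 2} \<times> {0, 1, \<omega>, \<omega> ^ 2}"
      using bij_betw_apply[OF A4_bij, of v] that Vc by blast
    then show ?thesis by (rule SigmaD2)
  qed
  with one have "(\<lambda>p. (slope p, offset p)) ` V \<subseteq> {1} \<times> {0, 1, \<omega>, \<omega> ^ 2}"
    by (intro image_subsetI SigmaI singletonI) simp_all
  then have "(\<lambda>p. (slope p, offset p)) ` V = {1} \<times> {0, 1, \<omega>, \<omega> ^ 2}"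
    using card omega by (intro card_seteq) (simp_all add: card_image[OF inj] card_cartesian_product)
  with inj have bij: "bij_betw (\<lambda>p. (slope p, offset p)) V ({1} \<times> {0, 1, \<omega>, \<omega> ^ 2})"
    by (simp add: bij_betw_def)
  show ?thesis
  proof
    show "finite (carrier (A4\<lparr>carrier := V\<rparr>))" using fin by simp
  qed (use assms two omega A4_slope_mult A4_offset_mult bij subsetD[OF Vc] in auto)
qed

end

text \<open>The infinite universe makes room for induced modules; the embedding of k into it makes
  room for the explicit modules with up to four moments.\<close>

theorem proposition3p5:
  fixes \<zeta> :: "'k::field" and V :: "(nat \<Rightarrow> nat) set"
  assumes "CHAR('k) = 2"
    and "\<zeta> ^ 3 = 1" and "\<forall>m. 0 < m \<and> m < 3 \<longrightarrow> \<zeta> ^ m \<noteq> 1"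
    and "sylow_subgroup 2 V (alt_group 4)"
    and universe: "infinite (UNIV :: 'u set)" "\<exists>\<iota> :: 'k \<Rightarrow> 'u. inj \<iota>"
  shows "simple_ghost_number TYPE('k) TYPE('u) (alt_group 4) =
           ghost_number TYPE('k) TYPE('u) (alt_group 4 \<lparr>carrier := V\<rparr>) \<and>
         ghost_number TYPE('k) TYPE('u) (alt_group 4 \<lparr>carrier := V\<rparr>) = 2 \<and>
         2 \<le> ghost_number TYPE('k) TYPE('u) (alt_group 4) \<and>
         ghost_number TYPE('k) TYPE('u) (alt_group 4) \<le> 4"
proof -
  have two: "(1::'k) + 1 = 0"
    using of_nat_CHAR[where 'a = 'k] unfolding assms(1) by (simp only: of_nat_numeral one_add_one)
  have "\<zeta> ^ 1 \<noteq> 1" by (rule assms(3)[rule_format]) simp_all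
  then have "\<zeta> \<noteq> 1" by (simp only: power_one_right not_False_eq_True)
  \<comment> \<open>Since \<zeta> is not 1, it is a root of x^2 + x + 1, and in characteristic two
    this is the relation required of \<omega>.\<close>
  have "(\<zeta> - 1) * (\<zeta> ^ 2 + (\<zeta> + 1)) = \<zeta> ^ 3 - 1"
    by (simp add: algebra_simps power2_eq_square power3_eq_cube)
  also have "\<dots> = 0" by (simp only: assms(2) diff_self)
  finally have "(\<zeta> - 1) * (\<zeta> ^ 2 + (\<zeta> + 1)) = 0" .
  with \<open>\<zeta> \<noteq> 1\<close> have "\<zeta> ^ 2 + (\<zeta> + 1) = 0" by (simp only: mult_eq_0_iff right_minus_eq) blast
  moreover have "(\<zeta> + 1) + (\<zeta> + 1) = 0"
    using two by (metis distrib_left mult.right_neutral mult_zero_right)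
  ultimately have omega: "\<zeta> ^ 2 = \<zeta> + 1" by (metis add_right_cancel)
  interpret F4: F4 \<zeta> by standard (rule two omega)+
  obtain J :: "(nat \<Rightarrow> 'k) \<Rightarrow> 'u" and J' where
    J: "\<And>m. (\<And>i. i \<notin> {0, 1, 2, 3} \<Longrightarrow> m i = 0) \<Longrightarrow> J' (J m) = m"
    using universe(2) ex_encoding[OF universe(1)] by metis
  \<comment> \<open>Both groups use the same slope, offset and coding; only the range of the slopes
    differs.\<close>
  interpret A4: affine_group_copy "alt_group 4" "TYPE('k)" "TYPE('u)" \<zeta> "F4.slope" "F4.offset" "{1, \<zeta>, \<zeta> ^ 2}" J J'
    using F4.A4_affine_group[OF universe(1)] J
    by (simp add: affine_group_copy_def affine_group_copy_axioms_def)
  interpret V: affine_group_copy "alt_group 4\<lparr>carrier := V\<rparr>" "TYPE('k)" "TYPE('u)" \<zeta> "F4.slope" "F4.offset" "{1}" J J'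
    using F4.sylow_affine_group[OF universe(1) assms(4)] J
    by (simp add: affine_group_copy_def affine_group_copy_axioms_def)
  show ?thesis
    using A4.simple_ghost_number_eq_2 V.ghost_number_eq_2 A4.ghost_number_ge A4.ghost_number_le_4 by simp
qed

end
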